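(* Let $G$ be a complex semisimple Lie group with Weyl group $W$, and let $I\subset W$ be a fat ideal. (i) If $G$ has no simple factors of type $A_1$, then $I$ contains each element $w\in W$ with $\ell(w)\leq 1$. (ii) If $G$ has no simple factors of type $A_1$, $A_2$, $A_3$, or $B_2$, then $I$ contains each element $w\in W$ with $\ell(w)\leq 2$.
   Context: The simple factors of $G$ are the simple Lie algebra summands of its Lie algebra $\mathfrak{g}$, with types in the Cartan classification (under the exceptional isomorphisms the excluded types also include $B_1,C_1,C_2,D_3$). $W$ is a Coxeter group generated by the simple root reflections for a fixed choice of simple roots, $\ell$ is the corresponding word length, and $w_0\in W$ is the unique longest element. The Chevalley-Bruhat order on $W$: $x\leq y$ iff $x$ is represented by a subword (delete zero or more letters) of a reduced word for $y$. An ideal is a subset $I\subset W$ that is downward closed for this order. Its orthogonal is the ideal $I^\perp=w_0(W\setminus I)$; $I$ is fat if $I\supset I^\perp$. *)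

theory Defs
  imports Complex_Main "HOL-Library.Sublist" "HOL-Algebra.Bij" "HOL-Algebra.Generated_Groups"
begin

section \<open>Complex Lie algebras\<close>

text \<open>A complex semisimple Lie group is one whose Lie algebra is semisimple; its Weyl group and its
  simple factors are those of the Lie algebra, which is therefore taken as the basic datum.\<close>

locale complex_lie_algebra = vector_space scale
  for scale :: "complex \<Rightarrow> 'g::ab_group_add \<Rightarrow> 'g" (infixr "*s" 75) +
  fixes bracket :: "'g \<Rightarrow> 'g \<Rightarrow> 'g"
  assumes finite_dim: "\<exists>B. finite B \<and> span B = UNIV"
    and bracket_add_left: "bracket (x + y) z = bracket x z + bracket y z"
    and bracket_add_right: "bracket x (y + z) = bracket x y + bracket x z"
    and bracket_scale_left: "bracket (c *s x) y = c *s bracket x y"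
    and bracket_scale_right: "bracket x (c *s y) = c *s bracket x y"
    and bracket_self: "bracket x x = 0"
    and jacobi: "bracket x (bracket y z) + bracket y (bracket z x) + bracket z (bracket x y) = 0"
begin

text \<open>All notions below are relative to a subalgebra \<open>L\<close> of the ambient Lie algebra, so that they
  apply both to the whole Lie algebra (\<open>L = UNIV\<close>) and to its simple ideals.\<close>

definition lie_subalgebra :: "'g set \<Rightarrow> bool" where
  "lie_subalgebra L \<longleftrightarrow> subspace L \<and> (\<forall>x\<in>L. \<forall>y\<in>L. bracket x y \<in> L)"

definition lie_ideal :: "'g set \<Rightarrow> 'g set \<Rightarrow> bool" where
  "lie_ideal L J \<longleftrightarrow> subspace J \<and> J \<subseteq> L \<and> (\<forall>x\<in>L. \<forall>y\<in>J. bracket x y \<in> J)"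

primrec derived_series :: "'g set \<Rightarrow> nat \<Rightarrow> 'g set" where
  "derived_series J 0 = J"
| "derived_series J (Suc n) =
     span {bracket x y | x y. x \<in> derived_series J n \<and> y \<in> derived_series J n}"

definition solvable_lie :: "'g set \<Rightarrow> bool" where
  "solvable_lie J \<longleftrightarrow> (\<exists>n. derived_series J n = {0})"

definition semisimple_lie :: "'g set \<Rightarrow> bool" where
  "semisimple_lie L \<longleftrightarrow>
     lie_subalgebra L \<and> (\<forall>J. lie_ideal L J \<and> solvable_lie J \<longrightarrow> J = {0})"

definition simple_lie :: "'g set \<Rightarrow> bool" where
  "simple_lie L \<longleftrightarrow>
     lie_subalgebra L \<and> (\<exists>x\<in>L. \<exists>y\<in>L. bracket x y \<noteq> 0) \<and>
     (\<forall>J. lie_ideal L J \<longrightarrow> J = {0} \<or> J = L)"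

text \<open>A semisimple Lie algebra is the direct sum of its simple ideals, so the simple summands are
  exactly the ideals that are simple as Lie algebras.\<close>

definition simple_factor :: "'g set \<Rightarrow> 'g set \<Rightarrow> bool" where
  "simple_factor L S \<longleftrightarrow> lie_ideal L S \<and> simple_lie S"

section \<open>Cartan subalgebras, roots and the Weyl group\<close>

text \<open>For semisimple \<open>L\<close>: a self-centralizing commutative subalgebra whose elements act
  diagonalizably on \<open>L\<close>.\<close>

definition cartan_subalgebra :: "'g set \<Rightarrow> 'g set \<Rightarrow> bool" where
  "cartan_subalgebra L H \<longleftrightarrow>
     lie_subalgebra H \<and> H \<subseteq> L \<and>
     (\<forall>h\<in>H. \<forall>k\<in>H. bracket h k = 0) \<and>
     (\<forall>x\<in>L. (\<forall>h\<in>H. bracket h x = 0) \<longrightarrow> x \<in> H) \<and>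
     (\<forall>h\<in>H. L \<subseteq> span {x \<in> L. \<exists>c. bracket h x = c *s x})"

text \<open>Functionals on \<open>H\<close> are normalised to vanish outside \<open>H\<close>, so that equality in the dual space
  is equality of functions.\<close>

definition dual_space :: "'g set \<Rightarrow> ('g \<Rightarrow> complex) set" where
  "dual_space H = {f. (\<forall>h\<in>H. \<forall>k\<in>H. f (h + k) = f h + f k) \<and>
                      (\<forall>c. \<forall>h\<in>H. f (c *s h) = c * f h) \<and> (\<forall>x. x \<notin> H \<longrightarrow> f x = 0)}"

definition root_space :: "'g set \<Rightarrow> 'g set \<Rightarrow> ('g \<Rightarrow> complex) \<Rightarrow> 'g set" where
  "root_space L H \<alpha> = {x \<in> L. \<forall>h\<in>H. bracket h x = \<alpha> h *s x}"

definition roots :: "'g set \<Rightarrow> 'g set \<Rightarrow> ('g \<Rightarrow> complex) set" where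
  "roots L H = {\<alpha> \<in> dual_space H. \<alpha> \<noteq> (\<lambda>h. 0) \<and> root_space L H \<alpha> \<noteq> {0}}"

text \<open>The coroot of \<open>\<alpha>\<close> is the unique element \<open>t\<close> of \<open>[L\<^sub>\<alpha>, L\<^sub>-\<^sub>\<alpha>]\<close> with \<open>\<alpha>(t) = 2\<close>. For semisimple
  \<open>L\<close> the root spaces are one-dimensional, so it is a single bracket.\<close>

definition coroot :: "'g set \<Rightarrow> 'g set \<Rightarrow> ('g \<Rightarrow> complex) \<Rightarrow> 'g" where
  "coroot L H \<alpha> = (THE t. (\<exists>x\<in>root_space L H \<alpha>. \<exists>y\<in>root_space L H (\<lambda>h. - \<alpha> h). t = bracket x y)
                          \<and> \<alpha> t = 2)"

text \<open>Simple roots: linearly independent, and every root is a nonnegative or a nonpositive integer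
  combination of them. (For semisimple \<open>L\<close> the roots span the dual of \<open>H\<close> and are finite in
  number, so such a \<open>\<Delta>\<close> is a basis of the dual.)\<close>

definition simple_roots :: "'g set \<Rightarrow> 'g set \<Rightarrow> ('g \<Rightarrow> complex) set \<Rightarrow> bool" where
  "simple_roots L H \<Delta> \<longleftrightarrow>
     finite \<Delta> \<and> \<Delta> \<subseteq> roots L H \<and>
     (\<forall>c :: ('g \<Rightarrow> complex) \<Rightarrow> complex.
        (\<forall>h\<in>H. (\<Sum>\<alpha>\<in>\<Delta>. c \<alpha> * \<alpha> h) = 0) \<longrightarrow> (\<forall>\<alpha>\<in>\<Delta>. c \<alpha> = 0)) \<and>
     (\<forall>\<beta>\<in>roots L H. \<exists>n :: ('g \<Rightarrow> complex) \<Rightarrow> nat.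
        (\<forall>h\<in>H. \<beta> h = (\<Sum>\<alpha>\<in>\<Delta>. of_nat (n \<alpha>) * \<alpha> h)) \<or>
        (\<forall>h\<in>H. \<beta> h = - (\<Sum>\<alpha>\<in>\<Delta>. of_nat (n \<alpha>) * \<alpha> h)))"

text \<open>The Weyl group is realised by its action on the Cartan subalgebra (contragredient to the
  action on the dual), inside the group of all bijections of \<open>H\<close>.\<close>

definition reflection :: "'g set \<Rightarrow> 'g set \<Rightarrow> ('g \<Rightarrow> complex) \<Rightarrow> 'g \<Rightarrow> 'g" where
  "reflection L H \<alpha> = (\<lambda>h\<in>H. h - \<alpha> h *s coroot L H \<alpha>)"

definition simple_reflections :: "'g set \<Rightarrow> 'g set \<Rightarrow> ('g \<Rightarrow> complex) set \<Rightarrow> ('g \<Rightarrow> 'g) set" where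
  "simple_reflections L H \<Delta> = reflection L H ` \<Delta>"

definition weyl_group :: "'g set \<Rightarrow> 'g set \<Rightarrow> ('g \<Rightarrow> complex) set \<Rightarrow> ('g \<Rightarrow> 'g) monoid" where
  "weyl_group L H \<Delta> = subgroup_generated (BijGroup H) (simple_reflections L H \<Delta>)"

section \<open>Cartan types\<close>

text \<open>\<open>M i j\<close> is the Cartan integer \<open>\<alpha>\<^sub>j(\<alpha>\<^sub>i\<^sup>\<or>)\<close>. Neither the Cartan subalgebra nor the simple roots
  matter, by conjugacy, up to the numbering.\<close>

definition has_cartan_matrix :: "'g set \<Rightarrow> nat \<Rightarrow> (nat \<Rightarrow> nat \<Rightarrow> int) \<Rightarrow> bool" where
  "has_cartan_matrix L n M \<longleftrightarrow>
     (\<exists>H \<alpha>. cartan_subalgebra L H \<and> inj_on \<alpha> {..<n} \<and> simple_roots L H (\<alpha> ` {..<n}) \<and>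
        (\<forall>i<n. \<forall>j<n. \<alpha> j (coroot L H (\<alpha> i)) = of_int (M i j)))"

end

definition cartan_matrix_A :: "nat \<Rightarrow> nat \<Rightarrow> int" where
  "cartan_matrix_A i j = (if i = j then 2 else if i = Suc j \<or> j = Suc i then - 1 else 0)"

text \<open>In type \<open>B\<^sub>n\<close> the last simple root is the short one.\<close>

definition cartan_matrix_B :: "nat \<Rightarrow> nat \<Rightarrow> nat \<Rightarrow> int" where
  "cartan_matrix_B n i j = (if i = Suc j \<and> Suc i = n then - 2 else cartan_matrix_A i j)"

context complex_lie_algebra
begin

definition type_A :: "nat \<Rightarrow> 'g set \<Rightarrow> bool" where
  "type_A n S \<longleftrightarrow> has_cartan_matrix S n cartan_matrix_A"

definition type_B :: "nat \<Rightarrow> 'g set \<Rightarrow> bool" where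
  "type_B n S \<longleftrightarrow> has_cartan_matrix S n (cartan_matrix_B n)"

end

section \<open>Word length, Chevalley--Bruhat order and ideals\<close>

text \<open>\<open>W\<close> is a group and \<open>S\<close> a set of involutions generating it, so that words in \<open>S\<close> need no
  inverse letters.\<close>

definition word_prod :: "('a, 'b) monoid_scheme \<Rightarrow> 'a list \<Rightarrow> 'a" where
  "word_prod W ws = foldr (\<lambda>s w. s \<otimes>\<^bsub>W\<^esub> w) ws \<one>\<^bsub>W\<^esub>"

definition word_length :: "('a, 'b) monoid_scheme \<Rightarrow> 'a set \<Rightarrow> 'a \<Rightarrow> nat" where
  "word_length W S w = (LEAST n. \<exists>ws\<in>lists S. length ws = n \<and> word_prod W ws = w)"

definition reduced_word :: "('a, 'b) monoid_scheme \<Rightarrow> 'a set \<Rightarrow> 'a list \<Rightarrow> 'a \<Rightarrow> bool" where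
  "reduced_word W S ws w \<longleftrightarrow>
     ws \<in> lists S \<and> word_prod W ws = w \<and> length ws = word_length W S w"

definition bruhat_le :: "('a, 'b) monoid_scheme \<Rightarrow> 'a set \<Rightarrow> 'a \<Rightarrow> 'a \<Rightarrow> bool" where
  "bruhat_le W S x y \<longleftrightarrow>
     (\<exists>ys. reduced_word W S ys y \<and> (\<exists>xs. subseq xs ys \<and> word_prod W xs = x))"

definition longest_element :: "('a, 'b) monoid_scheme \<Rightarrow> 'a set \<Rightarrow> 'a" where
  "longest_element W S =
     (THE w. w \<in> carrier W \<and> (\<forall>v\<in>carrier W. word_length W S v \<le> word_length W S w))"

definition bruhat_ideal :: "('a, 'b) monoid_scheme \<Rightarrow> 'a set \<Rightarrow> 'a set \<Rightarrow> bool" where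
  "bruhat_ideal W S I \<longleftrightarrow>
     I \<subseteq> carrier W \<and> (\<forall>y\<in>I. \<forall>x\<in>carrier W. bruhat_le W S x y \<longrightarrow> x \<in> I)"

definition orthogonal_ideal :: "('a, 'b) monoid_scheme \<Rightarrow> 'a set \<Rightarrow> 'a set \<Rightarrow> 'a set" where
  "orthogonal_ideal W S I = (\<lambda>w. longest_element W S \<otimes>\<^bsub>W\<^esub> w) ` (carrier W - I)"

definition fat_ideal :: "('a, 'b) monoid_scheme \<Rightarrow> 'a set \<Rightarrow> 'a set \<Rightarrow> bool" where
  "fat_ideal W S I \<longleftrightarrow> bruhat_ideal W S I \<and> orthogonal_ideal W S I \<subseteq> I"

end

theory Submission
  imports Defs
begin

text \<open>If a fat ideal \<open>I\<close> misses \<open>w\<close>, then \<open>w\<^sub>0 w \<in> I\<close>, so \<open>w\<close> is not below \<open>w\<^sub>0 w\<close> and a reduced word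
  of \<open>w\<^sub>0 w\<close> contains no subword representing \<open>w\<close>. For \<open>w = s\<^sub>i\<close> this puts \<open>w\<^sub>0 s\<^sub>i\<close> into the parabolic
  subgroup without \<open>s\<^sub>i\<close>; comparing the \<open>i\<close>-th coefficients of \<open>w\<^sub>0 \<alpha>\<^sub>k = w\<^sub>0 s\<^sub>i (s\<^sub>i \<alpha>\<^sub>k)\<close>, which is a
  negative root, shows that \<open>i\<close> is an isolated node. For \<open>w = s\<^sub>i s\<^sub>j\<close> either the same argument applies,
  or \<open>i\<close> and \<open>j\<close> are joined and at most two positive roots involve both \<open>\<alpha>\<^sub>i\<close> and \<open>\<alpha>\<^sub>j\<close>; this forces
  the component of \<open>i\<close> to be of type \<open>A\<^sub>2\<close>, \<open>A\<^sub>3\<close> or \<open>B\<^sub>2\<close>.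

  The structure theory uses only that \<open>H\<close> is a self-centralizing torus. An ideal that meets \<open>H\<close>
  trivially is nilpotent by Engel's theorem, hence zero; applied to the part of the root spaces in
  the radical of the Killing form this produces the \<open>sl\<^sub>2\<close>-triples. Conjugacy of reflections,
  \<open>w s\<^sub>i w\<^sup>-\<^sup>1 = s\<^sub>j\<close> if \<open>w \<alpha>\<^sub>i = \<alpha>\<^sub>j\<close>, and with it the exchange condition follow from the finiteness of
  the root system alone.\<close>

section \<open>Brackets and weight vectors\<close>

text \<open>Integrality takes over the part that positivity plays for Euclidean root systems. The
  Killing norm of an element of \<open>H\<close> with integral weights is a sum of integer squares,
  so norm zero forces the element to vanish. The \<open>sl_2\<close>-triples, the uniqueness of the
  coroot and the nonvanishing of its norm all rest on this.

  The bound of two roots comes from the inversions of \<open>s_i s_j\<close>. The longest element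
  makes every positive root negative, so \<open>w0 s_i s_j\<close> keeps exactly those positive
  roots positive that \<open>s_i s_j\<close> makes negative, namely the root of \<open>j\<close> and
  its companion \<open>s_j (e_i)\<close>. The number of positive roots involving two given adjacent
  nodes is one for \<open>A_2\<close>, two for \<open>A_3\<close> and \<open>B_2\<close>, and at
  least three in every other connected diagram. This is where the excluded types come from.

  The combinatorics only yields a block of the Dynkin diagram attached to \<open>H\<close>, whereas
  the hypothesis speaks of simple ideals with a Cartan subalgebra of their own. So the ideal
  belonging to a block has to be built, and its roots and coroots have to be computed inside
  it.\<close>

context complex_lie_algebra
begin

lemma bracket_zero_left [simp]: "bracket 0 x = 0"
  using bracket_scale_left[of 0 x x] by simp

lemma bracket_zero_right [simp]: "bracket x 0 = 0"
  using bracket_scale_right[of x 0 x] by simp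

lemma bracket_anti: "bracket x y = - bracket y x"
proof -
  have "bracket x y + bracket y x = 0"
    using bracket_self[of "x + y"] bracket_self[of x] bracket_self[of y]
    by (simp add: bracket_add_left bracket_add_right add.commute)
  then show ?thesis by (simp add: eq_neg_iff_add_eq_0)
qed

lemma bracket_minus_left [simp]: "bracket (- x) y = - bracket x y"
  using bracket_scale_left[of "-1" x y] by simp

lemma bracket_minus_right [simp]: "bracket x (- y) = - bracket x y"
  using bracket_scale_right[of x "-1" y] by simp

lemma bracket_diff_left: "bracket (x - y) z = bracket x z - bracket y z"
  using bracket_add_left[of x "- y" z] by simp

lemma bracket_diff_right: "bracket z (x - y) = bracket z x - bracket z y"
  using bracket_add_right[of z x "- y"] by simp

lemma bracket_sum_right: "bracket x (sum f A) = (\<Sum>a\<in>A. bracket x (f a))"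
  by (induction A rule: infinite_finite_induct) (auto simp: bracket_add_right)

lemma leibniz: "bracket x (bracket y z) = bracket (bracket x y) z + bracket y (bracket x z)"
proof -
  have "bracket x (bracket y z) + (- bracket y (bracket x z) + - bracket (bracket x y) z) = 0"
    using jacobi[of x y z] by (metis add.assoc bracket_anti bracket_minus_right)
  then show ?thesis by (simp add: algebra_simps eq_neg_iff_add_eq_0)
qed

lemma linear_bracket: "Vector_Spaces.linear scale scale (bracket x)"
  using vector_space_axioms
  by (simp add: Vector_Spaces.linear_iff bracket_add_right bracket_scale_right)

lemma subspace_bracket_right: "subspace U \<Longrightarrow> subspace {y. bracket x y \<in> U}"
  by (auto simp: subspace_def bracket_add_right bracket_scale_right)

lemma subspace_bracket_left: "subspace U \<Longrightarrow> subspace {x. bracket x y \<in> U}"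
  by (auto simp: subspace_def bracket_add_left bracket_scale_left)

lemma bracket_span_in:
  assumes "\<And>x y. x \<in> X \<Longrightarrow> y \<in> Y \<Longrightarrow> bracket x y \<in> U" "subspace U" "x \<in> span X" "y \<in> span Y"
  shows "bracket x y \<in> U"
proof -
  have "span Y \<subseteq> {y. bracket x' y \<in> U}" if "x' \<in> X" for x'
    using assms(1,2) that by (intro span_minimal subspace_bracket_right) auto
  then have "span X \<subseteq> {x. bracket x y \<in> U}"
    using assms(2,4) by (intro span_minimal subspace_bracket_left) auto
  then show ?thesis using assms(3) by auto
qed

text \<open>For \<open>h\<close> separating \<open>j\<close> from the new index \<open>n\<close>,
  the operator \<open>bracket h - w n h\<close> kills the summand \<open>n\<close> and rescales the
  others, by a nonzero factor at \<open>j\<close>. The induction hypothesis is therefore used for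
  rescaled vectors, and \<open>h\<close> may vary with \<open>j\<close>.\<close>

lemma weight_components:
  fixes w :: "'i \<Rightarrow> 'g \<Rightarrow> complex"
  assumes "finite M" "subspace V"
    and stab: "\<And>h x. h \<in> T \<Longrightarrow> x \<in> V \<Longrightarrow> bracket h x \<in> V"
    and "\<And>i h. i \<in> M \<Longrightarrow> h \<in> T \<Longrightarrow> bracket h (v i) = w i h *s v i"
    and "\<And>i j. i \<in> M \<Longrightarrow> j \<in> M \<Longrightarrow> i \<noteq> j \<Longrightarrow> \<exists>h\<in>T. w i h \<noteq> w j h"
    and "sum v M \<in> V" "i \<in> M"
  shows "v i \<in> V"
  using assms(1,4-7)
proof (induction M arbitrary: v i rule: finite_induct)
  case empty
  then show ?case by simp
next
  case (insert n M)
  have *: "v j \<in> V" if jM: "j \<in> M" for j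
  proof -
    obtain h where h: "h \<in> T" "w j h \<noteq> w n h" using insert.prems(2)[of j n] jM insert.hyps by auto
    have "(\<Sum>k\<in>M. (w k h - w n h) *s v k) = bracket h (sum v (insert n M)) - w n h *s sum v (insert n M)"
      using insert h(1)
      by (simp add: bracket_add_right bracket_sum_right scale_right_distrib scale_sum_right
          scale_left_diff_distrib sum_subtractf)
    also have "\<dots> \<in> V"
      using insert.prems(3) h(1) stab assms(2) by (intro subspace_diff subspace_scale) auto
    finally have "(w j h - w n h) *s v j \<in> V"
      using insert.prems(1,2) that
      by (intro insert.IH[where v = "\<lambda>k. (w k h - w n h) *s v k"])
        (auto simp: bracket_scale_right mult.commute)
    from subspace_scale[OF assms(2) this, of "inverse (w j h - w n h)"] h(2)
    show ?thesis by simp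
  qed
  have "sum v (insert n M) - sum v M \<in> V"
    by (rule subspace_diff[OF assms(2) insert.prems(3) subspace_sum[OF assms(2) *]])
  also have "sum v (insert n M) - sum v M = v n" using insert.hyps by simp
  finally have "v n \<in> V" .
  then show ?case using * insert.prems(4) by blast
qed

text \<open>A diagonalizable operator stays diagonalizable on a stable subspace: the eigenspace
  components of a vector of \<open>V\<close> lie in \<open>V\<close> by
  \<open>weight_components\<close>, with the eigenvalues themselves as indices.\<close>

lemma eigenvectors_in_stable_subspace:
  assumes V: "subspace V" and stab: "\<And>x. x \<in> V \<Longrightarrow> bracket h x \<in> V"
    and x: "x \<in> V" "x \<in> span {z. \<exists>c. bracket h z = c *s z}"
  shows "x \<in> span {z \<in> V. \<exists>c. bracket h z = c *s z}"
proof -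
  obtain t r where t: "finite t" "t \<subseteq> {z. \<exists>c. bracket h z = c *s z}" "x = (\<Sum>a\<in>t. r a *s a)"
    using x(2) unfolding span_explicit by blast
  have "\<forall>a\<in>t. \<exists>c. bracket h a = c *s a" using t(2) by auto
  then obtain ev where ev: "\<And>a. a \<in> t \<Longrightarrow> bracket h a = ev a *s a"
    by (auto simp: bchoice_iff)
  define v where "v c = (\<Sum>a\<in>{a\<in>t. ev a = c}. r a *s a)" for c
  have xs: "x = sum v (ev ` t)"
    unfolding t(3) v_def using sum.image_gen[OF t(1), of "\<lambda>a. r a *s a" ev] .
  have hv: "bracket h (v c) = c *s v c" for c
    unfolding v_def by (simp add: bracket_sum_right bracket_scale_right ev scale_sum_right mult.commute)
  have "v c \<in> V" if "c \<in> ev ` t" for c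
    by (rule weight_components[where T = "{h}" and w = "\<lambda>c _. c" and M = "ev ` t"])
      (use V stab x(1) xs hv that t(1) in auto)
  then have "sum v (ev ` t) \<in> span {z \<in> V. \<exists>c. bracket h z = c *s z}"
    using hv by (intro span_sum[OF span_base]) auto
  then show ?thesis by (simp only: xs)
qed

text \<open>A joint eigenspace \<open>V\<close> of the operators in \<open>T\<close> is stable under
  any \<open>h\<close> commuting with them, so each joint eigenvector of \<open>T\<close> splits
  into eigenvectors of \<open>h\<close> inside \<open>V\<close>.\<close>

lemma simultaneous_eigenvectors:
  assumes "finite T" "\<And>h k. h \<in> T \<Longrightarrow> k \<in> T \<Longrightarrow> bracket h k = 0"
    and "\<And>h. h \<in> T \<Longrightarrow> span {x. \<exists>c. bracket h x = c *s x} = UNIV"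
  shows "span {x. \<forall>h\<in>T. \<exists>c. bracket h x = c *s x} = UNIV"
  using assms
proof (induction T rule: finite_induct)
  case empty
  then show ?case by simp
next
  case (insert h T)
  let ?E = "{x. \<forall>h'\<in>insert h T. \<exists>c. bracket h' x = c *s x}"
  have "x \<in> span ?E" if x: "\<forall>h'\<in>T. \<exists>c. bracket h' x = c *s x" for x
  proof -
    obtain c where c: "\<And>k. k \<in> T \<Longrightarrow> bracket k x = c k *s x" using x by metis
    define V where "V = {z. \<forall>k\<in>T. bracket k z = c k *s z}"
    have V: "subspace V"
      by (auto simp: V_def subspace_def bracket_add_right bracket_scale_right scale_right_distrib
          scale_left_commute)
    have "x \<in> span {z \<in> V. \<exists>c. bracket h z = c *s z}"
    proof (rule eigenvectors_in_stable_subspace[OF V])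
      show "bracket h z \<in> V" if "z \<in> V" for z
      proof -
        have "bracket k (bracket h z) = c k *s bracket h z" if k: "k \<in> T" for k
          using \<open>z \<in> V\<close> k insert.prems(1)[of k h] leibniz[of k h z]
          by (simp add: V_def bracket_scale_right)
        then show ?thesis by (simp add: V_def)
      qed
      show "x \<in> V" using c by (simp add: V_def)
      show "x \<in> span {z. \<exists>c. bracket h z = c *s z}" using insert.prems(2)[of h] by auto
    qed
    then show ?thesis by (rule subsetD[OF span_mono, rotated]) (auto simp: V_def)
  qed
  then have "span {x. \<forall>h\<in>T. \<exists>c. bracket h x = c *s x} \<subseteq> span ?E"
    by (intro span_minimal) auto
  then show ?case using insert.IH insert.prems by auto
qed

lemma finite_independent: "independent C \<Longrightarrow> finite C"
  using finite_dim independent_span_bound by (metis subset_UNIV)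

lemma weight_basis_exists:
  assumes "cartan_subalgebra UNIV H"
  shows "\<exists>B wt. finite B \<and> independent B \<and> span B = UNIV \<and>
     (\<forall>b\<in>B. \<forall>h\<in>H. bracket h b = wt b h *s b) \<and> (\<forall>b. \<forall>h. h \<notin> H \<longrightarrow> wt b h = 0)"
proof -
  have H: "subspace H" "\<And>h k. h \<in> H \<Longrightarrow> k \<in> H \<Longrightarrow> bracket h k = 0"
     "\<And>h. h \<in> H \<Longrightarrow> span {x. \<exists>c. bracket h x = c *s x} = UNIV"
    using assms by (simp_all add: cartan_subalgebra_def lie_subalgebra_def top.extremum_unique)
  obtain T where T: "T \<subseteq> H" "independent T" "H \<subseteq> span T"
    using maximal_independent_subset by blast
  let ?E = "{x. \<forall>h\<in>T. \<exists>c. bracket h x = c *s x}"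
  have E: "span ?E = UNIV"
    using T by (intro simultaneous_eigenvectors finite_independent H) auto
  obtain B where B: "B \<subseteq> ?E" "independent B" "?E \<subseteq> span B"
    using maximal_independent_subset by blast
  \<comment> \<open>Having \<open>b\<close> as an eigenvector is a linear condition on
    \<open>h\<close>, so the finite basis \<open>T\<close> of \<open>H\<close> controls all of
    \<open>H\<close>.\<close>
  have "\<exists>c. bracket h b = c *s b" if "b \<in> B" "h \<in> H" for b h
  proof -
    have "h \<in> span T" using T that by blast
    then show ?thesis
    proof (induction rule: span_induct)
      case base
      show ?case
        by (rule subspaceI)
          (auto simp: bracket_add_left bracket_scale_left simp flip: scale_left_distrib
            intro: exI[of _ 0])
    next
      case (step x)
      then show ?case using B that by blast
    qed
  qed
  then obtain wt where "\<And>b h. b \<in> B \<Longrightarrow> h \<in> H \<Longrightarrow> bracket h b = wt b h *s b" by metis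
  moreover have "span B = UNIV" using span_minimal[OF B(3) subspace_span] E by auto
  \<comment> \<open>Weights are set to zero off \<open>H\<close>, so that weights agreeing on
    \<open>H\<close> are equal functions; \<open>homogeneous_element\<close> separates distinct
    weights this way.\<close>
  ultimately show ?thesis using B finite_independent
    by (intro exI[of _ B] exI[of _ "\<lambda>b h. if h \<in> H then wt b h else 0"]) auto
qed

end

section \<open>Weight decomposition and Engel's theorem\<close>

locale weight_basis = complex_lie_algebra scale bracket
  for scale :: "complex \<Rightarrow> 'g::ab_group_add \<Rightarrow> 'g" (infixr "*s" 75)
    and bracket :: "'g \<Rightarrow> 'g \<Rightarrow> 'g" +
  fixes H :: "'g set" and B :: "'g set" and wt :: "'g \<Rightarrow> 'g \<Rightarrow> complex"
  assumes semisimple: "semisimple_lie UNIV"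
    and cartan: "cartan_subalgebra UNIV H"
    and finite_B: "finite B" and independent_B: "independent B" and span_B: "span B = UNIV"
    and wt: "b \<in> B \<Longrightarrow> h \<in> H \<Longrightarrow> bracket h b = wt b h *s b"
    and wt_outside: "h \<notin> H \<Longrightarrow> wt b h = 0"
begin

sublocale finite_dimensional_vector_space scale B
  by unfold_locales (use finite_B independent_B span_B in auto)

abbreviation rs :: "('g \<Rightarrow> complex) \<Rightarrow> 'g set" where
  "rs \<equiv> root_space UNIV H"

definition cf :: "'g \<Rightarrow> 'g \<Rightarrow> complex" where
  "cf b x = representation B x b"

lemma subspace_H: "subspace H"
  and H_commute: "h \<in> H \<Longrightarrow> k \<in> H \<Longrightarrow> bracket h k = 0"
  and H_self_centralizing: "(\<And>h. h \<in> H \<Longrightarrow> bracket h x = 0) \<Longrightarrow> x \<in> H"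
  using cartan by (simp_all add: cartan_subalgebra_def lie_subalgebra_def)

lemma rs_iff: "x \<in> rs \<alpha> \<longleftrightarrow> (\<forall>h\<in>H. bracket h x = \<alpha> h *s x)"
  by (simp add: root_space_def)

lemma basis_rs: "b \<in> B \<Longrightarrow> b \<in> rs (wt b)" "b \<in> B \<Longrightarrow> b \<noteq> 0"
  using wt independent_B dependent_zero by (auto simp: rs_iff)

lemma rs_cong: "(\<And>h. h \<in> H \<Longrightarrow> \<alpha> h = \<beta> h) \<Longrightarrow> rs \<alpha> = rs \<beta>"
  by (auto simp: rs_iff)

lemma subspace_rs: "subspace (rs \<alpha>)"
  by (auto simp: subspace_def rs_iff bracket_add_right bracket_scale_right scale_right_distrib
      scale_left_commute)

lemma rs_zero: "(\<And>h. h \<in> H \<Longrightarrow> \<alpha> h = 0) \<Longrightarrow> rs \<alpha> = H"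
  by (auto simp: rs_iff H_commute intro: H_self_centralizing)

lemma rs_bracket: "x \<in> rs \<alpha> \<Longrightarrow> y \<in> rs \<beta> \<Longrightarrow> bracket x y \<in> rs (\<lambda>h. \<alpha> h + \<beta> h)"
  by (simp add: rs_iff leibniz[of _ x y] bracket_scale_left bracket_scale_right scale_left_distrib)

lemma rs_bracket_neg: "x \<in> rs \<alpha> \<Longrightarrow> y \<in> rs (\<lambda>h. - \<alpha> h) \<Longrightarrow> bracket x y \<in> H"
  using rs_bracket[of x \<alpha> y "\<lambda>h. - \<alpha> h"] rs_zero[of "\<lambda>h. \<alpha> h + - \<alpha> h"] by simp

lemma cf_add: "cf b (x + y) = cf b x + cf b y"
  unfolding cf_def by (subst representation_add) (auto simp: independent_B span_B)

lemma cf_scale: "cf b (c *s x) = c * cf b x"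
  unfolding cf_def by (subst representation_scale) (auto simp: independent_B span_B)

lemma cf_zero [simp]: "cf b 0 = 0"
  using cf_scale[of b 0 0] by simp

lemma cf_diff: "cf b (x - y) = cf b x - cf b y"
  using cf_add[of b "x - y" y] by simp

lemma cf_sum: "cf b (sum f A) = (\<Sum>a\<in>A. cf b (f a))"
  by (induction A rule: infinite_finite_induct) (auto simp: cf_add)

lemma cf_basis: "b \<in> B \<Longrightarrow> cf c b = (if c = b then 1 else 0)"
  unfolding cf_def using representation_basis[OF independent_B, of b] by auto

lemma sum_cf: "(\<Sum>b\<in>B. cf b x *s b) = x"
  unfolding cf_def
  by (rule sum_representation_eq) (use independent_B span_B finite_B in auto)

lemma cf_bracket:
  assumes "h \<in> H" "b \<in> B"
  shows "cf b (bracket h x) = wt b h * cf b x"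
proof -
  have "bracket h x = (\<Sum>c\<in>B. (wt c h * cf c x) *s c)"
    by (subst sum_cf[symmetric, of x])
      (auto simp: bracket_sum_right bracket_scale_right wt assms intro!: sum.cong)
  then have "cf b (bracket h x) = (\<Sum>c\<in>B. if b = c then wt c h * cf c x else 0)"
    by (auto simp: cf_sum cf_scale cf_basis intro!: sum.cong)
  then show ?thesis using assms finite_B by simp
qed

lemma rs_cf: "x \<in> rs \<alpha> \<Longrightarrow> b \<in> B \<Longrightarrow> cf b x \<noteq> 0 \<Longrightarrow> h \<in> H \<Longrightarrow> wt b h = \<alpha> h"
  using cf_bracket[of h b x] by (simp add: rs_iff cf_scale)

lemma rs_weight:
  assumes "x \<in> rs \<alpha>" "x \<noteq> 0"
  obtains b where "b \<in> B" "\<And>h. h \<in> H \<Longrightarrow> wt b h = \<alpha> h"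
proof -
  obtain b where "b \<in> B" "cf b x \<noteq> 0"
    using sum_cf[of x] assms(2) by (metis (no_types, lifting) scale_zero_left sum.neutral)
  then show ?thesis using that rs_cf assms(1) by blast
qed

definition h_stable :: "'g set \<Rightarrow> bool" where
  "h_stable J \<longleftrightarrow> subspace J \<and> (\<forall>h\<in>H. \<forall>x\<in>J. bracket h x \<in> J)"

lemma h_stableD: "h_stable J \<Longrightarrow> subspace J" "h_stable J \<Longrightarrow> h \<in> H \<Longrightarrow> x \<in> J \<Longrightarrow> bracket h x \<in> J"
  by (auto simp: h_stable_def)

text \<open>Grouping the coordinates by weight writes \<open>x\<close> as a sum of weight vectors
  with distinct weights. Stability puts each summand into \<open>J\<close>, and some summand must
  leave \<open>U\<close>.\<close>

lemma homogeneous_element: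
  assumes J: "h_stable J" and U: "subspace U" and x: "x \<in> J" "x \<notin> U"
  obtains \<alpha> y where "y \<in> J" "y \<in> rs \<alpha>" "y \<notin> U"
proof -
  define c where "c \<mu> = (\<Sum>b\<in>{b\<in>B. wt b = \<mu>}. cf b x *s b)" for \<mu>
  have xc: "x = sum c (wt ` B)"
    unfolding c_def using sum.image_gen[OF finite_B, of "\<lambda>b. cf b x *s b" wt] sum_cf by simp
  have c: "h \<in> H \<Longrightarrow> bracket h (c \<mu>) = \<mu> h *s c \<mu>" for h \<mu>
    by (auto simp: c_def bracket_sum_right bracket_scale_right wt scale_sum_right mult.commute
        intro!: sum.cong)
  have "c \<mu> \<in> J" if "\<mu> \<in> wt ` B" for \<mu>
  proof (rule weight_components[where T = H and w = "\<lambda>\<mu>. \<mu>" and M = "wt ` B"])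
    fix \<mu> \<nu> assume "\<mu> \<in> wt ` B" "\<nu> \<in> wt ` B" "\<mu> \<noteq> \<nu>"
    then show "\<exists>h\<in>H. \<mu> h \<noteq> \<nu> h" using wt_outside by (metis (no_types, lifting) ext imageE)
  qed (use J x finite_B c that xc in \<open>auto simp: h_stable_def\<close>)
  moreover have "\<exists>\<mu>\<in>wt ` B. c \<mu> \<notin> U"
    using x(2) U xc subspace_sum[OF U, of "wt ` B" c] by auto
  ultimately show ?thesis using that c by (metis rs_iff)
qed

lemma bracket_power_rs:
  "x \<in> rs \<alpha> \<Longrightarrow> v \<in> rs \<beta> \<Longrightarrow> (bracket x ^^ k) v \<in> rs (\<lambda>h. \<beta> h + of_nat k * \<alpha> h)"
proof (induction k)
  case (Suc k)
  then have "bracket x ((bracket x ^^ k) v) \<in> rs (\<lambda>h. \<alpha> h + (\<beta> h + of_nat k * \<alpha> h))"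
    by (intro rs_bracket) auto
  then show ?case by (simp add: algebra_simps)
qed simp

text \<open>Powers that never vanish would have weights with infinitely many values at
  \<open>h\<close>, while the finite basis \<open>B\<close> carries only finitely many
  weights.\<close>

lemma bracket_power_eventually_zero:
  assumes "x \<in> rs \<alpha>" "v \<in> rs \<beta>" "h \<in> H" "\<alpha> h \<noteq> 0"
  obtains k where "(bracket x ^^ k) v = 0"
proof -
  have False if nz: "\<And>k. (bracket x ^^ k) v \<noteq> 0"
  proof -
    have "\<beta> h + of_nat k * \<alpha> h \<in> (\<lambda>b. wt b h) ` B" for k
    proof -
      obtain b where "b \<in> B" "\<And>h. h \<in> H \<Longrightarrow> wt b h = \<beta> h + of_nat k * \<alpha> h"
        using rs_weight[OF bracket_power_rs[OF assms(1,2)] nz[of k]] by metis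
      then show ?thesis using assms(3) by (metis image_eqI)
    qed
    then have "range (\<lambda>k. \<beta> h + of_nat k * \<alpha> h) \<subseteq> (\<lambda>b. wt b h) ` B" by auto
    then have "finite (range (\<lambda>k::nat. \<beta> h + of_nat k * \<alpha> h))"
      using finite_B finite_subset by blast
    moreover have "inj (\<lambda>k::nat. \<beta> h + of_nat k * \<alpha> h)"
      using assms(4) by (auto simp: inj_def)
    ultimately show False using finite_imageD infinite_UNIV_nat by blast
  qed
  then show ?thesis using that by blast
qed

lemma h_stable_transporter:
  assumes "h_stable N" "h_stable U" "h_stable V"
  shows "h_stable {v \<in> V. \<forall>n\<in>N. bracket n v \<in> U}"
  unfolding h_stable_def
proof (intro conjI ballI)
  show "subspace {v \<in> V. \<forall>n\<in>N. bracket n v \<in> U}"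
    using assms by (auto simp: h_stable_def subspace_def bracket_add_right bracket_scale_right)
  fix h v assume h: "h \<in> H" and v: "v \<in> {v \<in> V. \<forall>n\<in>N. bracket n v \<in> U}"
  have "bracket n (bracket h v) \<in> U" if "n \<in> N" for n
  proof -
    have "bracket (bracket n h) v = - bracket (bracket h n) v"
      by (subst bracket_anti[of n h]) simp
    moreover have "bracket (bracket h n) v \<in> U" "bracket h (bracket n v) \<in> U"
      using assms h v that by (auto simp: h_stable_def)
    ultimately show ?thesis
      using h_stableD(1)[OF assms(2)] by (subst leibniz) (auto intro: subspace_diff)
  qed
  then show "bracket h v \<in> {v \<in> V. \<forall>n\<in>N. bracket n v \<in> U}"
    using assms(3) h v by (auto simp: h_stable_def)
qed

text \<open>The usual induction proving Engel's theorem, carried out with homogeneous vectors: these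
  act nilpotently as soon as the subalgebra has no weight zero part.\<close>

lemma engel:
  assumes "h_stable M" "\<And>x y. x \<in> M \<Longrightarrow> y \<in> M \<Longrightarrow> bracket x y \<in> M" "M \<inter> H \<subseteq> {0}"
    and "h_stable V" "\<And>m v. m \<in> M \<Longrightarrow> v \<in> V \<Longrightarrow> bracket m v \<in> V"
    and "h_stable U" "\<And>m u. m \<in> M \<Longrightarrow> u \<in> U \<Longrightarrow> bracket m u \<in> U"
    and "U \<subset> V"
  shows "\<exists>v\<in>V - U. \<forall>m\<in>M. bracket m v \<in> U"
  using assms
proof (induction "dim M" arbitrary: M U V rule: less_induct)
  case less
  note M = less.prems(1-3) and V = less.prems(4,5) and U = less.prems(6,7)
  note sM = h_stableD(1)[OF M(1)] and sU = h_stableD(1)[OF U(1)] and sV = h_stableD(1)[OF V(1)]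
  show ?case
  proof (cases "M = {0}")
    case True
    then show ?thesis using less.prems(8) subspace_0[OF sU] by auto
  next
    case False
    \<comment> \<open>Nested stable subspaces stand for quotients: \<open>N\<close> acts on
      \<open>M\<close> modulo \<open>N\<close> and on \<open>V\<close> modulo \<open>U\<close>. A
      member of \<open>S\<close> of largest dimension turns out to have codimension one in
      \<open>M\<close>.\<close>
    define S where "S = {N. h_stable N \<and> (\<forall>x\<in>N. \<forall>y\<in>N. bracket x y \<in> N) \<and> N \<subset> M}"
    have dimS: "dim N < dim M" if "N \<in> S" for N
    proof (rule dim_psubset)
      have "span N = N" "span M = M" using that sM by (auto simp: S_def h_stable_def)
      then show "span N \<subset> span M" using that by (simp only: S_def mem_Collect_eq)
    qed
    have "{0} \<in> S" using False subspace_0[OF sM] by (auto simp: S_def h_stable_def)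
    then obtain N where N: "N \<in> S" and max: "\<And>N'. N' \<in> S \<Longrightarrow> dim N' \<le> dim N"
      using ex_has_greatest_nat[of "\<lambda>N. N \<in> S" "{0}" dim "dim M"] dimS by blast
    have hN: "h_stable N" and algN: "\<And>x y. x \<in> N \<Longrightarrow> y \<in> N \<Longrightarrow> bracket x y \<in> N" and NM: "N \<subset> M"
      using N by (auto simp: S_def)
    note sN = h_stableD(1)[OF hN]
    have NH: "N \<inter> H \<subseteq> {0}" using NM M(3) by auto
    obtain x0 where x0: "x0 \<in> M - N" "\<forall>n\<in>N. bracket n x0 \<in> N"
      using less.hyps[OF dimS[OF N] hN algN NH M(1) _ hN algN NM] M(2) NM by blast
    have "x0 \<in> {v \<in> M. \<forall>n\<in>N. bracket n v \<in> N}" "x0 \<notin> N" using x0 by auto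
    then obtain \<alpha> x where x': "x \<in> {v \<in> M. \<forall>n\<in>N. bracket n v \<in> N}" "x \<in> rs \<alpha>" "x \<notin> N"
      by (rule homogeneous_element[OF h_stable_transporter[OF hN hN M(1)] sN])
    then have x: "x \<in> M" "\<forall>n\<in>N. bracket n x \<in> N" "x \<in> rs \<alpha>" "x \<notin> N" by auto
    \<comment> \<open>If the weight were zero, \<open>x\<close> would lie in
      \<open>M \<inter> H\<close>, hence be \<open>0\<close> and belong to \<open>N\<close>.\<close>
    obtain h where h: "h \<in> H" "\<alpha> h \<noteq> 0"
      using rs_zero[of \<alpha>] x M(3) subspace_0[OF sN] by blast
    let ?N = "span (insert x N)"
    have sub: "?N \<subseteq> M" using sM x(1) NM by (intro span_minimal) auto
    have xN: "bracket n x \<in> N" "bracket x n \<in> N" if "n \<in> N" for n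
      using x(2) that bracket_anti[of x n] subspace_neg[OF sN] by auto
    have M_eq: "?N = M"
    proof (rule ccontr)
      assume "?N \<noteq> M"
      have "bracket k y \<in> ?N" if "k \<in> H" "y \<in> ?N" for k y
        by (rule bracket_span_in[where X = "{k}" and Y = "insert x N"])
          (use that x(3) hN span_scale[OF span_base[of x "insert x N"]] in
            \<open>auto simp: rs_iff h_stable_def intro: span_base\<close>)
      moreover have "bracket y z \<in> ?N" if "y \<in> ?N" "z \<in> ?N" for y z
        by (rule bracket_span_in[where X = "insert x N" and Y = "insert x N"])
          (use that xN algN in \<open>auto simp: bracket_self span_zero intro: span_base\<close>)
      ultimately have "?N \<in> S" using sub \<open>?N \<noteq> M\<close> by (auto simp: S_def h_stable_def)
      moreover have "dim N < dim ?N"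
      proof (rule dim_psubset)
        have "span N = N" using sN by simp
        moreover have "N \<subseteq> ?N" "x \<in> ?N" by (auto intro: span_base)
        ultimately show "span N \<subset> span ?N" using x(4) by (metis psubsetI span_span)
      qed
      ultimately show False using max by fastforce
    qed
    let ?V = "{v \<in> V. \<forall>n\<in>N. bracket n v \<in> U}"
    obtain v0 where v0: "v0 \<in> V - U" "\<forall>n\<in>N. bracket n v0 \<in> U"
      using less.hyps[OF dimS[OF N] hN algN NH V(1) _ U(1) _ less.prems(8)] V(2) U(2) NM by blast
    have "v0 \<in> ?V" "v0 \<notin> U" using v0 by auto
    then obtain \<beta> v where v: "v \<in> ?V" "v \<in> rs \<beta>" "v \<notin> U"
      by (rule homogeneous_element[OF h_stable_transporter[OF hN U(1) V(1)] sU])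
    have step: "bracket x y \<in> ?V" if "y \<in> ?V" for y
    proof -
      have "bracket n (bracket x y) \<in> U" if "n \<in> N" for n
        using leibniz[of n x y] xN(1)[OF that] U(2)[OF x(1), of "bracket n y"] \<open>y \<in> ?V\<close> that
        by (auto intro!: subspace_add[OF sU])
      then show ?thesis using that V(2)[OF x(1)] by auto
    qed
    have pow: "(bracket x ^^ k) v \<in> ?V" for k
      by (induction k) (use v(1) step in auto)
    obtain k where "(bracket x ^^ k) v = 0"
      using bracket_power_eventually_zero[OF x(3) v(2) h] .
    then have ex: "\<exists>k. (bracket x ^^ k) v \<in> U" using subspace_0[OF sU] by metis
    \<comment> \<open>The last power outside \<open>U\<close> is sent into \<open>U\<close> by
      \<open>x\<close>, and by \<open>N\<close> because it still lies in \<open>?V\<close>; together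
      \<open>x\<close> and \<open>N\<close> span \<open>M\<close>.\<close>
    define n where "n = (LEAST k. (bracket x ^^ k) v \<in> U)"
    have n: "(bracket x ^^ n) v \<in> U" "\<And>k. k < n \<Longrightarrow> (bracket x ^^ k) v \<notin> U"
      using LeastI_ex[OF ex] not_less_Least unfolding n_def by auto
    obtain j where j: "n = Suc j" using n(1) v(3) by (cases n) auto
    let ?y = "(bracket x ^^ j) v"
    have "bracket m ?y \<in> U" if "m \<in> M" for m
      by (rule bracket_span_in[where X = "insert x N" and Y = "{?y}"])
        (use that M_eq n(1) j pow[of j] sU in \<open>auto intro: span_base\<close>)
    then show ?thesis using n(2)[of j] j pow[of j] by blast
  qed
qed

lemma abelian_ideal_trivial:
  assumes J: "lie_ideal UNIV J" and "\<And>x y. x \<in> J \<Longrightarrow> y \<in> J \<Longrightarrow> bracket x y = 0"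
  shows "J = {0}"
proof -
  have "0 \<in> J" using J by (simp add: lie_ideal_def subspace_0)
  then have "{bracket x y |x y. x \<in> J \<and> y \<in> J} = {0}" using assms(2) by force
  then have "derived_series J 1 = {0}" by simp
  then show ?thesis using J semisimple unfolding semisimple_lie_def solvable_lie_def by blast
qed

text \<open>Engel's theorem for \<open>J\<close> acting on itself gives a nonzero element commuting
  with all of \<open>J\<close>. But the centre of \<open>J\<close> is an abelian ideal of the whole
  algebra, hence zero by semisimplicity.\<close>

lemma ideal_meets_H:
  assumes J: "lie_ideal UNIV J" "J \<inter> H \<subseteq> {0}"
  shows "J = {0}"
proof (rule ccontr)
  assume "J \<noteq> {0}"
  have sJ: "subspace J" and iJ: "\<And>x y. y \<in> J \<Longrightarrow> bracket x y \<in> J"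
    using J by (auto simp: lie_ideal_def)
  have hJ: "h_stable J" using sJ iJ by (simp add: h_stable_def)
  have "\<exists>v\<in>J - {0}. \<forall>m\<in>J. bracket m v \<in> {0}"
    using \<open>J \<noteq> {0}\<close> subspace_0[OF sJ] J(2)
    by (intro engel hJ iJ) (auto simp: h_stable_def)
  then obtain v where v: "v \<in> J" "v \<noteq> 0" "\<And>m. m \<in> J \<Longrightarrow> bracket m v = 0" by auto
  let ?Z = "{z \<in> J. \<forall>m\<in>J. bracket m z = 0}"
  have "lie_ideal UNIV ?Z"
    unfolding lie_ideal_def
  proof (intro conjI ballI)
    show "subspace ?Z"
      using sJ by (auto simp: subspace_def bracket_add_right bracket_scale_right)
    fix l z assume z: "z \<in> ?Z"
    have "bracket m (bracket l z) = 0" if "m \<in> J" for m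
      using leibniz[of m l z] bracket_anti[of m l] z that iJ[of m l] by simp
    then show "bracket l z \<in> ?Z" using z iJ by auto
  qed simp
  then have "?Z = {0}" by (rule abelian_ideal_trivial) auto
  then show False using v by auto
qed

text \<open>An element of \<open>H\<close> on which all weights vanish is central, so the line it
  spans is an abelian ideal.\<close>

lemma weights_separate_H:
  assumes h: "h \<in> H" "\<And>b. b \<in> B \<Longrightarrow> wt b h = 0"
  shows "h = 0"
proof -
  have "bracket h x = 0" for x
    by (subst sum_cf[symmetric]) (simp add: bracket_sum_right bracket_scale_right wt h)
  then have "bracket x h = 0" for x using bracket_anti[of x h] by simp
  then have "bracket x (c *s h) = 0" for x c by (simp add: bracket_scale_right)
  then have "span {h} = {0}"
    using subspace_span[of "{h}"]
    by (intro abelian_ideal_trivial) (auto simp: lie_ideal_def span_singleton intro: range_eqI[of _ _ 0])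
  then show ?thesis using span_base[of h "{h}"] by simp
qed

end

section \<open>Coroots and root strings\<close>

context weight_basis
begin

text \<open>The \<open>sl_2\<close> formula for moving back up after lowering a vector killed by
  \<open>e\<close>. Leaving \<open>\<alpha> t\<close> arbitrary lets it serve twice: the value
  \<open>2\<close> gives the strings of weights, the value \<open>0\<close> excludes isotropic
  brackets.\<close>

lemma ladder:
  assumes e: "e \<in> rs \<alpha>" and f: "f \<in> rs (\<lambda>h. - \<alpha> h)" and t: "t = bracket e f"
    and v: "v \<in> rs \<beta>" "bracket e v = 0"
  shows "bracket e ((bracket f ^^ Suc k) v) =
    (of_nat (Suc k) * (\<beta> t - of_nat k * \<alpha> t / 2)) *s (bracket f ^^ k) v"
proof (induction k)
  case 0
  then show ?case
    using leibniz[of e f v] v t rs_bracket_neg[OF e f] by (simp add: rs_iff)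
next
  case (Suc k)
  let ?u = "(bracket f ^^ Suc k) v"
  have "?u \<in> rs (\<lambda>h. \<beta> h + of_nat (Suc k) * (- \<alpha> h))"
    by (rule bracket_power_rs[OF f v(1)])
  then have "bracket t ?u = (\<beta> t - of_nat (Suc k) * \<alpha> t) *s ?u"
    using t rs_bracket_neg[OF e f] by (simp add: rs_iff)
  then have "bracket e (bracket f ?u) = (\<beta> t - of_nat (Suc k) * \<alpha> t) *s ?u
      + bracket f ((of_nat (Suc k) * (\<beta> t - of_nat k * \<alpha> t / 2)) *s (bracket f ^^ k) v)"
    using leibniz[of e f ?u] t Suc.IH by simp
  also have "\<dots> = ((\<beta> t - of_nat (Suc k) * \<alpha> t) + of_nat (Suc k) * (\<beta> t - of_nat k * \<alpha> t / 2)) *s ?u"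
    by (simp only: bracket_scale_right scale_left_distrib funpow.simps o_def)
  also have "(\<beta> t - of_nat (Suc k) * \<alpha> t) + of_nat (Suc k) * (\<beta> t - of_nat k * \<alpha> t / 2)
      = of_nat (Suc (Suc k)) * (\<beta> t - of_nat (Suc k) * \<alpha> t / 2)"
    by (simp add: field_simps)
  finally show ?case by simp
qed

lemma last_nonzero_power:
  assumes "(F ^^ k) v = (0::'g)" "v \<noteq> 0"
  obtains n where "F ((F ^^ n) v) = 0" "\<And>j. j \<le> n \<Longrightarrow> (F ^^ j) v \<noteq> 0"
proof -
  define m where "m = (LEAST k. (F ^^ k) v = 0)"
  have m: "(F ^^ m) v = 0" "\<And>j. j < m \<Longrightarrow> (F ^^ j) v \<noteq> 0"
    using LeastI[of "\<lambda>k. (F ^^ k) v = 0", OF assms(1)] not_less_Least unfolding m_def by auto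
  then obtain n where "m = Suc n" using assms(2) by (cases m) auto
  then show ?thesis using that[of n] m by auto
qed

lemma top_vector:
  assumes "e \<in> rs \<alpha>" "v \<in> rs \<beta>" "v \<noteq> 0" "h \<in> H" "\<alpha> h \<noteq> 0"
  obtains p w where "w \<in> rs (\<lambda>h. \<beta> h + of_nat p * \<alpha> h)" "w \<noteq> 0" "bracket e w = 0"
proof -
  obtain k where "(bracket e ^^ k) v = 0"
    using bracket_power_eventually_zero[OF assms(1,2,4,5)] .
  then obtain n where "bracket e ((bracket e ^^ n) v) = 0" "(bracket e ^^ n) v \<noteq> 0"
    using last_nonzero_power[of k "bracket e" v] assms(3) by (metis order_refl)
  then show ?thesis using that bracket_power_rs[OF assms(1,2)] by blast
qed

text \<open>Lower a top vector until it dies. With \<open>\<alpha> t = 0\<close> the factor in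
  \<open>ladder\<close> at the last step is a positive multiple of \<open>wt b t\<close>, so every
  weight vanishes on \<open>t\<close>.\<close>

lemma bracket_eq_zero_if_isotropic:
  assumes e: "e \<in> rs \<alpha>" and f: "f \<in> rs (\<lambda>h. - \<alpha> h)" and t: "t = bracket e f"
    and h: "h \<in> H" "\<alpha> h \<noteq> 0" and "\<alpha> t = 0"
  shows "t = 0"
proof (rule weights_separate_H)
  show tH: "t \<in> H" using rs_bracket_neg[OF e f] t by simp
  fix b assume b: "b \<in> B"
  note basis_rs[OF b]
  then obtain p w where w: "w \<in> rs (\<lambda>h. wt b h + of_nat p * \<alpha> h)" "w \<noteq> 0" "bracket e w = 0"
    using top_vector[OF e _ _ h] by metis
  obtain k where "(bracket f ^^ k) w = 0"
    using bracket_power_eventually_zero[OF f w(1) h(1)] h(2) by auto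
  then obtain n where n: "bracket f ((bracket f ^^ n) w) = 0" "(bracket f ^^ n) w \<noteq> 0"
    using last_nonzero_power[of k "bracket f" w] w(2) by (metis order_refl)
  have "bracket e ((bracket f ^^ Suc n) w) = 0" using n(1) by simp
  then have "(of_nat (Suc n) * (wt b t + of_nat p * \<alpha> t - of_nat n * \<alpha> t / 2)) *s (bracket f ^^ n) w = 0"
    using ladder[OF e f t w(1,3), of n] by (simp only: )
  then have "of_nat (Suc n) * wt b t = 0" using n(2) \<open>\<alpha> t = 0\<close> by simp
  then show "wt b t = 0" by (metis mult_eq_0_iff of_nat_eq_0_iff old.nat.distinct(2))
qed

text \<open>Here \<open>p\<close> counts the steps up from \<open>\<beta>\<close> to a vector killed
  by \<open>e\<close>, and \<open>m\<close> the steps down from there that still give nonzero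
  vectors. The factor in \<open>ladder\<close> at the next step must vanish, which expresses
  \<open>\<beta> t\<close> by the two.\<close>

lemma weight_string:
  assumes e: "e \<in> rs \<alpha>" and f: "f \<in> rs (\<lambda>h. - \<alpha> h)" and t: "t = bracket e f" and 2: "\<alpha> t = 2"
    and v: "v \<in> rs \<beta>" "v \<noteq> 0"
  obtains p m :: nat where "\<beta> t = of_nat m - 2 * of_nat p"
    and "\<And>k. k \<le> m \<Longrightarrow> \<exists>w\<in>rs (\<lambda>h. \<beta> h + (of_nat p - of_nat k) * \<alpha> h). w \<noteq> 0"
proof -
  have tH: "t \<in> H" using rs_bracket_neg[OF e f] t by simp
  obtain p w where w: "w \<in> rs (\<lambda>h. \<beta> h + of_nat p * \<alpha> h)" "w \<noteq> 0" "bracket e w = 0"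
    by (rule top_vector[OF e v tH]) (use 2 in auto)
  obtain k where "(bracket f ^^ k) w = 0"
    using bracket_power_eventually_zero[OF f w(1) tH] 2 by auto
  then obtain n where n: "bracket f ((bracket f ^^ n) w) = 0" "\<And>j. j \<le> n \<Longrightarrow> (bracket f ^^ j) w \<noteq> 0"
    using last_nonzero_power[of k "bracket f" w] w(2) by metis
  have "bracket e ((bracket f ^^ Suc n) w) = 0" using n(1) by simp
  then have "(of_nat (Suc n) * (\<beta> t + of_nat p * \<alpha> t - of_nat n * \<alpha> t / 2)) *s (bracket f ^^ n) w = 0"
    using ladder[OF e f t w(1,3), of n] by (simp only: )
  then have "of_nat (Suc n) * (\<beta> t + of_nat p * 2 - of_nat n) = 0"
    using n(2)[of n] 2 by simp
  then have "\<beta> t + of_nat p * 2 - of_nat n = 0"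
    by (metis mult_eq_0_iff of_nat_eq_0_iff old.nat.distinct(2))
  then have "\<beta> t = of_nat n - 2 * of_nat p" by (simp add: algebra_simps)
  moreover have "\<exists>w\<in>rs (\<lambda>h. \<beta> h + (of_nat p - of_nat k) * \<alpha> h). w \<noteq> 0" if "k \<le> n" for k
  proof -
    have "(\<lambda>h. \<beta> h + of_nat p * \<alpha> h + of_nat k * - \<alpha> h) = (\<lambda>h. \<beta> h + (of_nat p - of_nat k) * \<alpha> h)"
      by (simp add: fun_eq_iff algebra_simps)
    then show ?thesis using bracket_power_rs[OF f w(1), of k] n(2)[OF that] by auto
  qed
  ultimately show ?thesis using that by blast
qed

section \<open>Trace and Killing form\<close>

definition trace :: "('g \<Rightarrow> 'g) \<Rightarrow> complex" where
  "trace F = (\<Sum>b\<in>B. cf b (F b))"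

definition killing :: "'g \<Rightarrow> 'g \<Rightarrow> complex" where
  "killing x y = trace (\<lambda>z. bracket x (bracket y z))"

lemma trace_commute:
  assumes F: "Vector_Spaces.linear scale scale F" and G: "Vector_Spaces.linear scale scale G"
  shows "trace (\<lambda>z. F (G z)) = trace (\<lambda>z. G (F z))"
proof -
  have lin: "L x = (\<Sum>c\<in>B. cf c x *s L c)" if "Vector_Spaces.linear scale scale L" for L x
  proof -
    interpret L: Vector_Spaces.linear scale scale L by (rule that)
    show ?thesis by (subst sum_cf[symmetric, of x]) (simp add: L.sum L.scale)
  qed
  have "cf b (F (G b)) = (\<Sum>c\<in>B. cf c (G b) * cf b (F c))" for b
    by (subst lin[OF F]) (simp add: cf_sum cf_scale)
  moreover have "cf b (G (F b)) = (\<Sum>c\<in>B. cf c (F b) * cf b (G c))" for b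
    by (subst lin[OF G]) (simp add: cf_sum cf_scale)
  ultimately show ?thesis
    unfolding trace_def by simp (subst sum.swap, simp add: mult.commute)
qed

lemma killing_commute: "killing x y = killing y x"
  unfolding killing_def by (rule trace_commute) (rule linear_bracket)+

lemma killing_scale_left: "killing (c *s x) y = c * killing x y"
  by (simp add: killing_def trace_def bracket_scale_left cf_scale sum_distrib_left)

lemma killing_diff_left: "killing (x - y) z = killing x z - killing y z"
  by (simp add: killing_def trace_def bracket_diff_left cf_diff sum_subtractf)

lemma killing_scale_right: "killing y (c *s x) = c * killing y x"
  by (metis killing_commute killing_scale_left)

lemma killing_diff_right: "killing z (x - y) = killing z x - killing z y"
  by (metis killing_commute killing_diff_left)

lemma killing_zero_right [simp]: "killing x 0 = 0"
  using killing_scale_right[of x 0 0] by simp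

lemma killing_sum_right: "killing x (sum f A) = (\<Sum>a\<in>A. killing x (f a))"
proof -
  have add: "killing x (y + z) = killing x y + killing x z" for y z
    using killing_diff_right[of x "y + z" z] by simp
  show ?thesis by (induction A rule: infinite_finite_induct) (auto simp: add)
qed

lemma killing_invariant: "killing (bracket x y) z = killing x (bracket y z)"
proof -
  have 1: "bracket (bracket x y) w = bracket x (bracket y w) - bracket y (bracket x w)" for x y w
    using leibniz[of x y w] by simp
  have "trace (\<lambda>w. bracket y (bracket x (bracket z w))) = trace (\<lambda>w. bracket x (bracket z (bracket y w)))"
    by (rule trace_commute[OF linear_bracket
          Vector_Spaces.linear_compose[OF linear_bracket linear_bracket, unfolded o_def]])
  then show ?thesis
    unfolding killing_def trace_def 1
    by (simp add: 1 cf_diff sum_subtractf bracket_diff_right)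
qed

lemma killing_H: "h \<in> H \<Longrightarrow> k \<in> H \<Longrightarrow> killing h k = (\<Sum>b\<in>B. wt b h * wt b k)"
  by (simp add: killing_def trace_def wt bracket_scale_right cf_scale cf_basis mult.commute
      cong: sum.cong)

lemma killing_bracket: "h \<in> H \<Longrightarrow> x \<in> rs \<alpha> \<Longrightarrow> killing h (bracket x y) = \<alpha> h * killing x y"
  by (simp add: killing_invariant[symmetric] rs_iff killing_scale_left)

text \<open>Over the complex numbers \<open>killing u u\<close> may vanish for nonzero
  \<open>u\<close>, but for integral weights it is a sum of integer squares.\<close>

lemma killing_definite:
  assumes u: "u \<in> H" "\<And>b. b \<in> B \<Longrightarrow> wt b u \<in> \<int>" and "killing u u = 0"
  shows "u = 0"
proof (rule weights_separate_H[OF u(1)])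
  have "\<forall>b\<in>B. \<exists>r. wt b u = of_int r"
    using u(2) by (auto elim: Ints_cases)
  then obtain r where r: "\<And>b. b \<in> B \<Longrightarrow> wt b u = of_int (r b)"
    by (auto simp: bchoice_iff)
  have "killing u u = complex_of_int (\<Sum>b\<in>B. r b * r b)"
    unfolding of_int_sum by (simp add: killing_H u r)
  then have "(\<Sum>b\<in>B. r b * r b) = 0" using assms(3) by (metis of_int_eq_0_iff)
  then have "\<forall>b\<in>B. r b * r b = 0"
    using finite_B by (subst (asm) sum_nonneg_eq_0_iff) auto
  then show "wt b u = 0" if "b \<in> B" for b using r that by auto
qed

lemma wt_Ints:
  assumes e: "e \<in> rs \<alpha>" and f: "f \<in> rs (\<lambda>h. - \<alpha> h)" and t: "t = bracket e f" and 2: "\<alpha> t = 2"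
    and b: "b \<in> B"
  shows "wt b t \<in> \<int>"
proof -
  note basis_rs[OF b]
  then obtain p m :: nat where "wt b t = of_nat m - 2 * of_nat p"
    by (rule weight_string[OF e f t 2])
  then show ?thesis by (auto intro: Ints_diff Ints_mult)
qed

text \<open>Suppose the bracket \<open>s\<close> is nonzero. Then \<open>\<alpha> s\<close> is
  nonzero too, and scaling \<open>f\<close> turns \<open>s\<close> into an element on which
  \<open>\<alpha>\<close> is \<open>2\<close> and all weights are integral, while its Killing norm
  is a multiple of \<open>killing e f\<close>, hence zero.\<close>

lemma bracket_eq_zero_if_killing_zero:
  assumes e: "e \<in> rs \<alpha>" and f: "f \<in> rs (\<lambda>h. - \<alpha> h)" and h: "h \<in> H" "\<alpha> h \<noteq> 0"
    and k: "killing e f = 0"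
  shows "bracket e f = 0"
proof (rule ccontr)
  define s where "s = bracket e f"
  assume "bracket e f \<noteq> 0"
  then have s0: "s \<noteq> 0" "\<alpha> s \<noteq> 0"
    using bracket_eq_zero_if_isotropic[OF e f s_def h] by (auto simp: s_def)
  have sH: "s \<in> H" using rs_bracket_neg[OF e f] s_def by simp
  define c where "c = 2 / \<alpha> s"
  have cf: "c *s f \<in> rs (\<lambda>h. - \<alpha> h)" using subspace_scale[OF subspace_rs f] .
  have t: "c *s s = bracket e (c *s f)" by (simp add: s_def bracket_scale_right)
  \<comment> \<open>\<open>\<alpha>\<close> is an arbitrary function here; its homogeneity along
    \<open>s\<close> is read off from the action on the nonzero vector \<open>e\<close>.\<close>
  have lin: "\<alpha> (c *s s) = 2"
  proof -
    have "e \<noteq> 0" using s0 s_def by auto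
    have "bracket (c *s s) e = (c * \<alpha> s) *s e"
      using e sH by (simp add: bracket_scale_left rs_iff)
    moreover have "bracket (c *s s) e = \<alpha> (c *s s) *s e"
      using e subspace_scale[OF subspace_H sH] by (simp add: rs_iff)
    ultimately have "\<alpha> (c *s s) = c * \<alpha> s" using \<open>e \<noteq> 0\<close> by simp
    then show ?thesis using s0 by (simp add: c_def)
  qed
  have "killing s s = 0" using killing_bracket[OF sH e, of f] k by (simp add: s_def)
  then have "killing (c *s s) (c *s s) = 0" by (simp add: killing_scale_left killing_scale_right)
  then have "c *s s = 0"
    using killing_definite[OF subspace_scale[OF subspace_H sH]] wt_Ints[OF e cf t lin] by blast
  then show False using s0 by (simp add: c_def)
qed

text \<open>The delicate point about \<open>P\<close> is closure under brackets when the weights of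
  \<open>b\<close> and \<open>y\<close> cancel: the result would land in \<open>H\<close>, but it is
  zero because \<open>killing y b\<close> is zero. Hence \<open>span P\<close> is an ideal without
  weight zero part.\<close>

lemma killing_opposite_nonzero:
  assumes x: "x \<in> rs \<alpha>" "x \<noteq> 0" and h: "h \<in> H" "\<alpha> h \<noteq> 0"
  shows "\<exists>y\<in>rs (\<lambda>h. - \<alpha> h). killing x y \<noteq> 0"
proof (rule ccontr)
  assume asm: "\<not> ?thesis"
  define P where "P = {x. \<exists>\<alpha>. x \<in> rs \<alpha> \<and> (\<exists>h\<in>H. \<alpha> h \<noteq> 0) \<and> (\<forall>y\<in>rs (\<lambda>h. - \<alpha> h). killing x y = 0)}"
  have P: "bracket b y \<in> span P" if b: "b \<in> B" and "y \<in> P" for b y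
  proof -
    from \<open>y \<in> P\<close> obtain \<alpha> where y: "y \<in> rs \<alpha>" "\<exists>h\<in>H. \<alpha> h \<noteq> 0" "\<forall>z\<in>rs (\<lambda>h. - \<alpha> h). killing y z = 0"
      by (auto simp: P_def)
    have b': "b \<in> rs (wt b)" using wt b by (simp add: rs_iff)
    show ?thesis
    proof (cases "\<exists>h\<in>H. wt b h + \<alpha> h \<noteq> 0")
      case False
      then have "b \<in> rs (\<lambda>h. - \<alpha> h)"
        using b' rs_cong[of "wt b" "\<lambda>h. - \<alpha> h"] by (simp add: eq_neg_iff_add_eq_0)
      then have "bracket y b = 0" using y bracket_eq_zero_if_killing_zero by blast
      then show ?thesis using bracket_anti[of b y] by (simp add: span_zero)
    next
      case True
      have "killing (bracket b y) w = 0" if w: "w \<in> rs (\<lambda>h. - (wt b h + \<alpha> h))" for w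
      proof -
        have "bracket b w \<in> rs (\<lambda>h. - \<alpha> h)" using rs_bracket[OF b' w] by simp
        then have "killing y (bracket b w) = 0" using y(3) by blast
        then show ?thesis
          using killing_invariant[of y b w] killing_scale_left[of "-1" "bracket y b" w]
            bracket_anti[of b y] by simp
      qed
      then have "bracket b y \<in> P" using rs_bracket[OF b' y(1)] True by (auto simp: P_def)
      then show ?thesis by (rule span_base)
    qed
  qed
  have "lie_ideal UNIV (span P)"
    using bracket_span_in[OF P subspace_span] by (simp add: lie_ideal_def span_B)
  moreover have "span P \<inter> H \<subseteq> {0}"
  proof
    fix z assume z: "z \<in> span P \<inter> H"
    \<comment> \<open>Elements of \<open>H\<close> have coordinates only at basis vectors of weight
      zero, elements of \<open>span P\<close> only at the others.\<close>
    have "cf b z = 0" if b: "b \<in> B" for b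
    proof (cases "\<exists>h\<in>H. wt b h \<noteq> 0")
      case True
      then show ?thesis using z rs_zero[of "\<lambda>_. 0"] rs_cf[of z "\<lambda>_. 0" b] b by auto
    next
      case False
      have "P \<subseteq> {z. cf b z = 0}"
      proof
        fix y assume "y \<in> P"
        then obtain \<alpha> h where y: "y \<in> rs \<alpha>" "h \<in> H" "\<alpha> h \<noteq> 0" by (auto simp: P_def)
        then show "y \<in> {z. cf b z = 0}" using False rs_cf[OF y(1) b _ y(2)] by auto
      qed
      moreover have "subspace {z. cf b z = 0}" by (simp add: subspace_def cf_add cf_scale)
      ultimately show ?thesis using span_minimal z by blast
    qed
    then show "z \<in> {0}" using sum_cf[of z] by simp
  qed
  ultimately have "span P = {0}" by (rule ideal_meets_H)
  moreover have "x \<in> P" using asm x h by (auto simp: P_def)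
  ultimately show False using x(2) span_base by blast
qed

end

section \<open>The root system\<close>

context weight_basis
begin

abbreviation \<Phi> :: "('g \<Rightarrow> complex) set" where
  "\<Phi> \<equiv> roots UNIV H"

abbreviation cr :: "('g \<Rightarrow> complex) \<Rightarrow> 'g" where
  "cr \<equiv> coroot UNIV H"

text \<open>Linearity on \<open>H\<close>, which \<open>dual_space\<close> demands, follows from the
  bilinearity of the bracket by acting on a nonzero weight vector.\<close>

lemma roots_iff:
  "\<alpha> \<in> \<Phi> \<longleftrightarrow> (\<exists>x\<in>rs \<alpha>. x \<noteq> 0) \<and> (\<exists>h\<in>H. \<alpha> h \<noteq> 0) \<and> (\<forall>h. h \<notin> H \<longrightarrow> \<alpha> h = 0)"
proof
  assume "\<alpha> \<in> \<Phi>"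
  then show "(\<exists>x\<in>rs \<alpha>. x \<noteq> 0) \<and> (\<exists>h\<in>H. \<alpha> h \<noteq> 0) \<and> (\<forall>h. h \<notin> H \<longrightarrow> \<alpha> h = 0)"
    using subspace_0[OF subspace_rs[of \<alpha>]] by (auto simp: roots_def dual_space_def fun_eq_iff)
next
  assume *: "(\<exists>x\<in>rs \<alpha>. x \<noteq> 0) \<and> (\<exists>h\<in>H. \<alpha> h \<noteq> 0) \<and> (\<forall>h. h \<notin> H \<longrightarrow> \<alpha> h = 0)"
  then obtain x where x: "x \<in> rs \<alpha>" "x \<noteq> 0" by blast
  have "\<alpha> (h + k) = \<alpha> h + \<alpha> k" if "h \<in> H" "k \<in> H" for h k
  proof -
    have "\<alpha> (h + k) *s x = bracket (h + k) x"
      using x(1) subspace_add[OF subspace_H that] by (simp add: rs_iff)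
    also have "\<dots> = (\<alpha> h + \<alpha> k) *s x"
      using x(1) that by (simp add: rs_iff scale_left_distrib bracket_add_left)
    finally show ?thesis using x(2) by simp
  qed
  moreover have "\<alpha> (c *s h) = c * \<alpha> h" if "h \<in> H" for h c
  proof -
    have "\<alpha> (c *s h) *s x = bracket (c *s h) x"
      using x(1) subspace_scale[OF subspace_H that, of c] by (simp add: rs_iff)
    also have "\<dots> = (c * \<alpha> h) *s x"
      using x(1) that by (simp add: rs_iff bracket_scale_left)
    finally show ?thesis using x(2) by simp
  qed
  ultimately show "\<alpha> \<in> \<Phi>" using * x by (auto simp: roots_def dual_space_def)
qed

lemma root_vanish: "\<alpha> \<in> \<Phi> \<Longrightarrow> h \<notin> H \<Longrightarrow> \<alpha> h = 0"
  by (simp add: roots_iff)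

lemma root_add: "\<alpha> \<in> \<Phi> \<Longrightarrow> h \<in> H \<Longrightarrow> k \<in> H \<Longrightarrow> \<alpha> (h + k) = \<alpha> h + \<alpha> k"
  and root_scale: "\<alpha> \<in> \<Phi> \<Longrightarrow> h \<in> H \<Longrightarrow> \<alpha> (c *s h) = c * \<alpha> h"
  by (auto simp: roots_def dual_space_def)

lemma root_minus: "\<alpha> \<in> \<Phi> \<Longrightarrow> h \<in> H \<Longrightarrow> \<alpha> (- h) = - \<alpha> h"
  using root_scale[of \<alpha> h "-1"] by simp

lemma root_diff: "\<alpha> \<in> \<Phi> \<Longrightarrow> h \<in> H \<Longrightarrow> k \<in> H \<Longrightarrow> \<alpha> (h - k) = \<alpha> h - \<alpha> k"
  using root_add[of \<alpha> h "- k"] root_minus[of \<alpha> k] subspace_neg[OF subspace_H, of k] by simp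

lemma root_sum: "\<alpha> \<in> \<Phi> \<Longrightarrow> (\<And>a. a \<in> A \<Longrightarrow> f a \<in> H) \<Longrightarrow> \<alpha> (sum f A) = (\<Sum>a\<in>A. \<alpha> (f a))"
proof (induction A rule: infinite_finite_induct)
  case (insert a A)
  then show ?case using subspace_sum[OF subspace_H, of A f] by (simp add: root_add)
qed (use root_scale[of \<alpha> 0 0] subspace_0[OF subspace_H] in auto)

lemma weight_root:
  assumes "x \<in> rs \<alpha>" "x \<noteq> 0" "h \<in> H" "\<alpha> h \<noteq> 0"
  shows "(\<lambda>h. if h \<in> H then \<alpha> h else 0) \<in> \<Phi>"
  using assms rs_cong[of \<alpha> "\<lambda>h. if h \<in> H then \<alpha> h else 0"] by (auto simp: roots_iff)

lemma sl2_triple: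
  assumes \<alpha>: "\<alpha> \<in> \<Phi>" and x: "x \<in> rs \<alpha>" "x \<noteq> 0"
  obtains y where "y \<in> rs (\<lambda>h. - \<alpha> h)" "\<alpha> (bracket x y) = 2" "bracket x y \<in> H"
proof -
  obtain h where h: "h \<in> H" "\<alpha> h \<noteq> 0" using \<alpha> by (auto simp: roots_iff)
  obtain y where y: "y \<in> rs (\<lambda>h. - \<alpha> h)" "killing x y \<noteq> 0"
    using killing_opposite_nonzero[OF x h] by blast
  have sH: "bracket x y \<in> H" by (rule rs_bracket_neg[OF x(1) y(1)])
  have "bracket x y \<noteq> 0" using killing_bracket[OF h(1) x(1), of y] h(2) y(2) by auto
  then have s: "\<alpha> (bracket x y) \<noteq> 0"
    using bracket_eq_zero_if_isotropic[OF x(1) y(1) refl h] by blast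
  let ?c = "2 / \<alpha> (bracket x y)"
  show ?thesis
  proof (rule that)
    show "?c *s y \<in> rs (\<lambda>h. - \<alpha> h)" using subspace_scale[OF subspace_rs y(1)] .
    show "\<alpha> (bracket x (?c *s y)) = 2" "bracket x (?c *s y) \<in> H"
      using s \<alpha> sH subspace_scale[OF subspace_H sH] by (simp_all add: bracket_scale_right root_scale)
  qed
qed

text \<open>Uniqueness precedes the one-dimensionality of root spaces, whose proof uses the coroot.
  The four Killing products among \<open>t\<close> and \<open>t'\<close> are equal, so the
  difference has norm zero, and it has integral weights.\<close>

lemma coroot_unique:
  assumes \<alpha>: "\<alpha> \<in> \<Phi>"
    and e: "e \<in> rs \<alpha>" "f \<in> rs (\<lambda>h. - \<alpha> h)" "t = bracket e f" "\<alpha> t = 2"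
    and e': "e' \<in> rs \<alpha>" "f' \<in> rs (\<lambda>h. - \<alpha> h)" "t' = bracket e' f'" "\<alpha> t' = 2"
  shows "t = t'"
proof -
  have H: "t \<in> H" "t' \<in> H" "t - t' \<in> H"
    using rs_bracket_neg e e' subspace_diff[OF subspace_H] by auto
  have "killing t t = killing t' t" "killing t' t' = killing t t'"
    using killing_bracket[OF H(1) e(1), of f] killing_bracket[OF H(2) e(1), of f]
      killing_bracket[OF H(1) e'(1), of f'] killing_bracket[OF H(2) e'(1), of f'] e e' by simp_all
  then have "killing (t - t') (t - t') = 0"
    using killing_commute[of t t'] by (simp add: killing_diff_left killing_diff_right)
  moreover have "wt b (t - t') \<in> \<int>" if b: "b \<in> B" for b
  proof -
    have "wt b (t - t') *s b = bracket (t - t') b" using wt[OF b H(3)] by simp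
    also have "\<dots> = (wt b t - wt b t') *s b"
      using wt[OF b] H by (simp add: scale_left_diff_distrib bracket_diff_left)
    finally have "wt b (t - t') = wt b t - wt b t'"
      using b independent_B dependent_zero by auto
    then show ?thesis
      using wt_Ints[OF e b] wt_Ints[OF e' b] by simp
  qed
  ultimately show ?thesis using killing_definite[OF H(3)] by simp
qed

lemma coroot_eq:
  assumes "\<alpha> \<in> \<Phi>" "e \<in> rs \<alpha>" "f \<in> rs (\<lambda>h. - \<alpha> h)" "\<alpha> (bracket e f) = 2"
  shows "cr \<alpha> = bracket e f"
  unfolding coroot_def
proof (rule the_equality)
  show "(\<exists>x\<in>rs \<alpha>. \<exists>y\<in>rs (\<lambda>h. - \<alpha> h). bracket e f = bracket x y) \<and> \<alpha> (bracket e f) = 2"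
    using assms by blast
  fix t assume "(\<exists>x\<in>rs \<alpha>. \<exists>y\<in>rs (\<lambda>h. - \<alpha> h). t = bracket x y) \<and> \<alpha> t = 2"
  then obtain x y where x: "x \<in> rs \<alpha>" "y \<in> rs (\<lambda>h. - \<alpha> h)" "t = bracket x y" "\<alpha> t = 2" by blast
  show "t = bracket e f" by (rule coroot_unique[OF assms(1) x assms(2,3) refl assms(4)])
qed

lemma coroot_triple:
  assumes "\<alpha> \<in> \<Phi>"
  obtains e f where "e \<in> rs \<alpha>" "e \<noteq> 0" "f \<in> rs (\<lambda>h. - \<alpha> h)" "cr \<alpha> = bracket e f"
proof -
  obtain x where x: "x \<in> rs \<alpha>" "x \<noteq> 0" using assms by (auto simp: roots_iff)
  obtain y where "y \<in> rs (\<lambda>h. - \<alpha> h)" "\<alpha> (bracket x y) = 2" using sl2_triple[OF assms x] .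
  then show ?thesis using coroot_eq[OF assms x(1)] that[OF x] by blast
qed

lemma
  assumes "\<alpha> \<in> \<Phi>"
  shows coroot_H: "cr \<alpha> \<in> H" and root_coroot: "\<alpha> (cr \<alpha>) = 2"
proof -
  obtain x where x: "x \<in> rs \<alpha>" "x \<noteq> 0" using assms by (auto simp: roots_iff)
  obtain y where "y \<in> rs (\<lambda>h. - \<alpha> h)" "\<alpha> (bracket x y) = 2" "bracket x y \<in> H"
    using sl2_triple[OF assms x] .
  then show "cr \<alpha> \<in> H" "\<alpha> (cr \<alpha>) = 2" using coroot_eq[OF assms x(1)] by auto
qed

lemma bracket_opposite:
  assumes \<alpha>: "\<alpha> \<in> \<Phi>" and x: "x \<in> rs \<alpha>" and y: "y \<in> rs (\<lambda>h. - \<alpha> h)"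
  obtains c where "bracket x y = c *s cr \<alpha>"
proof (cases "bracket x y = 0")
  case True
  then show ?thesis using that[of 0] by simp
next
  case False
  obtain h where h: "h \<in> H" "\<alpha> h \<noteq> 0" using \<alpha> by (auto simp: roots_iff)
  have sH: "bracket x y \<in> H" by (rule rs_bracket_neg[OF x y])
  have s: "\<alpha> (bracket x y) \<noteq> 0"
    using bracket_eq_zero_if_isotropic[OF x y refl h] False by blast
  let ?c = "2 / \<alpha> (bracket x y)"
  have "\<alpha> (bracket x (?c *s y)) = 2" using s \<alpha> sH by (simp add: bracket_scale_right root_scale)
  then have "cr \<alpha> = ?c *s bracket x y"
    using coroot_eq[OF \<alpha> x subspace_scale[OF subspace_rs y]] by (simp add: bracket_scale_right)
  then have "bracket x y = (\<alpha> (bracket x y) / 2) *s cr \<alpha>" using s by simp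
  then show ?thesis using that by blast
qed

text \<open>Up to a nonzero factor \<open>cr \<alpha>\<close> represents the functional
  \<open>\<alpha>\<close> through the Killing form. This gives the symmetry of vanishing Cartan
  integers and later the independence of the coroots.\<close>

lemma killing_coroot:
  assumes "\<alpha> \<in> \<Phi>" "h \<in> H"
  shows "killing h (cr \<alpha>) = \<alpha> h * (killing (cr \<alpha>) (cr \<alpha>) / 2)"
proof -
  obtain e f where e: "e \<in> rs \<alpha>" "f \<in> rs (\<lambda>h. - \<alpha> h)" "cr \<alpha> = bracket e f"
    using coroot_triple[OF assms(1)] by metis
  have "killing (cr \<alpha>) (cr \<alpha>) = 2 * killing e f"
    using killing_bracket[OF coroot_H[OF assms(1)] e(1), of f] e(3) root_coroot[OF assms(1)] by simp
  then show ?thesis using killing_bracket[OF assms(2) e(1), of f] e(3) by simp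
qed

lemma killing_coroot_nonzero:
  assumes "\<alpha> \<in> \<Phi>"
  shows "killing (cr \<alpha>) (cr \<alpha>) \<noteq> 0"
proof
  obtain e f where e: "e \<in> rs \<alpha>" "f \<in> rs (\<lambda>h. - \<alpha> h)" "cr \<alpha> = bracket e f"
    using coroot_triple[OF assms(1)] by metis
  assume "killing (cr \<alpha>) (cr \<alpha>) = 0"
  then have "cr \<alpha> = 0"
    using killing_definite[OF coroot_H[OF assms]] wt_Ints[OF e root_coroot[OF assms]] by blast
  then show False using root_coroot[OF assms] root_scale[OF assms subspace_0[OF subspace_H], of 0] by simp
qed

lemma coroot_zero_sym:
  assumes "\<alpha> \<in> \<Phi>" "\<beta> \<in> \<Phi>" "\<alpha> (cr \<beta>) = 0"
  shows "\<beta> (cr \<alpha>) = 0"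
  using killing_coroot[OF assms(1) coroot_H[OF assms(2)]]
    killing_coroot[OF assms(2) coroot_H[OF assms(1)]] assms(3)
    killing_coroot_nonzero[OF assms(2)] killing_commute[of "cr \<alpha>" "cr \<beta>"] by simp

section \<open>Strings, reflections and multiples of roots\<close>

lemma root_neg:
  assumes "\<alpha> \<in> \<Phi>"
  shows "(\<lambda>h. - \<alpha> h) \<in> \<Phi>"
proof -
  obtain x h where x: "x \<in> rs \<alpha>" "x \<noteq> 0" "h \<in> H" "\<alpha> h \<noteq> 0" using assms by (auto simp: roots_iff)
  obtain y where "y \<in> rs (\<lambda>h. - \<alpha> h)" "killing x y \<noteq> 0"
    using killing_opposite_nonzero[OF x] by blast
  moreover from this have "y \<noteq> 0" by auto
  ultimately show ?thesis using x root_vanish[OF assms] by (auto simp: roots_iff)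
qed

lemma cartan_integer:
  assumes \<alpha>: "\<alpha> \<in> \<Phi>" and \<beta>: "\<beta> \<in> \<Phi>"
  shows "\<beta> (cr \<alpha>) \<in> \<int>"
proof -
  obtain e f where e: "e \<in> rs \<alpha>" "f \<in> rs (\<lambda>h. - \<alpha> h)" "cr \<alpha> = bracket e f"
    using coroot_triple[OF \<alpha>] by metis
  obtain v where v: "v \<in> rs \<beta>" "v \<noteq> 0" using \<beta> by (auto simp: roots_iff)
  obtain p m :: nat where "\<beta> (cr \<alpha>) = of_nat m - 2 * of_nat p"
    by (rule weight_string[OF e root_coroot[OF \<alpha>] v])
  then show ?thesis by (auto intro: Ints_diff Ints_mult)
qed

text \<open>For a nonnegative pairing \<open>j\<close> the string starts \<open>p\<close> steps
  above \<open>\<beta>\<close> and descends \<open>m = j + 2 * p\<close> steps; the member with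
  index \<open>p + j\<close> has the reflected weight. For a negative pairing \<open>e\<close> and
  \<open>f\<close> change places.\<close>

lemma root_reflection:
  assumes \<alpha>: "\<alpha> \<in> \<Phi>" and \<beta>: "\<beta> \<in> \<Phi>"
  shows "(\<lambda>h. \<beta> h - \<beta> (cr \<alpha>) * \<alpha> h) \<in> \<Phi>"
proof -
  let ?\<gamma> = "\<lambda>h. \<beta> h - \<beta> (cr \<alpha>) * \<alpha> h"
  obtain e f where e: "e \<in> rs \<alpha>" "f \<in> rs (\<lambda>h. - \<alpha> h)" "cr \<alpha> = bracket e f"
    using coroot_triple[OF \<alpha>] by metis
  obtain v where v: "v \<in> rs \<beta>" "v \<noteq> 0" using \<beta> by (auto simp: roots_iff)
  have step: "\<exists>w\<in>rs (\<lambda>h. \<beta> h - \<beta> t * \<gamma> h). w \<noteq> 0"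
    if e: "e \<in> rs \<gamma>" and f: "f \<in> rs (\<lambda>h. - \<gamma> h)" and t: "t = bracket e f" and 2: "\<gamma> t = 2"
      and j: "\<beta> t = of_nat j" for e f \<gamma> t and j :: nat
  proof -
    obtain p m :: nat where pm: "\<beta> t = of_nat m - 2 * of_nat p"
      and k: "\<And>k. k \<le> m \<Longrightarrow> \<exists>w\<in>rs (\<lambda>h. \<beta> h + (of_nat p - of_nat k) * \<gamma> h). w \<noteq> 0"
      by (rule weight_string[OF e f t 2 v]) (rule that)
    have "of_nat m = (of_nat (j + 2 * p) :: complex)" using pm j by (simp add: algebra_simps)
    then have "m = j + 2 * p" using of_nat_eq_iff by blast
    then have "\<exists>w\<in>rs (\<lambda>h. \<beta> h + (of_nat p - of_nat (p + j)) * \<gamma> h). w \<noteq> 0" by (intro k) simp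
    moreover have "(\<lambda>h. \<beta> h + (of_nat p - of_nat (p + j)) * \<gamma> h) = (\<lambda>h. \<beta> h - \<beta> t * \<gamma> h)"
      unfolding j by (simp add: fun_eq_iff algebra_simps)
    ultimately show ?thesis by (simp only:)
  qed
  obtain n where n: "\<beta> (cr \<alpha>) = of_int n" using cartan_integer[OF \<alpha> \<beta>] by (auto elim: Ints_cases)
  have "\<exists>w\<in>rs ?\<gamma>. w \<noteq> 0"
  proof (cases "n \<ge> 0")
    case True
    then have "\<beta> (cr \<alpha>) = of_nat (nat n)" using n by (simp add: of_nat_nat)
    then show ?thesis using step[OF e root_coroot[OF \<alpha>]] by blast
  next
    case False
    have t: "- cr \<alpha> = bracket f e" using e(3) bracket_anti[of f e] by simp
    have "- \<alpha> (- cr \<alpha>) = 2" "\<beta> (- cr \<alpha>) = of_nat (nat (- n))"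
      using root_minus[OF \<alpha> coroot_H[OF \<alpha>]] root_minus[OF \<beta> coroot_H[OF \<alpha>]] root_coroot[OF \<alpha>] n False
      by (simp_all add: of_nat_nat)
    then have "\<exists>w\<in>rs (\<lambda>h. \<beta> h - \<beta> (- cr \<alpha>) * (- \<alpha> h)). w \<noteq> 0"
      using e(1) by (intro step[OF e(2) _ t, of "nat (- n)"]) auto
    moreover have "(\<lambda>h. \<beta> h - \<beta> (- cr \<alpha>) * (- \<alpha> h)) = ?\<gamma>"
      using root_minus[OF \<beta> coroot_H[OF \<alpha>]] by (simp add: fun_eq_iff)
    ultimately show ?thesis by (simp only:)
  qed
  moreover have "\<exists>h\<in>H. ?\<gamma> h \<noteq> 0"
  proof (rule ccontr)
    assume *: "\<not> ?thesis"
    then have "\<beta> (cr \<alpha>) - \<beta> (cr \<alpha>) * \<alpha> (cr \<alpha>) = 0" using coroot_H[OF \<alpha>] by blast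
    then have "\<beta> (cr \<alpha>) = 0" using root_coroot[OF \<alpha>] by simp
    then show False using * \<beta> by (auto simp: roots_iff)
  qed
  ultimately show ?thesis using root_vanish \<alpha> \<beta> by (auto simp: roots_iff)
qed

text \<open>Subtracting a suitable multiple of \<open>x\<close> from \<open>z\<close> leaves a
  vector \<open>v\<close> killed by \<open>y\<close>. A nonzero such vector cannot have eigenvalue
  \<open>2\<close> for \<open>bracket x y\<close>: by \<open>ladder\<close> with \<open>x\<close>
  and \<open>y\<close> exchanged, its powers under \<open>x\<close> would never vanish.\<close>

lemma root_space_one_dim:
  assumes \<alpha>: "\<alpha> \<in> \<Phi>" and x: "x \<in> rs \<alpha>" "x \<noteq> 0" and z: "z \<in> rs \<alpha>"
  obtains c where "z = c *s x"
proof -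
  obtain y where y: "y \<in> rs (\<lambda>h. - \<alpha> h)" "\<alpha> (bracket x y) = 2" "bracket x y \<in> H"
    using sl2_triple[OF \<alpha> x] .
  define t where "t = bracket x y"
  obtain c where c: "bracket z y = c *s cr \<alpha>" using bracket_opposite[OF \<alpha> z y(1)] .
  define v where "v = z - c *s x"
  have v: "v \<in> rs \<alpha>" unfolding v_def using subspace_diff[OF subspace_rs z] subspace_scale[OF subspace_rs x(1)] by blast
  have "bracket v y = 0"
    using c coroot_eq[OF \<alpha> x(1) y(1,2)] by (simp add: v_def bracket_diff_left bracket_scale_left)
  then have yv: "bracket y v = 0" using bracket_anti[of y v] by simp
  have "v = 0"
  proof (rule ccontr)
    assume "v \<noteq> 0"
    obtain k where "(bracket x ^^ k) v = 0"
      using bracket_power_eventually_zero[OF x(1) v y(3)] y(2) by auto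
    then obtain n where n: "bracket x ((bracket x ^^ n) v) = 0" "\<And>j. j \<le> n \<Longrightarrow> (bracket x ^^ j) v \<noteq> 0"
      using last_nonzero_power[of k "bracket x" v] \<open>v \<noteq> 0\<close> by metis
    have xx: "x \<in> rs (\<lambda>h. - (- \<alpha> h))" using x(1) by simp
    have "bracket y ((bracket x ^^ Suc n) v) = 0" using n(1) by simp
    then have "(of_nat (Suc n) * (\<alpha> (bracket y x) - of_nat n * (- \<alpha> (bracket y x)) / 2)) *s (bracket x ^^ n) v = 0"
      using ladder[OF y(1) xx refl v yv, of n] by (simp only:)
    then have "of_nat (Suc n) * (\<alpha> (bracket y x) - of_nat n * (- \<alpha> (bracket y x)) / 2) = 0"
      using n(2)[of n] by simp
    moreover have "\<alpha> (bracket y x) = -2"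
      using y root_minus[OF \<alpha> y(3)] bracket_anti[of y x] by simp
    ultimately have "of_nat (Suc n) * (- 2 - of_nat n :: complex) = 0" by simp
    then have "- 2 - of_nat n = (0::complex)"
      by (metis mult_eq_0_iff of_nat_eq_0_iff old.nat.distinct(2))
    then have "of_nat (n + 2) = (0::complex)" by (simp add: algebra_simps)
    then show False by (metis of_nat_eq_0_iff add_is_0 zero_neq_numeral)
  qed
  then show ?thesis using that[of c] by (simp add: v_def)
qed

text \<open>The value of \<open>\<alpha>\<close> on the coroot of its \<open>n\<close>-fold multiple
  is \<open>2 / n\<close>, so \<open>n\<close> divides \<open>2\<close>. For \<open>n = 2\<close>, a
  vector \<open>v\<close> of weight twice \<open>\<alpha>\<close> is killed by \<open>e\<close>,
  since three times \<open>\<alpha>\<close> is no root, and \<open>bracket f v\<close> is a multiple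
  of \<open>e\<close>. So \<open>cr \<alpha>\<close> kills \<open>v\<close>, although its eigenvalue
  there is \<open>4\<close>.\<close>

lemma root_multiple:
  assumes \<alpha>: "\<alpha> \<in> \<Phi>" and n: "(\<lambda>h. of_nat n * \<alpha> h) \<in> \<Phi>"
  shows "n = 1"
proof -
  have dvd: "k dvd 2" if k: "(\<lambda>h. of_nat k * \<alpha> h) \<in> \<Phi>" for k :: nat
  proof -
    let ?\<beta> = "\<lambda>h. of_nat k * \<alpha> h"
    obtain j where "\<alpha> (cr ?\<beta>) = of_int j" using cartan_integer[OF k \<alpha>] by (auto elim: Ints_cases)
    then have "of_int (int k * j) = (of_int 2 :: complex)" using root_coroot[OF k] by simp
    then have "int k * j = 2" using of_int_eq_iff by blast
    then have "int k dvd int 2" by (metis dvd_triv_left of_nat_numeral)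
    then show ?thesis by (simp only: of_nat_dvd_iff)
  qed
  have "n \<noteq> 2"
  proof
    assume n2: "n = 2"
    obtain v where v: "v \<in> rs (\<lambda>h. 2 * \<alpha> h)" "v \<noteq> 0" using n n2 by (auto simp: roots_iff)
    obtain e f where e: "e \<in> rs \<alpha>" "e \<noteq> 0" "f \<in> rs (\<lambda>h. - \<alpha> h)" "cr \<alpha> = bracket e f"
      using coroot_triple[OF \<alpha>] by metis
    have ev: "bracket e v = 0"
    proof (rule ccontr)
      assume nz: "bracket e v \<noteq> 0"
      have "bracket e v \<in> rs (\<lambda>h. of_nat 3 * \<alpha> h)"
        using rs_bracket[OF e(1) v(1)] by (simp add: algebra_simps)
      then have "(\<lambda>h. of_nat 3 * \<alpha> h) \<in> \<Phi>"
        using nz \<alpha> root_vanish[OF \<alpha>] by (auto simp: roots_iff)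
      then show False using dvd by fastforce
    qed
    have "bracket f v \<in> rs \<alpha>" using rs_bracket[OF e(3) v(1)] by (simp add: algebra_simps)
    then obtain c where "bracket f v = c *s e" using root_space_one_dim[OF \<alpha> e(1,2)] by blast
    then have "bracket e (bracket f v) = 0" by (simp add: bracket_scale_right bracket_self)
    then have "bracket (cr \<alpha>) v = 0" using leibniz[of e f v] ev e(4) by simp
    moreover have "bracket (cr \<alpha>) v = 4 *s v"
      using v(1) coroot_H[OF \<alpha>] root_coroot[OF \<alpha>] by (simp add: rs_iff)
    ultimately show False using v(2) by simp
  qed
  moreover have "n \<le> 2" "n \<noteq> 0" using dvd[OF n] dvd_imp_le[of n 2] by (auto intro: Nat.gr0I)
  ultimately show ?thesis by linarith
qed

lemma finite_roots: "finite \<Phi>"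
proof -
  have "\<Phi> \<subseteq> wt ` B"
  proof
    fix \<alpha> assume \<alpha>: "\<alpha> \<in> \<Phi>"
    then obtain x where x: "x \<in> rs \<alpha>" "x \<noteq> 0" by (auto simp: roots_iff)
    obtain b where b: "b \<in> B" "\<And>h. h \<in> H \<Longrightarrow> wt b h = \<alpha> h" by (rule rs_weight[OF x]) (rule that)
    then have "wt b = \<alpha>" using wt_outside root_vanish[OF \<alpha>] by (metis ext)
    then show "\<alpha> \<in> wt ` B" using b by blast
  qed
  then show ?thesis using finite_B finite_subset by blast
qed

lemma roots_separate_H:
  assumes "h \<in> H" "\<And>\<alpha>. \<alpha> \<in> \<Phi> \<Longrightarrow> \<alpha> h = 0"
  shows "h = 0"
proof (rule weights_separate_H[OF assms(1)])
  fix b assume b: "b \<in> B"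
  note basis_rs[OF b]
  then show "wt b h = 0"
    using weight_root[of b "wt b" h] assms by fastforce
qed

end

section \<open>Integral root systems and words in simple reflections\<close>

text \<open>Roots are recorded by their coefficients with respect to the simple roots, and \<open>A i j\<close> is the
  value of the \<open>j\<close>-th simple root on the \<open>i\<close>-th simple coroot.\<close>

locale integral_roots =
  fixes D :: "'i set" and A :: "'i \<Rightarrow> 'i \<Rightarrow> int" and R :: "('i \<Rightarrow> int) set"
  assumes finite_D: "finite D" and finite_R: "finite R"
    and A_diag: "i \<in> D \<Longrightarrow> A i i = 2"
    and A_zero: "i \<in> D \<Longrightarrow> j \<in> D \<Longrightarrow> A i j = 0 \<Longrightarrow> A j i = 0"
    and R_outside: "v \<in> R \<Longrightarrow> i \<notin> D \<Longrightarrow> v i = 0"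
    and R_sign: "v \<in> R \<Longrightarrow> (\<forall>i. 0 \<le> v i) \<or> (\<forall>i. v i \<le> 0)"
    and R_nonzero: "(\<lambda>_. 0) \<notin> R"
    and R_simple: "i \<in> D \<Longrightarrow> (\<lambda>_. 0)(i := 1) \<in> R"
    and R_neg: "v \<in> R \<Longrightarrow> (\<lambda>i. - v i) \<in> R"
    and R_reflection: "i \<in> D \<Longrightarrow> v \<in> R \<Longrightarrow> v(i := v i - (\<Sum>j\<in>D. A i j * v j)) \<in> R"
    and R_multiple: "i \<in> D \<Longrightarrow> (\<lambda>_. 0)(i := n) \<in> R \<Longrightarrow> 0 < n \<Longrightarrow> n = 1"
begin

definition e :: "'i \<Rightarrow> 'i \<Rightarrow> int" where
  "e i = (\<lambda>_. 0)(i := 1)"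

definition pr :: "'i \<Rightarrow> ('i \<Rightarrow> int) \<Rightarrow> int" where
  "pr i v = (\<Sum>j\<in>D. A i j * v j)"

definition s :: "'i \<Rightarrow> ('i \<Rightarrow> int) \<Rightarrow> 'i \<Rightarrow> int" where
  "s i v = v(i := v i - pr i v)"

definition act :: "'i list \<Rightarrow> ('i \<Rightarrow> int) \<Rightarrow> 'i \<Rightarrow> int" where
  "act ws = foldr s ws"

definition pos :: "('i \<Rightarrow> int) \<Rightarrow> bool" where
  "pos v \<longleftrightarrow> v \<in> R \<and> (\<forall>i. 0 \<le> v i)"

text \<open>Stands for equality in the Weyl group. Testing on roots keeps the group itself out of
  the combinatorics; \<open>wp_eq_iff\<close> identifies the two notions.\<close>

definition eqv :: "'i list \<Rightarrow> 'i list \<Rightarrow> bool" where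
  "eqv us ws \<longleftrightarrow> (\<forall>v\<in>R. act us v = act ws v)"

definition len :: "'i list \<Rightarrow> nat" where
  "len ws = (LEAST n. \<exists>us. set us \<subseteq> D \<and> length us = n \<and> eqv ws us)"

definition longest :: "'i list \<Rightarrow> bool" where
  "longest ws \<longleftrightarrow> set ws \<subseteq> D \<and> (\<forall>us. set us \<subseteq> D \<longrightarrow> len us \<le> len ws)"

lemma e_R: "i \<in> D \<Longrightarrow> e i \<in> R"
  by (simp add: e_def R_simple)

lemma s_R: "i \<in> D \<Longrightarrow> v \<in> R \<Longrightarrow> s i v \<in> R"
  by (simp add: s_def pr_def R_reflection)

lemma pr_upd: "i \<in> D \<Longrightarrow> pr k (v(i := c)) = pr k v + A k i * (c - v i)"
proof -
  assume i: "i \<in> D"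
  have "pr k (v(i := c)) = (\<Sum>j\<in>D. A k j * v j + (if j = i then A k i * (c - v i) else 0))"
    unfolding pr_def by (rule sum.cong) (auto simp: algebra_simps)
  then show ?thesis using i finite_D by (simp add: sum.distrib pr_def)
qed

lemma pr_zero [simp]: "pr k (\<lambda>_. 0) = 0"
  by (simp add: pr_def)

lemma pr_e: "j \<in> D \<Longrightarrow> pr i (e j) = A i j"
  by (simp add: e_def pr_upd)

lemma pr_linear: "pr i (\<lambda>j. x j + c * y j) = pr i x + c * pr i y"
  by (simp add: pr_def sum.distrib sum_distrib_left algebra_simps)

lemma s_linear: "s i (\<lambda>j. x j + c * y j) = (\<lambda>j. s i x j + c * s i y j)"
  by (auto simp: s_def pr_linear algebra_simps)

lemma s_involution: "i \<in> D \<Longrightarrow> s i (s i v) = v"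
  by (auto simp: s_def pr_upd A_diag)

lemma s_e: "i \<in> D \<Longrightarrow> s i (e i) = (\<lambda>j. - e i j)"
  by (auto simp: s_def pr_e A_diag) (auto simp: e_def)

lemma act_Nil [simp]: "act [] v = v" and act_Cons [simp]: "act (i # ws) v = s i (act ws v)"
  and act_append [simp]: "act (us @ ws) v = act us (act ws v)"
  by (simp_all add: act_def)

lemma act_R: "set ws \<subseteq> D \<Longrightarrow> v \<in> R \<Longrightarrow> act ws v \<in> R"
  by (induction ws) (auto simp: s_R)

lemma act_linear: "act ws (\<lambda>j. x j + c * y j) = (\<lambda>j. act ws x j + c * act ws y j)"
  by (induction ws) (auto simp: s_linear)

lemma act_uminus: "act ws (\<lambda>j. - x j) = (\<lambda>j. - act ws x j)"
  by (induction ws) (auto simp: s_def pr_def sum_negf)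

lemma act_rev: "set ws \<subseteq> D \<Longrightarrow> act (rev ws) (act ws v) = v"
  by (induction ws arbitrary: v) (auto simp: s_involution)

lemma act_rev': "set ws \<subseteq> D \<Longrightarrow> act ws (act (rev ws) v) = v"
  using act_rev[of "rev ws" v] by simp

lemma s_sum: "s i (\<lambda>k. \<Sum>j\<in>J. c j * f j k) = (\<lambda>k. \<Sum>j\<in>J. c j * s i (f j) k)"
proof -
  have "pr i (\<lambda>k. \<Sum>j\<in>J. c j * f j k) = (\<Sum>j\<in>J. c j * pr i (f j))"
    unfolding pr_def sum_distrib_left by (subst sum.swap) (simp add: ac_simps)
  then show ?thesis
    by (auto simp: s_def fun_eq_iff sum_subtractf algebra_simps)
qed

lemma act_sum: "act ws (\<lambda>k. \<Sum>j\<in>J. c j * f j k) = (\<lambda>k. \<Sum>j\<in>J. c j * act ws (f j) k)"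
  by (induction ws) (auto simp: s_sum)

lemma act_expand:
  assumes "\<And>i. i \<notin> D \<Longrightarrow> v i = 0"
  shows "act ws v k = (\<Sum>i\<in>D. v i * act ws (e i) k)"
proof -
  have "v = (\<lambda>k. \<Sum>i\<in>D. v i * e i k)"
  proof
    fix k show "v k = (\<Sum>i\<in>D. v i * e i k)"
      using assms[of k] finite_D by (cases "k \<in> D") (auto simp: e_def if_distrib cong: if_cong)
  qed
  then show ?thesis using act_sum[of ws v e D] by metis
qed

lemma posI: "v \<in> R \<Longrightarrow> 0 < v i \<Longrightarrow> pos v"
  using R_sign[of v] by (auto simp: pos_def) (meson leD)

lemma not_posD: "v \<in> R \<Longrightarrow> \<not> pos v \<Longrightarrow> v i \<le> 0"
  using posI[of v i] by force

lemma pos_e: "i \<in> D \<Longrightarrow> pos (e i)"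
  using e_R[of i] by (auto simp: pos_def e_def)

lemma pos_ex: "pos v \<Longrightarrow> \<exists>i\<in>D. 0 < v i"
  using R_nonzero R_outside unfolding pos_def by (metis ext order_le_less)

lemma pos_uminus: "pos v \<Longrightarrow> \<not> pos (\<lambda>i. - v i)"
  using pos_ex[of v] by (auto simp: pos_def) (meson leD)

text \<open>Only coordinate \<open>i\<close> changes, so a change of sign forces all other
  coordinates of \<open>v\<close> to vanish; \<open>R_multiple\<close> then fixes the remaining
  one.\<close>

lemma pos_reflection:
  assumes "pos v" "i \<in> D" "\<not> pos (s i v)"
  shows "v = e i"
proof -
  have le: "s i v j \<le> 0" for j
    using not_posD[OF s_R[OF assms(2)] assms(3)] assms(1) by (simp add: pos_def)
  have 0: "v j = 0" if "j \<noteq> i" for j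
    using le[of j] assms(1) that by (auto simp: s_def pos_def intro: antisym)
  have v: "v = (\<lambda>_. 0)(i := v i)" using 0 by auto
  have "0 < v i" using pos_ex[OF assms(1)] 0 by (metis less_irrefl)
  then have "v i = 1" using R_multiple[OF assms(2)] v assms(1) by (metis pos_def)
  then show ?thesis using v by (simp add: e_def)
qed

text \<open>The composite \<open>s\<^sub>i w\<^sup>-\<^sup>1 s\<^sub>j w\<close> is a transvection along \<open>e i\<close>; if it were nontrivial it would have
  infinite orbits on the roots.\<close>

lemma act_conjugate:
  assumes ws: "set ws \<subseteq> D" and i: "i \<in> D" and j: "j \<in> D" and ij: "act ws (e i) = e j"
    and v: "v \<in> R"
  shows "act ws (s i v) = s j (act ws v)"
proof -
  define f where "f v = pr j (act ws v) - pr i v" for v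
  define M where "M v = s i (act (rev ws) (s j (act ws v)))" for v
  have s_alt: "s k x = (\<lambda>l. x l + (- pr k x) * e k l)" for k x
    by (auto simp: s_def e_def)
  have rev_e: "act (rev ws) (e j) = e i" using act_rev[OF ws, of "e i"] ij by simp
  have M: "M v = (\<lambda>l. v l + f v * e i l)" for v
  proof -
    have 1: "act (rev ws) (s j (act ws v)) = (\<lambda>l. v l + (- pr j (act ws v)) * e i l)"
      unfolding s_alt[of j] act_linear act_rev[OF ws] rev_e ..
    have "M v = (\<lambda>l. s i v l + (- pr j (act ws v)) * s i (e i) l)"
      unfolding M_def 1 s_linear ..
    also have "\<dots> = (\<lambda>l. v l + f v * e i l)"
      unfolding s_e[OF i] by (subst s_alt[of i v]) (simp add: f_def algebra_simps)
    finally show ?thesis .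
  qed
  have MR: "M v \<in> R" if "v \<in> R" for v
    unfolding M_def using that ws i j by (intro s_R act_R) auto
  \<comment> \<open>Both \<open>pr i (e i)\<close> and \<open>pr j (e j)\<close> equal
    \<open>2\<close>, so \<open>f\<close> is unchanged by adding multiples of \<open>e i\<close>,
    and each application of \<open>M\<close> adds the same multiple \<open>f v\<close> of
    \<open>e i\<close>.\<close>
  have f_lin: "f (\<lambda>l. x l + c * e i l) = f x" for x c
    unfolding f_def act_linear pr_linear ij using i j by (simp add: pr_e A_diag)
  have orbit: "(\<lambda>l. v l + of_nat n * f v * e i l) \<in> R" for n :: nat
  proof (induction n)
    case (Suc n)
    from MR[OF this] show ?case
      unfolding M f_lin[of v "of_nat n * f v"] by (simp add: algebra_simps)
  qed (use v in simp)
  have "f v = 0"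
  proof (rule ccontr)
    assume "f v \<noteq> 0"
    then have "inj (\<lambda>n::nat. (\<lambda>l. v l + of_nat n * f v * e i l))"
      by (auto simp: inj_def fun_eq_iff e_def dest: spec[of _ i])
    moreover have "finite (range (\<lambda>n::nat. (\<lambda>l. v l + of_nat n * f v * e i l)))"
      using orbit finite_R by (auto intro: finite_subset)
    ultimately show False using finite_imageD infinite_UNIV_nat by blast
  qed
  then have pr: "pr j (act ws v) = pr i v" by (simp add: f_def)
  have "act ws (s i v) = (\<lambda>l. act ws v l + (- pr i v) * e j l)"
    unfolding s_alt[of i] act_linear ij ..
  then show ?thesis using pr by (simp add: s_alt[of j])
qed

section \<open>Words as group elements and the exchange condition\<close>

lemma eqv_refl [simp]: "eqv ws ws" and eqv_sym: "eqv us ws \<Longrightarrow> eqv ws us"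
  and eqv_trans: "eqv us ws \<Longrightarrow> eqv ws xs \<Longrightarrow> eqv us xs"
  by (simp_all add: eqv_def)

lemma eqv_rev:
  assumes "set us \<subseteq> D" "set ws \<subseteq> D" "eqv us ws"
  shows "eqv (rev us) (rev ws)"
  unfolding eqv_def
proof
  fix v assume "v \<in> R"
  then have "act (rev ws) v \<in> R" using assms by (intro act_R) auto
  then have "act us (act (rev ws) v) = v"
    using assms(3) act_rev'[OF assms(2)] by (simp add: eqv_def)
  then show "act (rev us) v = act (rev ws) v" using act_rev[OF assms(1)] by metis
qed

text \<open>Reading the word from the right, follow \<open>e i\<close> until a letter
  \<open>j\<close> first makes it negative. Just before, it equals \<open>e j\<close>, and
  \<open>act_conjugate\<close> moves the appended \<open>i\<close> next to that \<open>j\<close>,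
  where the two cancel.\<close>

lemma exchange:
  assumes "set ws \<subseteq> D" "i \<in> D" "\<not> pos (act ws (e i))"
  shows "\<exists>us. set us \<subseteq> D \<and> Suc (length us) = length ws \<and> eqv (ws @ [i]) us"
  using assms
proof (induction ws)
  case Nil
  then show ?case by (simp add: pos_e)
next
  case (Cons j ws)
  show ?case
  proof (cases "pos (act ws (e i))")
    case True
    then have ij: "act ws (e i) = e j" using pos_reflection[of _ j] Cons.prems by simp
    have "eqv ((j # ws) @ [i]) ws"
      using act_conjugate[OF _ Cons.prems(2) _ ij] Cons.prems
      by (auto simp: eqv_def s_involution)
    then show ?thesis using Cons.prems by auto
  next
    case False
    then obtain us where "set us \<subseteq> D" "Suc (length us) = length ws" "eqv (ws @ [i]) us"
      using Cons by auto
    then show ?thesis using Cons.prems by (intro exI[of _ "j # us"]) (auto simp: eqv_def)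
  qed
qed

section \<open>Length, reduced words and the longest element\<close>

lemma len_le: "set us \<subseteq> D \<Longrightarrow> eqv ws us \<Longrightarrow> len ws \<le> length us"
  unfolding len_def by (rule Least_le) blast

lemma len_cong:
  assumes "eqv us ws" shows "len us = len ws"
proof -
  have "eqv us = eqv ws" using assms by (auto simp: eqv_def fun_eq_iff)
  then show ?thesis by (simp add: len_def)
qed

lemma reduced_exists:
  assumes "set ws \<subseteq> D"
  obtains us where "set us \<subseteq> D" "eqv ws us" "length us = len ws"
proof -
  have "\<exists>n us. set us \<subseteq> D \<and> length us = n \<and> eqv ws us" using assms eqv_refl by blast
  from LeastI_ex[OF this] show ?thesis using that unfolding len_def by blast
qed

text \<open>The length of a word depends only on the map it induces on the finite set
  \<open>R\<close>, so it takes finitely many values.\<close>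

lemma longest_exists: "\<exists>ws. longest ws"
proof -
  define L where "L f = (LEAST n. \<exists>us. set us \<subseteq> D \<and> length us = n \<and> (\<forall>v\<in>R. f v = act us v))" for f
  have "len ws = L (restrict (act ws) R)" for ws
    by (simp add: len_def L_def eqv_def)
  then have "len ` {ws. set ws \<subseteq> D} \<subseteq> L ` (R \<rightarrow>\<^sub>E R)"
    using act_R by fastforce
  then have fin: "finite (len ` {ws. set ws \<subseteq> D})"
    using finite_R by (meson finite_PiE finite_imageI finite_subset)
  moreover have "len ` {ws. set ws \<subseteq> D} \<noteq> {}" by (auto intro: exI[of _ "[]"])
  ultimately have "Max (len ` {ws. set ws \<subseteq> D}) \<in> len ` {ws. set ws \<subseteq> D}" by (rule Max_in)
  then obtain ws where "set ws \<subseteq> D" "len ws = Max (len ` {ws. set ws \<subseteq> D})" by auto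
  then have "longest ws" using Max_ge[OF fin] by (auto simp: longest_def)
  then show ?thesis by blast
qed

text \<open>Otherwise a reduced word for \<open>ws @ [i]\<close> makes \<open>e i\<close> negative,
  and appending \<open>i\<close> once more shortens it by \<open>exchange\<close>. The result
  represents \<open>ws\<close>, which would be shorter than \<open>ws @ [i]\<close>, against
  maximality.\<close>

lemma longest_simple:
  assumes w: "longest ws" and i: "i \<in> D"
  shows "\<not> pos (act ws (e i))"
proof
  assume p: "pos (act ws (e i))"
  have ws: "set ws \<subseteq> D" using w by (simp add: longest_def)
  then obtain us where us: "set us \<subseteq> D" "eqv (ws @ [i]) us" "length us = len (ws @ [i])"
    using reduced_exists[of "ws @ [i]"] i by auto
  have "act us (e i) = act (ws @ [i]) (e i)" using us(2) e_R[OF i] by (simp only: eqv_def)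
  also have "\<dots> = (\<lambda>j. - act ws (e i) j)" by (simp add: s_e[OF i] act_uminus)
  finally have "\<not> pos (act us (e i))" using pos_uminus[OF p] by simp
  then obtain xs where xs: "set xs \<subseteq> D" "Suc (length xs) = length us" "eqv (us @ [i]) xs"
    using exchange[OF us(1) i] by blast
  have "eqv ws (us @ [i])"
    using us(2) s_R[OF i] s_involution[OF i] by (simp add: eqv_def) metis
  then have "len ws \<le> length xs" using len_le[OF xs(1)] eqv_trans xs(3) by blast
  moreover have "len (ws @ [i]) \<le> len ws" using w ws i by (simp add: longest_def)
  ultimately show False using xs(2) us(3) by simp
qed

lemma longest_nonpos:
  assumes w: "longest ws" and v: "\<And>i. i \<notin> D \<Longrightarrow> v i = 0" "\<And>i. 0 \<le> v i"
  shows "act ws v k \<le> 0"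
proof -
  have "act ws (e i) k \<le> 0" if "i \<in> D" for i
    using not_posD[OF act_R[OF _ e_R[OF that]] longest_simple[OF w that]] w
    by (simp add: longest_def)
  then have "(\<Sum>i\<in>D. v i * act ws (e i) k) \<le> 0"
    using v(2) by (intro sum_nonpos mult_nonneg_nonpos)
  then show ?thesis using act_expand[of v ws k] v(1) by simp
qed

lemma longest_not_pos: "longest ws \<Longrightarrow> pos v \<Longrightarrow> \<not> pos (act ws v)"
  using longest_nonpos[of ws v] pos_ex[of "act ws v"] R_outside
  by (meson leD pos_def)

text \<open>A nonempty reduced word makes the simple root of its last letter negative, for otherwise
  \<open>exchange\<close> would shorten it.\<close>

lemma eqv_Nil_if_preserves_pos:
  assumes us: "set us \<subseteq> D" and p: "\<And>v. pos v \<Longrightarrow> pos (act us v)"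
  shows "eqv us []"
proof -
  obtain xs where xs: "set xs \<subseteq> D" "eqv us xs" "length xs = len us" by (rule reduced_exists[OF us])
  have "xs = []"
  proof (cases xs rule: rev_cases)
    case (snoc ys i)
    then have i: "i \<in> D" and ys: "set ys \<subseteq> D" using xs(1) by auto
    have "act us (e i) = (\<lambda>j. - act ys (e i) j)"
      using xs(2) snoc e_R[OF i] s_e[OF i] act_uminus by (simp add: eqv_def)
    then have "pos (\<lambda>j. - act ys (e i) j)" using p[OF pos_e[OF i]] by simp
    then have "\<not> pos (act ys (e i))" using pos_uminus[of "act ys (e i)"] by blast
    then obtain zs where zs: "set zs \<subseteq> D" "Suc (length zs) = length ys" "eqv (ys @ [i]) zs"
      using exchange[OF ys i] by blast
    then have "len us \<le> length zs" using len_le[OF zs(1)] xs(2) snoc eqv_trans by blast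
    then show ?thesis using zs(2) xs(3) snoc by simp
  qed simp
  then show ?thesis using xs(2) by simp
qed

text \<open>Both words turn positive roots into negative ones and conversely, so
  \<open>rev us @ ws\<close> preserves positivity and acts as the identity.\<close>

lemma longest_unique:
  assumes "longest us" "longest ws"
  shows "eqv us ws"
proof -
  have D: "set us \<subseteq> D" "set ws \<subseteq> D" using assms by (auto simp: longest_def)
  have "eqv (rev us @ ws) []"
  proof (rule eqv_Nil_if_preserves_pos)
    fix v assume v: "pos v"
    let ?z = "act (rev us) (act ws v)"
    have z: "?z \<in> R" using D v by (intro act_R) (auto simp: pos_def)
    have "pos ?z"
    proof (rule ccontr)
      assume "\<not> pos ?z"
      then have "0 \<le> - ?z i" for i using not_posD[OF z, of i] by simp
      then have "act us (\<lambda>i. - ?z i) k \<le> 0" for k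
        using R_outside[OF z] by (intro longest_nonpos[OF assms(1)]) auto
      then have "0 \<le> act ws v k" for k
        unfolding act_uminus act_rev'[OF D(1)] by simp
      then have "pos (act ws v)" using act_R[OF D(2)] v by (simp add: pos_def)
      then show False using longest_not_pos[OF assms(2) v] by blast
    qed
    then show "pos (act (rev us @ ws) v)" by simp
  qed (use D in auto)
  then have "act (rev us) (act ws v) = v" if "v \<in> R" for v using that by (simp add: eqv_def)
  then show ?thesis unfolding eqv_def using act_rev'[OF D(1)] by metis
qed

section \<open>Conjugates of simple roots and supports\<close>

lemma root_conjugate_to_simple:
  assumes "set ws \<subseteq> D" "pos v" "\<not> pos (act ws v)"
  shows "\<exists>us i. set us \<subseteq> D \<and> i \<in> D \<and> act us v = e i"
  using assms
proof (induction ws)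
  case (Cons j ws)
  then show ?case
    using pos_reflection[of "act ws v" j] by (cases "pos (act ws v)") auto
qed simp

text \<open>The longest word turns \<open>v\<close> negative; by \<open>pos_reflection\<close> it
  passes through a simple root immediately before.\<close>

lemma pos_conjugate:
  assumes "pos v"
  obtains us i where "set us \<subseteq> D" "i \<in> D" "v = act us (e i)"
proof -
  obtain ws where ws: "longest ws" using longest_exists by blast
  then obtain us i where "set us \<subseteq> D" "i \<in> D" "act us v = e i"
    using root_conjugate_to_simple[OF _ assms longest_not_pos[OF ws assms]] by (auto simp: longest_def)
  then show ?thesis using that[of "rev us" i] act_rev[of us v] by auto
qed

text \<open>Up to sign a root arises from some \<open>e i\<close> by reflections. Those outside the
  block of \<open>i\<close> fix every vector supported in the block, those inside keep the support.
  Both \<open>C\<close> and its complement serve as the block.\<close>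

lemma root_support:
  assumes C: "\<And>i k. i \<in> C \<Longrightarrow> k \<in> D - C \<Longrightarrow> A i k = 0" "C \<subseteq> D" and v: "v \<in> R"
  shows "(\<forall>i. i \<notin> C \<longrightarrow> v i = 0) \<or> (\<forall>i\<in>C. v i = 0)"
proof -
  have p: "(\<forall>i. i \<notin> C \<longrightarrow> v i = 0) \<or> (\<forall>i\<in>C. v i = 0)" if pv: "pos v" for v
  proof -
    obtain us i where us: "set us \<subseteq> D" "i \<in> D" "v = act us (e i)" using pos_conjugate[OF pv] .
    have "\<forall>k. k \<notin> E \<longrightarrow> act us (e i) k = 0"
      if E: "E \<subseteq> D" "i \<in> E" "\<And>i k. i \<in> D - E \<Longrightarrow> k \<in> E \<Longrightarrow> A i k = 0" for E
      using us(1)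
    proof (induction us)
      case Nil
      then show ?case using E by (auto simp: e_def)
    next
      case (Cons j us)
      then have IH: "act us (e i) k = 0" if "k \<notin> E" for k using that by auto
      have "pr j (act us (e i)) = 0" if "j \<notin> E"
        unfolding pr_def by (rule sum.neutral) (use IH E that Cons.prems in auto)
      then show ?case using IH by (auto simp: s_def)
    qed
    from this[of C] this[of "D - C"] show ?thesis
      using us C A_zero by (cases "i \<in> C") (auto, metis DiffD1 DiffI subsetD)
  qed
  show ?thesis
  proof (cases "pos v")
    case False
    then have "pos (\<lambda>i. - v i)" using R_neg[OF v] not_posD[OF v] by (simp add: pos_def)
    from p[OF this] show ?thesis by simp
  qed (rule p)
qed


section \<open>Dynkin blocks isolated by a missing letter\<close>

definition cartan_component :: "nat \<Rightarrow> (nat \<Rightarrow> nat \<Rightarrow> int) \<Rightarrow> bool" where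
  "cartan_component n M \<longleftrightarrow> (\<exists>\<alpha>. inj_on \<alpha> {..<n} \<and> \<alpha> ` {..<n} \<subseteq> D \<and>
     (\<forall>i<n. \<forall>j<n. A (\<alpha> i) (\<alpha> j) = M i j) \<and> (\<forall>i<n. \<forall>k\<in>D - \<alpha> ` {..<n}. A (\<alpha> i) k = 0))"

lemma act_outside: "i \<notin> set us \<Longrightarrow> act us v i = v i"
  by (induction us) (auto simp: s_def)

text \<open>The root \<open>s i (e j)\<close> has coordinate \<open>1\<close> at \<open>j\<close>,
  hence is positive, and its coordinate at \<open>i\<close> is \<open>- A i j\<close>.\<close>

lemma A_nonpos:
  assumes "i \<in> D" "j \<in> D" "i \<noteq> j"
  shows "A i j \<le> 0"
proof -
  have "pos (s i (e j))"
    by (rule posI[OF s_R[OF assms(1) e_R[OF assms(2)]], of j]) (use assms in \<open>auto simp: s_def e_def\<close>)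
  then have "0 \<le> s i (e j) i" by (simp add: pos_def)
  then show ?thesis using assms by (simp add: s_def pr_e) (simp add: e_def)
qed

lemma s_e_other: "i \<in> D \<Longrightarrow> j \<in> D \<Longrightarrow> s i (e j) = (\<lambda>k. e j k - A i j * e i k)"
  by (auto simp: s_def pr_e) (auto simp: e_def)

lemma isolated_node:
  assumes "i \<in> D" "\<And>k. k \<in> D - {i} \<Longrightarrow> A i k = 0"
  shows "cartan_component 1 cartan_matrix_A"
  unfolding cartan_component_def
  by (rule exI[of _ "\<lambda>_. i"]) (use assms in \<open>auto simp: cartan_matrix_A_def A_diag inj_on_def\<close>)

text \<open>Since \<open>us\<close> leaves coordinate \<open>i\<close> alone, that coordinate of
  \<open>act ws (e k)\<close> is the one of \<open>act (rev vs) (e k)\<close>, and the longest word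
  makes it nonpositive. In the applications \<open>vs\<close> is \<open>[i]\<close> or a commuting
  pair.\<close>

lemma longest_missing_letter:
  assumes w: "longest ws" and i: "i \<in> D" and us: "set us \<subseteq> D" "i \<notin> set us"
    and vs: "eqv (ws @ vs) us"
    and k: "k \<in> D" and kk: "act (rev vs) (e k) i = - A i k" and vD: "set vs \<subseteq> D"
  shows "0 \<le> A i k"
proof -
  have "act ws (e k) = act (ws @ vs) (act (rev vs) (e k))"
    using act_rev'[OF vD] by simp
  also have "\<dots> = act us (act (rev vs) (e k))"
    using vs act_R[OF _ e_R[OF k], of "rev vs"] vD by (simp only: eqv_def) simp
  finally have "act ws (e k) i = - A i k" using act_outside[OF us(2)] kk by simp
  moreover have "act ws (e k) i \<le> 0"
    by (rule longest_nonpos[OF w]) (use k in \<open>auto simp: e_def\<close>)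
  ultimately show ?thesis by simp
qed

lemma missing_letter_isolated:
  assumes w: "longest ws" and i: "i \<in> D" and us: "set us \<subseteq> D" "i \<notin> set us"
    and "eqv (ws @ [i]) us"
  shows "cartan_component 1 cartan_matrix_A"
proof (rule isolated_node[OF i])
  fix k assume k: "k \<in> D - {i}"
  have "e k i = 0" using k by (auto simp: e_def)
  then have "0 \<le> A i k"
    by (intro longest_missing_letter[OF w i us assms(5)])
      (use k i in \<open>auto simp: s_def pr_e\<close>)
  then show "A i k = 0" using A_nonpos[of i k] i k by auto
qed

lemma commuting_missing_letter_isolated:
  assumes w: "longest ws" and i: "i \<in> D" and j: "j \<in> D" "i \<noteq> j" "A i j = 0"
    and vs: "vs = [i, j] \<or> vs = [j, i]"
    and us: "set us \<subseteq> D" "i \<notin> set us" and eq: "eqv (ws @ vs) us"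
  shows "cartan_component 1 cartan_matrix_A"
proof (rule isolated_node[OF i])
  fix k assume k: "k \<in> D - {i}"
  show "A i k = 0"
  proof (cases "k = j")
    case False
    have ji: "A j i = 0" using A_zero i j by blast
    have 1: "pr i (s j (e k)) = A i k" "pr j (s i (e k)) = A j k"
      using i j k ji False by (auto simp: s_def pr_upd pr_e)
    have "0 \<le> A i k"
    proof (rule longest_missing_letter[OF w i us eq])
      have ki: "e k i = 0" using k by (auto simp: e_def)
      show "act (rev vs) (e k) i = - A i k"
        using vs
      proof
        assume "vs = [i, j]"
        then have "act (rev vs) (e k) i = s i (e k) i" using j(2) by (simp add: s_def[of j])
        then show ?thesis using ki k by (simp add: s_def pr_e)
      next
        assume "vs = [j, i]"
        then have "act (rev vs) (e k) i = s j (e k) i - A i k" using 1 by (simp add: s_def[of i])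
        then show ?thesis using ki j(2) by (simp add: s_def)
      qed
    qed (use k i j vs in auto)
    then show ?thesis using A_nonpos[of i k] i k by auto
  qed (use j in simp)
qed

text \<open>If no reduced word of \<open>w\<^sub>0 s\<^sub>i s\<^sub>j\<close> contains the letters \<open>i\<close>, \<open>j\<close> in this order, then
  \<open>w\<^sub>0 s\<^sub>i s\<^sub>j = p q\<close> with \<open>p\<close> free of \<open>i\<close> and \<open>q\<close> free of \<open>j\<close>. All positive roots but \<open>e j\<close> and
  \<open>s j (e i)\<close> become negative under \<open>p q\<close>; the roots involving \<open>j\<close> stay positive under \<open>q\<close>, so
  those two are the only candidates for a positive root whose \<open>q\<close>-image involves \<open>i\<close> and \<open>j\<close>.\<close>

lemma two_roots_with_full_support:
  assumes w: "longest ws" and ij: "i \<in> D" "j \<in> D" "i \<noteq> j"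
    and pq: "set (p @ q) \<subseteq> D" "i \<notin> set p" "j \<notin> set q" and eq: "eqv (ws @ [i, j]) (p @ q)"
    and d: "pos d" "0 < d i" "0 < d j"
  shows "d = act q (e j) \<or> d = act q (s j (e i))"
proof (rule ccontr)
  assume asm: "\<not> ?thesis"
  define g where "g = act (rev q) d"
  have qD: "set q \<subseteq> D" using pq by simp
  have dR: "d \<in> R" using d by (simp add: pos_def)
  have gR: "g \<in> R" unfolding g_def using qD dR by (intro act_R) auto
  have gj: "g j = d j" unfolding g_def using pq(3) by (simp add: act_outside)
  have gd: "act q g = d" unfolding g_def by (rule act_rev'[OF qD])
  have pg: "pos g" using posI[OF gR, of j] gj d(3) by simp
  have "g \<noteq> e j" "g \<noteq> s j (e i)" using asm gd by auto
  then have p1: "pos (s j g)" using pos_reflection[OF pg ij(2)] by blast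
  have "s j g \<noteq> e i" using \<open>g \<noteq> s j (e i)\<close> s_involution[OF ij(2)] by metis
  then have p2: "pos (s i (s j g))" using pos_reflection[OF p1 ij(1)] by blast

  have "act (ws @ [i, j]) g = act (p @ q) g" using eq gR by (simp only: eqv_def)
  then have "act ws (s i (s j g)) = act p d" using gd by simp
  moreover have "act ws (s i (s j g)) i \<le> 0"
    by (rule longest_nonpos[OF w]) (use p2 R_outside in \<open>auto simp: pos_def\<close>)
  \<comment> \<open>Being free of \<open>i\<close>, the word \<open>p\<close> preserves the positive
    coordinate of \<open>d\<close> at \<open>i\<close>, although the longest word makes it
    nonpositive.\<close>
  ultimately show False using act_outside[OF pq(2), of d] d(2) by simp
qed

section \<open>Blocks in which two adjacent nodes share few roots\<close>

definition vec2 :: "'i \<Rightarrow> int \<Rightarrow> 'i \<Rightarrow> int \<Rightarrow> 'i \<Rightarrow> int" where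
  "vec2 i x j y = (\<lambda>_. 0)(i := x, j := y)"

definition vec3 :: "'i \<Rightarrow> int \<Rightarrow> 'i \<Rightarrow> int \<Rightarrow> 'i \<Rightarrow> int \<Rightarrow> 'i \<Rightarrow> int" where
  "vec3 i x j y k z = (\<lambda>_. 0)(i := x, j := y, k := z)"

lemma pr_vec2: "i \<in> D \<Longrightarrow> j \<in> D \<Longrightarrow> i \<noteq> j \<Longrightarrow> pr l (vec2 i x j y) = A l i * x + A l j * y"
  by (simp add: vec2_def pr_upd)

lemma pr_vec3: "i \<in> D \<Longrightarrow> j \<in> D \<Longrightarrow> k \<in> D \<Longrightarrow> i \<noteq> j \<Longrightarrow> i \<noteq> k \<Longrightarrow> j \<noteq> k \<Longrightarrow>
    pr l (vec3 i x j y k z) = A l i * x + A l j * y + A l k * z"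
  by (simp add: vec3_def pr_upd)

lemma s_vec2: "i \<in> D \<Longrightarrow> j \<in> D \<Longrightarrow> i \<noteq> j \<Longrightarrow>
    s l (vec2 i x j y) = (vec2 i x j y)(l := vec2 i x j y l - (A l i * x + A l j * y))"
  by (simp add: s_def pr_vec2)

lemma s_vec3: "i \<in> D \<Longrightarrow> j \<in> D \<Longrightarrow> k \<in> D \<Longrightarrow> i \<noteq> j \<Longrightarrow> i \<noteq> k \<Longrightarrow> j \<noteq> k \<Longrightarrow>
    s l (vec3 i x j y k z) =
      (vec3 i x j y k z)(l := vec3 i x j y k z l - (A l i * x + A l j * y + A l k * z))"
  by (simp add: s_def pr_vec3)

lemma vec2_eq: "i \<noteq> j \<Longrightarrow> vec2 i x j y = vec2 i x' j y' \<longleftrightarrow> x = x' \<and> y = y'"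
  by (auto simp: vec2_def fun_eq_iff)

text \<open>Write roots by their coordinates at \<open>i, j, k\<close>. Reflecting
  \<open>(1,1,0)\<close> at \<open>k\<close> and then at \<open>i\<close> gives
  \<open>(1,1,m)\<close> and \<open>(x,1,m)\<close> with \<open>m > 0\<close> and
  \<open>x = - A i k * m\<close>. By \<open>three\<close> the last two coincide, so
  \<open>m = 1\<close> and \<open>A i k = -1\<close>. A further neighbour \<open>l\<close> of the
  block would add a third root, the reflection of \<open>(1,1,1)\<close> at
  \<open>l\<close>.\<close>

lemma component_A3:
  assumes D: "i \<in> D" "j \<in> D" "k \<in> D" and ne: "i \<noteq> j" "i \<noteq> k" "j \<noteq> k"
    and A: "A i j = -1" "A j i = -1" "A k i \<noteq> 0"
    and three: "\<And>u v w. pos u \<Longrightarrow> pos v \<Longrightarrow> pos w \<Longrightarrow> 0 < u i \<Longrightarrow> 0 < u j \<Longrightarrow> 0 < v i \<Longrightarrow> 0 < v j \<Longrightarrow>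
        0 < w i \<Longrightarrow> 0 < w j \<Longrightarrow> u = v \<or> u = w \<or> v = w"
  shows "cartan_component 3 cartan_matrix_A"
proof -
  have neg: "A l m \<le> 0" if "l \<in> D" "m \<in> D" "l \<noteq> m" for l m using A_nonpos that by blast
  have Ai: "A i k < 0" "A k i < 0"
    using neg[of i k] neg[of k i] A_zero[of i k] D ne A(3) by force+
  have r1: "vec2 i 1 j 1 \<in> R"
  proof -
    have "s i (e j) = vec2 i 1 j 1"
      unfolding s_e_other[OF D(1,2)] using ne A by (auto simp: fun_eq_iff e_def vec2_def)
    then show ?thesis using s_R[OF D(1) e_R[OF D(2)]] by simp
  qed
  define m where "m = - (A k i + A k j)"
  have m: "m > 0" using Ai neg[of k j] D ne by (auto simp: m_def)
  have "s k (vec2 i 1 j 1) = vec3 i 1 j 1 k m"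
    unfolding s_vec2[OF D(1,2) ne(1)] using ne by (auto simp: m_def fun_eq_iff vec2_def vec3_def)
  then have r2: "vec3 i 1 j 1 k m \<in> R" using s_R[OF D(3) r1] by simp
  have "s i (vec3 i 1 j 1 k m) = vec3 i (- A i k * m) j 1 k m"
    unfolding s_vec3[OF D ne] using D ne A by (auto simp: A_diag fun_eq_iff vec3_def)
  then have r3: "vec3 i (- A i k * m) j 1 k m \<in> R" using s_R[OF D(1) r2] by simp
  have p: "pos (vec2 i 1 j 1)" "pos (vec3 i 1 j 1 k m)" "pos (vec3 i (- A i k * m) j 1 k m)"
    using posI[OF r1, of j] posI[OF r2, of j] posI[OF r3, of j] ne by (auto simp: vec2_def vec3_def)
  have x: "0 < - A i k * m" using Ai m by (simp add: mult_neg_pos)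
  have "vec2 i 1 j 1 = vec3 i 1 j 1 k m \<or> vec2 i 1 j 1 = vec3 i (- A i k * m) j 1 k m
      \<or> vec3 i 1 j 1 k m = vec3 i (- A i k * m) j 1 k m"
    by (rule three) (use p ne x in \<open>auto simp: vec2_def vec3_def\<close>)
  moreover have "vec2 i 1 j 1 \<noteq> vec3 i x j 1 k m" for x
    using m ne by (auto simp: vec2_def vec3_def fun_eq_iff dest: spec[of _ k])
  ultimately have "vec3 i 1 j 1 k m i = vec3 i (- A i k * m) j 1 k m i" by metis
  then have "- A i k * m = 1" using ne by (simp add: vec3_def)
  then have mx: "m = 1" "A i k = -1" using zmult_eq_1_iff[of "- A i k" m] m by auto
  then have ki: "A k i = -1" "A k j = 0" using Ai neg[of k j] D ne by (auto simp: m_def)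
  have jk: "A j k = 0" using A_zero ki D by blast
  have others: "A l i = 0 \<and> A l j = 0 \<and> A l k = 0" if l: "l \<in> D" "l \<noteq> i" "l \<noteq> j" "l \<noteq> k" for l
  proof (rule ccontr)
    assume asm: "\<not> ?thesis"
    let ?u = "vec3 i 1 j 1 k 1"
    let ?v = "s l ?u"
    have vl: "?v l > 0"
      using asm neg[of l i] neg[of l j] neg[of l k] l D ne
      unfolding s_vec3[OF D ne] by (auto simp: vec3_def)
    have u: "?u \<in> R" using r2 mx by simp
    have pv: "pos ?v" by (rule posI[OF s_R[OF l(1) u] vl])
    have vv: "?v i = 1" "?v j = 1" using l ne by (auto simp: s_def vec3_def)
    have "vec2 i 1 j 1 = ?u \<or> vec2 i 1 j 1 = ?v \<or> ?u = ?v"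
      by (rule three) (use p mx ne vv pv in \<open>auto simp: vec2_def vec3_def\<close>)
    moreover have "vec2 i 1 j 1 \<noteq> ?u" using ne by (auto simp: vec2_def vec3_def fun_eq_iff dest: spec[of _ k])
    moreover have "vec2 i 1 j 1 l = 0" "?u l = 0" using l by (auto simp: vec2_def vec3_def)
    ultimately show False using vl by (metis less_irrefl)
  qed
  \<comment> \<open>The diagram is the path from \<open>k\<close> through \<open>i\<close> to
    \<open>j\<close>, which dictates the numbering.\<close>
  let ?\<alpha> = "(\<lambda>_::nat. j)(0 := k, Suc 0 := i)"
  have img: "?\<alpha> ` {..<3} = {k, i, j}" by (auto simp: numeral_3_eq_3 lessThan_Suc)
  show ?thesis
    unfolding cartan_component_def
  proof (intro exI[of _ ?\<alpha>] conjI allI impI ballI)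
    show "inj_on ?\<alpha> {..<3}" using ne by (auto simp: inj_on_def numeral_3_eq_3 less_Suc_eq)
    show "?\<alpha> ` {..<3} \<subseteq> D" unfolding img using D by auto
    fix a b :: nat assume "a < 3" "b < 3"
    then show "A (?\<alpha> a) (?\<alpha> b) = cartan_matrix_A a b"
      using D ne A ki mx jk by (auto simp: cartan_matrix_A_def A_diag numeral_3_eq_3 less_Suc_eq)
  next
    fix a :: nat and l assume a: "a < 3" and l: "l \<in> D - ?\<alpha> ` {..<3}"
    then have "l \<in> D" "l \<noteq> i" "l \<noteq> j" "l \<noteq> k" unfolding img by auto
    then have "A i l = 0" "A j l = 0" "A k l = 0" using others A_zero D by blast+
    then show "A (?\<alpha> a) l = 0" by auto
  qed
qed

lemma component_rank2:
  assumes D: "i \<in> D" "j \<in> D" and ne: "i \<noteq> j"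
    and others: "\<And>l. l \<in> D \<Longrightarrow> l \<noteq> i \<Longrightarrow> l \<noteq> j \<Longrightarrow> A l i = 0 \<and> A l j = 0"
    and M: "M 0 0 = 2" "M 1 1 = 2" "A i j = M 0 1" "A j i = M 1 0"
  shows "cartan_component 2 M"
proof -
  let ?\<alpha> = "(\<lambda>_::nat. j)(0 := i)"
  have img: "?\<alpha> ` {..<2::nat} = {i, j}" by (auto simp: numeral_2_eq_2 lessThan_Suc)
  show ?thesis
    unfolding cartan_component_def
  proof (intro exI[of _ ?\<alpha>] conjI allI impI ballI)
    show "inj_on ?\<alpha> {..<2::nat}" using ne by (auto simp: inj_on_def numeral_2_eq_2 less_Suc_eq)
    show "?\<alpha> ` {..<2} \<subseteq> D" unfolding img using D by auto
    fix a b :: nat assume "a < 2" "b < 2"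
    then show "A (?\<alpha> a) (?\<alpha> b) = M a b"
      using D ne M by (auto simp: A_diag numeral_2_eq_2 less_Suc_eq)
  next
    fix a :: nat and l assume a: "a < 2" and l: "l \<in> D - ?\<alpha> ` {..<2}"
    then have "l \<in> D" "l \<noteq> i" "l \<noteq> j" unfolding img by auto
    then have "A i l = 0" "A j l = 0" using others A_zero D by blast+
    then show "A (?\<alpha> a) l = 0" by auto
  qed
qed

text \<open>In coordinates at \<open>i, j\<close> the roots \<open>(a,1)\<close>,
  \<open>(1,b)\<close> and \<open>(a,ab-1)\<close> are pairwise distinct if
  \<open>a * b > 2\<close>, so the product is \<open>1\<close> or \<open>2\<close>. If it is
  \<open>2\<close>, two of them are distinct and exhaust the bound, so that any neighbour would add
  a third root. If it is \<open>1\<close>, a neighbour leads to \<open>component_A3\<close>.\<close>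

lemma small_component:
  assumes D: "i \<in> D" "j \<in> D" and ne: "i \<noteq> j" and Aij: "A i j \<noteq> 0"
    and three: "\<And>u v w. pos u \<Longrightarrow> pos v \<Longrightarrow> pos w \<Longrightarrow> 0 < u i \<Longrightarrow> 0 < u j \<Longrightarrow> 0 < v i \<Longrightarrow> 0 < v j \<Longrightarrow>
        0 < w i \<Longrightarrow> 0 < w j \<Longrightarrow> u = v \<or> u = w \<or> v = w"
  shows "cartan_component 2 cartan_matrix_A \<or> cartan_component 3 cartan_matrix_A \<or>
    cartan_component 2 (cartan_matrix_B 2)"
proof -
  have neg: "A l m \<le> 0" if "l \<in> D" "m \<in> D" "l \<noteq> m" for l m using A_nonpos that by blast
  define a b where "a = - A i j" and "b = - A j i"
  have ab: "a > 0" "b > 0"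
    using neg[of i j] neg[of j i] A_zero[of j i] D ne Aij unfolding a_def b_def by fastforce+
  have si: "s i (vec2 i x j y) = vec2 i (a * y - x) j y" for x y
    unfolding s_vec2[OF D ne] using D ne by (auto simp: A_diag a_def fun_eq_iff vec2_def)
  have sj: "s j (vec2 i x j y) = vec2 i x j (b * x - y)" for x y
    unfolding s_vec2[OF D ne] using D ne by (auto simp: A_diag b_def fun_eq_iff vec2_def)
  have e: "e i = vec2 i 1 j 0" "e j = vec2 i 0 j 1" using ne by (auto simp: e_def vec2_def)
  have r: "vec2 i a j 1 \<in> R" "vec2 i 1 j b \<in> R" "vec2 i a j (b * a - 1) \<in> R"
    using si[of 0 1] sj[of 1 0] sj[of a 1] s_R[OF D(1) e_R[OF D(2)]] s_R[OF D(2) e_R[OF D(1)]]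
      s_R[OF D(2), of "vec2 i a j 1"] unfolding e by auto
  have p: "pos (vec2 i x j y)" if "vec2 i x j y \<in> R" "x > 0" for x y
    by (rule posI[OF that(1), of i]) (use that ne in \<open>auto simp: vec2_def\<close>)
  have val: "vec2 i x j y i = x" "vec2 i x j y j = y" for x y using ne by (auto simp: vec2_def)
  have isol: "A l i = 0 \<and> A l j = 0"
    if l: "l \<in> D" "l \<noteq> i" "l \<noteq> j" and uv: "vec2 i x j y \<in> R" "vec2 i x' j y' \<in> R"
      "x > 0" "x' > 0" "y > 0" "y' > 0" "vec2 i x j y \<noteq> vec2 i x' j y'" for l x y x' y'
  proof (rule ccontr)
    assume asm: "\<not> ?thesis"
    let ?w = "s l (vec2 i x j y)"
    have "A l i * x + A l j * y < 0"
    proof -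
      have "A l i * x \<le> 0" "A l j * y \<le> 0"
        using neg[of l i] neg[of l j] l D uv by (simp_all add: mult_nonpos_nonneg)
      moreover have "A l i * x \<noteq> 0 \<or> A l j * y \<noteq> 0" using asm uv by auto
      ultimately show ?thesis by linarith
    qed
    then have wl: "?w l > 0" unfolding s_vec2[OF D ne] using l by (simp add: vec2_def)
    have pw: "pos ?w" by (rule posI[OF s_R[OF l(1) uv(1)] wl])
    have w: "?w i = x" "?w j = y" using l ne by (auto simp: s_def vec2_def)
    have "vec2 i x j y = vec2 i x' j y' \<or> vec2 i x j y = ?w \<or> vec2 i x' j y' = ?w"
      by (rule three) (use p pw uv val w in auto)
    moreover have "vec2 i x j y l = 0" "vec2 i x' j y' l = 0" using l by (auto simp: vec2_def)
    ultimately show False using wl uv(7) by (metis less_irrefl)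
  qed
  have ab2: "a * b = 1 \<or> a * b = 2"
  proof (rule ccontr)
    assume "\<not> ?thesis"
    then have "a * b > 2" using mult_pos_pos[OF ab] by linarith
    then have c: "b * a - 1 > 1" by (simp add: mult.commute)
    have "vec2 i a j 1 = vec2 i 1 j b \<or> vec2 i a j 1 = vec2 i a j (b * a - 1) \<or>
        vec2 i 1 j b = vec2 i a j (b * a - 1)"
      by (rule three) (use p r val ab c in auto)
    then show False using ab c \<open>a * b > 2\<close> ne by (auto simp: vec2_eq)
  qed
  have "(a = 1 \<and> b = 1) \<or> (a = 1 \<and> b = 2) \<or> (a = 2 \<and> b = 1)"
  proof -
    have "a * 1 \<le> a * b" "1 * b \<le> a * b" using ab by (intro mult_left_mono mult_right_mono; simp)+
    then have "a \<le> 2" "b \<le> 2" using ab2 by auto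
    then have "a = 1 \<or> a = 2" "b = 1 \<or> b = 2" using ab by auto
    then show ?thesis using ab2 by auto
  qed
  then consider "a = 1" "b = 1" | "a = 1" "b = 2" | "a = 2" "b = 1" by blast
  then show ?thesis
  proof cases
    case 1
    then have A1: "A i j = -1" "A j i = -1" by (auto simp: a_def b_def)
    show ?thesis
    proof (cases "\<exists>k\<in>D. k \<noteq> i \<and> k \<noteq> j \<and> (A k i \<noteq> 0 \<or> A k j \<noteq> 0)")
      case True
      then obtain k where k: "k \<in> D" "k \<noteq> i" "k \<noteq> j" "A k i \<noteq> 0 \<or> A k j \<noteq> 0" by blast
      then have "cartan_component 3 cartan_matrix_A"
      proof (cases "A k i \<noteq> 0")
        case True
        then show ?thesis using component_A3[of i j k] D k ne A1 three by metis
      next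
        case False
        then show ?thesis using component_A3[of j i k] D k ne A1 three by metis
      qed
      then show ?thesis by blast
    next
      case False
      then have "cartan_component 2 cartan_matrix_A"
        by (intro component_rank2[OF D ne]) (use A1 in \<open>auto simp: cartan_matrix_A_def\<close>)
      then show ?thesis by blast
    qed
  next
    case 2
    have "cartan_component 2 (cartan_matrix_B 2)"
    proof (rule component_rank2[OF D ne])
      show "A l i = 0 \<and> A l j = 0" if "l \<in> D" "l \<noteq> i" "l \<noteq> j" for l
        by (rule isol[OF that, of 1 1 1 2]) (use r 2 ne in \<open>auto simp: vec2_eq\<close>)
    qed (use 2 in \<open>auto simp: cartan_matrix_B_def cartan_matrix_A_def a_def b_def\<close>)
    then show ?thesis by blast
  next
    case 3
    have "cartan_component 2 (cartan_matrix_B 2)"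
    \<comment> \<open>The nodes are swapped because \<open>cartan_matrix_B 2\<close> has its entry
      \<open>-2\<close> in row \<open>1\<close>.\<close>
    proof (rule component_rank2[OF D(2,1)])
      show "A l j = 0 \<and> A l i = 0" if "l \<in> D" "l \<noteq> j" "l \<noteq> i" for l
        using isol[OF that(1,3,2), of 2 1 1 1] r 3 ne by (auto simp: vec2_eq)
    qed (use 3 ne in \<open>auto simp: cartan_matrix_B_def cartan_matrix_A_def a_def b_def\<close>)
    then show ?thesis by blast
  qed
qed

section \<open>Words that avoid a pair of letters\<close>

lemma subseq_pairI:
  assumes "\<not> subseq [i, j] us" "i \<noteq> j"
  obtains p q where "us = p @ q" "i \<notin> set p" "j \<notin> set q"
proof -
  \<comment> \<open>The cut is made in front of the first \<open>i\<close>; a \<open>j\<close> after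
    it would complete the forbidden pair.\<close>
  let ?p = "takeWhile (\<lambda>x. x \<noteq> i) us" and ?q = "dropWhile (\<lambda>x. x \<noteq> i) us"
  have "j \<notin> set ?q"
  proof
    assume j: "j \<in> set ?q"
    then have "?q \<noteq> []" by (metis empty_iff list.set(1))
    then have hd: "hd ?q = i" using hd_dropWhile by blast
    then obtain q' where q': "?q = i # q'" using \<open>?q \<noteq> []\<close> by (cases ?q) auto
    then have "j \<in> set q'" using j assms(2) by auto
    then have "subseq [j] q'" by (simp add: subseq_singleton_left)
    then have "subseq ([] @ [i, j]) (?p @ ?q)" unfolding q' by (intro list_emb_append_mono) auto
    then show False using assms(1) by simp
  qed
  moreover have "i \<notin> set ?p" by (metis (mono_tags, lifting) set_takeWhileD)
  ultimately show ?thesis using that[of ?p ?q] by simp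
qed

text \<open>If the reflections commute, both orders are forbidden, and the cut shows that one of the
  letters is missing altogether. Otherwise the cut supplies \<open>p\<close> and \<open>q\<close>
  for \<open>two_roots_with_full_support\<close>, whose two candidates give the bound required by
  \<open>small_component\<close>.\<close>

lemma missing_pair_component:
  assumes w: "longest ws" and ij: "i \<in> D" "j \<in> D" "i \<noteq> j" and us: "set us \<subseteq> D"
    and eq: "eqv (ws @ [i, j]) us" and sub: "\<not> subseq [i, j] us"
    and sub': "A i j = 0 \<Longrightarrow> \<not> subseq [j, i] us"
  shows "cartan_component 1 cartan_matrix_A \<or> cartan_component 2 cartan_matrix_A \<or>
    cartan_component 3 cartan_matrix_A \<or> cartan_component 2 (cartan_matrix_B 2)"
proof (cases "A i j = 0")
  case True
  obtain p q where pq: "us = p @ q" "i \<notin> set p" "j \<notin> set q" using subseq_pairI[OF sub ij(3)] .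
  have "i \<notin> set us \<or> j \<notin> set us"
  proof (rule ccontr)
    assume "\<not> ?thesis"
    then have "j \<in> set p" "i \<in> set q" using pq by auto
    then have "subseq [j] p" "subseq [i] q" by (simp_all add: subseq_singleton_left)
    then have "subseq ([j] @ [i]) (p @ q)" by (rule list_emb_append_mono)
    then show False using sub'[OF True] pq by simp
  qed
  then have "cartan_component 1 cartan_matrix_A"
    using commuting_missing_letter_isolated[OF w ij True, of "[i, j]" us]
      commuting_missing_letter_isolated[OF w ij(2,1) _ A_zero[OF ij(1,2) True], of "[i, j]" us]
      us eq ij(3) by auto
  then show ?thesis by blast
next
  case False
  obtain p q where pq: "us = p @ q" "i \<notin> set p" "j \<notin> set q" using subseq_pairI[OF sub ij(3)] .
  have "d = act q (e j) \<or> d = act q (s j (e i))" if "pos d" "0 < d i" "0 < d j" for d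
    using two_roots_with_full_support[OF w ij _ pq(2,3) _ that] us eq pq(1) by simp
  then show ?thesis using small_component[OF ij False] by metis
qed

end

section \<open>Fat ideals\<close>

locale weyl_words = integral_roots D A R + group W
  for D :: "'i set" and A R and W :: "('a, 'b) monoid_scheme" (structure) +
  fixes r :: "'i \<Rightarrow> 'a"
  assumes r_closed: "i \<in> D \<Longrightarrow> r i \<in> carrier W"
    and carrier_words: "w \<in> carrier W \<Longrightarrow> \<exists>ws. set ws \<subseteq> D \<and> w = word_prod W (map r ws)"
    and word_eq_iff: "set us \<subseteq> D \<Longrightarrow> set ws \<subseteq> D \<Longrightarrow>
      word_prod W (map r us) = word_prod W (map r ws) \<longleftrightarrow> eqv us ws"
begin

definition P :: "'i list \<Rightarrow> 'a" where
  "P ws = word_prod W (map r ws)"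

lemma P_closed: "set ws \<subseteq> D \<Longrightarrow> P ws \<in> carrier W"
  by (induction ws) (auto simp: P_def word_prod_def r_closed)

lemma P_append: "set us \<subseteq> D \<Longrightarrow> set ws \<subseteq> D \<Longrightarrow> P (us @ ws) = P us \<otimes> P ws"
  using P_closed
  by (induction us) (auto simp: P_def word_prod_def r_closed m_assoc)

lemma P_eq_iff: "set us \<subseteq> D \<Longrightarrow> set ws \<subseteq> D \<Longrightarrow> P us = P ws \<longleftrightarrow> eqv us ws"
  unfolding P_def by (rule word_eq_iff)

lemma lists_simple: "lists (r ` D) = map r ` {ws. set ws \<subseteq> D}"
  by (simp only: lists_image flip: lists_eq_set)

lemma word_length_P:
  assumes "set ws \<subseteq> D"
  shows "word_length W (r ` D) (P ws) = len ws"
proof -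
  have "(\<exists>xs\<in>lists (r ` D). length xs = n \<and> word_prod W xs = P ws) \<longleftrightarrow>
      (\<exists>us. set us \<subseteq> D \<and> length us = n \<and> eqv ws us)" for n
    unfolding lists_simple using P_eq_iff[OF _ assms] eqv_sym by (auto simp flip: P_def)
  then show ?thesis by (simp add: word_length_def len_def)
qed

lemma reduced_representative:
  assumes "w \<in> carrier W"
  obtains us where "set us \<subseteq> D" "w = P us" "length us = word_length W (r ` D) w" "len us = length us"
proof -
  obtain ws where ws: "set ws \<subseteq> D" "w = P ws" using carrier_words[OF assms] by (auto simp: P_def)
  obtain us where us: "set us \<subseteq> D" "eqv ws us" "length us = len ws" by (rule reduced_exists[OF ws(1)])
  have w: "w = P us" using us ws P_eq_iff[of ws us] by simp
  have "len us = length us" using us(3) len_cong[OF us(2)] by simp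
  then show ?thesis using that[OF us(1) w] word_length_P[OF us(1)] w by simp
qed

lemma longest_element_P:
  assumes w0: "longest w0"
  shows "longest_element W (r ` D) = P w0"
  unfolding longest_element_def
proof (rule the_equality)
  have D: "set w0 \<subseteq> D" using w0 by (simp add: longest_def)
  have "word_length W (r ` D) v \<le> word_length W (r ` D) (P w0)" if v: "v \<in> carrier W" for v
  proof -
    obtain us where "set us \<subseteq> D" "v = P us" using carrier_words[OF v] by (auto simp: P_def)
    then show ?thesis using w0 word_length_P by (simp add: longest_def)
  qed
  then show "P w0 \<in> carrier W \<and> (\<forall>v\<in>carrier W. word_length W (r ` D) v \<le> word_length W (r ` D) (P w0))"
    using P_closed[OF D] by blast
  fix w assume w: "w \<in> carrier W \<and> (\<forall>v\<in>carrier W. word_length W (r ` D) v \<le> word_length W (r ` D) w)"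
  then obtain us where us: "set us \<subseteq> D" "w = P us" using carrier_words by (auto simp: P_def)
  have "longest us"
    unfolding longest_def
  proof (intro conjI allI impI)
    fix vs assume vs: "set vs \<subseteq> D"
    then have "word_length W (r ` D) (P vs) \<le> word_length W (r ` D) w" using w P_closed by blast
    then show "len vs \<le> len us" using word_length_P vs us by simp
  qed (rule us)
  then have "eqv us w0" using w0 by (rule longest_unique)
  then show "w = P w0" using us P_eq_iff[OF us(1) D] by simp
qed

text \<open>Fatness and the Bruhat order are unfolded only here; the remaining argument concerns
  words and their action on roots.\<close>

lemma fat_ideal_missing_word:
  assumes fat: "fat_ideal W (r ` D) I" and ws: "set ws \<subseteq> D" "P ws \<notin> I" and w0: "longest w0"
  obtains us where "set us \<subseteq> D" "eqv (w0 @ ws) us"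
    "\<And>xs. subseq xs us \<Longrightarrow> set xs \<subseteq> D \<Longrightarrow> \<not> eqv xs ws"
proof -
  have D: "set w0 \<subseteq> D" using w0 by (simp add: longest_def)
  obtain us where us: "set us \<subseteq> D" "eqv (w0 @ ws) us" "length us = len (w0 @ ws)"
    using reduced_exists[of "w0 @ ws"] D ws by auto
  have v: "P w0 \<otimes> P ws = P us"
    using P_append[OF D ws(1)] P_eq_iff[of "w0 @ ws" us] us D ws by simp
  have "P w0 \<otimes> P ws \<in> orthogonal_ideal W (r ` D) I"
    unfolding orthogonal_ideal_def longest_element_P[OF w0]
    using ws P_closed by (intro image_eqI[of _ _ "P ws"]) auto
  then have "P us \<in> I" using fat v unfolding fat_ideal_def by auto
  moreover have "reduced_word W (r ` D) (map r us) (P us)"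
    using us word_length_P[OF us(1)] len_cong[OF us(2)]
    by (auto simp: reduced_word_def lists_simple P_def)
  ultimately have "\<not> eqv xs ws" if xs: "subseq xs us" "set xs \<subseteq> D" for xs
  proof (intro notI)
    assume "eqv xs ws"
    then have "word_prod W (map r xs) = P ws"
      using P_eq_iff[OF xs(2) ws(1)] by (simp add: P_def)
    then have "bruhat_le W (r ` D) (P ws) (P us)"
      unfolding bruhat_le_def
      using \<open>reduced_word W (r ` D) (map r us) (P us)\<close> subseq_map[OF xs(1), of r] by blast
    then show False
      using fat ws P_closed \<open>P us \<in> I\<close> unfolding fat_ideal_def bruhat_ideal_def by blast
  qed
  then show ?thesis using that us by blast
qed

lemma fat_ideal_length_le_1:
  assumes fat: "fat_ideal W (r ` D) I" and no: "\<not> cartan_component 1 cartan_matrix_A"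
    and w: "w \<in> carrier W" "word_length W (r ` D) w \<le> 1"
  shows "w \<in> I"
proof (rule ccontr)
  assume "w \<notin> I"
  obtain ws where ws: "set ws \<subseteq> D" "w = P ws" "length ws = word_length W (r ` D) w"
    using reduced_representative[OF w(1)] .
  obtain w0 where w0: "longest w0" using longest_exists by blast
  obtain us where us: "set us \<subseteq> D" "eqv (w0 @ ws) us"
    "\<And>xs. subseq xs us \<Longrightarrow> set xs \<subseteq> D \<Longrightarrow> \<not> eqv xs ws"
    using fat_ideal_missing_word[OF fat ws(1) _ w0] \<open>w \<notin> I\<close> ws(2) by blast
  show False
  proof (cases ws)
    case Nil
    then show ?thesis using us(3)[of "[]"] by simp
  next
    case (Cons i ws')
    have "length ws \<le> 1" using ws(3) w(2) by simp
    then have i: "ws = [i]" "i \<in> D" using ws(1) Cons by auto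
    then have "i \<notin> set us" using us(3)[of "[i]"] by (auto simp: subseq_singleton_left)
    then show ?thesis using missing_letter_isolated[OF w0 i(2) us(1)] us(2) i no by blast
  qed
qed

lemma fat_ideal_length_le_2:
  assumes fat: "fat_ideal W (r ` D) I" and no: "\<not> cartan_component 1 cartan_matrix_A"
     "\<not> cartan_component 2 cartan_matrix_A" "\<not> cartan_component 3 cartan_matrix_A"
     "\<not> cartan_component 2 (cartan_matrix_B 2)"
    and w: "w \<in> carrier W" "word_length W (r ` D) w \<le> 2"
  shows "w \<in> I"
proof (cases "word_length W (r ` D) w \<le> 1")
  case True
  then show ?thesis using fat_ideal_length_le_1[OF fat no(1) w(1)] by simp
next
  case False
  show ?thesis
  proof (rule ccontr)
    assume "w \<notin> I"
    obtain ws where ws: "set ws \<subseteq> D" "w = P ws" "length ws = word_length W (r ` D) w"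
      and red: "len ws = length ws"
      using reduced_representative[OF w(1)] .
    obtain w0 where w0: "longest w0" using longest_exists by blast
    obtain us where us: "set us \<subseteq> D" "eqv (w0 @ ws) us"
      "\<And>xs. subseq xs us \<Longrightarrow> set xs \<subseteq> D \<Longrightarrow> \<not> eqv xs ws"
      using fat_ideal_missing_word[OF fat ws(1) _ w0] \<open>w \<notin> I\<close> ws(2) by blast
    have "length ws = Suc (Suc 0)" using ws(3) w(2) False by simp
    then obtain i j where wsij: "ws = [i, j]" by (auto simp: length_Suc_conv)
    then have ij: "i \<in> D" "j \<in> D" using ws by auto
    have "i \<noteq> j"
    proof
      assume "i = j"
      then have "eqv ws []" using ij wsij by (simp add: eqv_def s_involution)
      then have "len ws \<le> length ([] :: 'i list)" by (intro len_le) auto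
      then show False using red wsij by simp
    qed
    moreover have "\<not> subseq [i, j] us" using us(3)[of "[i, j]"] ij wsij by auto
    moreover have "\<not> subseq [j, i] us" if "A i j = 0"
    proof -
      have "A j i = 0" using A_zero ij that by blast
      then have "eqv [j, i] ws"
        using that ij wsij \<open>i \<noteq> j\<close> by (auto simp: eqv_def s_def pr_upd fun_upd_twist)
      then show ?thesis using us(3)[of "[j, i]"] ij by auto
    qed
    ultimately show False
      using missing_pair_component[OF w0 ij _ us(1)] us(2) wsij no by blast
  qed
qed

end

section \<open>The Weyl group\<close>

locale root_basis = weight_basis +
  fixes D :: "('a \<Rightarrow> complex) set"
  assumes simple: "simple_roots UNIV H D"
begin

lemma finite_D: "finite D" and D_roots: "D \<subseteq> \<Phi>"
  using simple by (simp_all add: simple_roots_def)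

lemma D_independent:
  assumes "\<And>h. h \<in> H \<Longrightarrow> (\<Sum>\<alpha>\<in>D. c \<alpha> * \<alpha> h) = 0" "\<alpha> \<in> D"
  shows "c \<alpha> = 0"
proof -
  have "\<forall>c. (\<forall>h\<in>H. (\<Sum>\<alpha>\<in>D. c \<alpha> * \<alpha> h) = 0) \<longrightarrow> (\<forall>\<alpha>\<in>D. c \<alpha> = 0)"
    using simple by (simp add: simple_roots_def)
  then show ?thesis using assms by blast
qed

definition ev :: "(('a \<Rightarrow> complex) \<Rightarrow> int) \<Rightarrow> 'a \<Rightarrow> complex" where
  "ev v h = (\<Sum>\<alpha>\<in>D. of_int (v \<alpha>) * \<alpha> h)"

text \<open>For roots \<open>\<beta> (cr \<alpha>)\<close> is an integer living in the complex
  numbers; the floor of its real part brings it into \<open>int\<close>, as \<open>A_eq\<close>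
  confirms.\<close>

definition A :: "('a \<Rightarrow> complex) \<Rightarrow> ('a \<Rightarrow> complex) \<Rightarrow> int" where
  "A \<alpha> \<beta> = \<lfloor>Re (\<beta> (cr \<alpha>))\<rfloor>"

definition R :: "(('a \<Rightarrow> complex) \<Rightarrow> int) set" where
  "R = {v. (\<forall>\<alpha>. \<alpha> \<notin> D \<longrightarrow> v \<alpha> = 0) \<and> ev v \<in> \<Phi>}"

lemma A_eq: "\<alpha> \<in> \<Phi> \<Longrightarrow> \<beta> \<in> \<Phi> \<Longrightarrow> of_int (A \<alpha> \<beta>) = \<beta> (cr \<alpha>)"
proof -
  assume "\<alpha> \<in> \<Phi>" "\<beta> \<in> \<Phi>"
  then obtain n where "\<beta> (cr \<alpha>) = of_int n" using cartan_integer Ints_cases by metis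
  then show ?thesis by (simp add: A_def)
qed

lemma ev_outside: "h \<notin> H \<Longrightarrow> ev v h = 0"
  unfolding ev_def
proof (intro sum.neutral ballI)
  fix \<alpha> assume "h \<notin> H" "\<alpha> \<in> D"
  then have "\<alpha> h = 0" using root_vanish D_roots by blast
  then show "of_int (v \<alpha>) * \<alpha> h = 0" by simp
qed

lemma ev_inj:
  assumes "\<And>\<alpha>. \<alpha> \<notin> D \<Longrightarrow> v \<alpha> = 0" "\<And>\<alpha>. \<alpha> \<notin> D \<Longrightarrow> v' \<alpha> = 0" "\<And>h. h \<in> H \<Longrightarrow> ev v h = ev v' h"
  shows "v = v'"
proof
  fix \<alpha>
  have "v \<alpha> = v' \<alpha>" if "\<alpha> \<in> D"
  proof -
    have "of_int (v \<alpha>) - of_int (v' \<alpha>) = (0::complex)"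
    proof (rule D_independent[of "\<lambda>\<alpha>. of_int (v \<alpha>) - of_int (v' \<alpha>)"])
      show "(\<Sum>\<alpha>\<in>D. (of_int (v \<alpha>) - of_int (v' \<alpha>)) * \<alpha> h) = 0" if "h \<in> H" for h
        using assms(3)[OF that] by (simp only: ev_def left_diff_distrib sum_subtractf) simp
    qed (rule that)
    then show ?thesis by simp
  qed
  then show "v \<alpha> = v' \<alpha>" using assms(1,2) by metis
qed

lemma ev_upd: "\<alpha> \<in> D \<Longrightarrow> ev (v(\<alpha> := v \<alpha> - c)) h = ev v h - of_int c * \<alpha> h"
proof -
  assume \<alpha>: "\<alpha> \<in> D"
  have "ev (v(\<alpha> := v \<alpha> - c)) h = (\<Sum>\<beta>\<in>D. of_int (v \<beta>) * \<beta> h - (if \<beta> = \<alpha> then of_int c * \<alpha> h else 0))"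
    unfolding ev_def by (rule sum.cong) (auto simp: left_diff_distrib)
  then show ?thesis using \<alpha> finite_D by (simp add: sum_subtractf ev_def)
qed

lemma ev_zero [simp]: "ev (\<lambda>_. 0) h = 0"
  by (simp add: ev_def)

lemma ev_single: "\<alpha> \<in> D \<Longrightarrow> ev ((\<lambda>_. 0)(\<alpha> := c)) = (\<lambda>h. of_int c * \<alpha> h)"
  using ev_upd[of \<alpha> "\<lambda>_. 0" "- c"] by (auto simp: fun_eq_iff)

lemma ev_minus: "ev (\<lambda>\<alpha>. - v \<alpha>) = (\<lambda>h. - ev v h)"
  by (simp add: ev_def sum_negf fun_eq_iff)

lemma root_coefficients:
  assumes \<beta>: "\<beta> \<in> \<Phi>"
  obtains v where "v \<in> R" "ev v = \<beta>" "(\<forall>\<alpha>. 0 \<le> v \<alpha>) \<or> (\<forall>\<alpha>. v \<alpha> \<le> 0)"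
proof -
  obtain n :: "('a \<Rightarrow> complex) \<Rightarrow> nat" where n:
    "(\<forall>h\<in>H. \<beta> h = (\<Sum>\<alpha>\<in>D. of_nat (n \<alpha>) * \<alpha> h)) \<or> (\<forall>h\<in>H. \<beta> h = - (\<Sum>\<alpha>\<in>D. of_nat (n \<alpha>) * \<alpha> h))"
    using simple \<beta> unfolding simple_roots_def by meson
  define v where "v \<alpha> = (if \<alpha> \<in> D then int (n \<alpha>) else 0)" for \<alpha>
  have ev: "ev v h = (\<Sum>\<alpha>\<in>D. of_nat (n \<alpha>) * \<alpha> h)" for h
    unfolding ev_def v_def by (rule sum.cong) auto
  from n show ?thesis
  proof
    assume "\<forall>h\<in>H. \<beta> h = (\<Sum>\<alpha>\<in>D. of_nat (n \<alpha>) * \<alpha> h)"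
    then have "ev v = \<beta>" using ev ev_outside root_vanish[OF \<beta>] by (metis ext)
    then show ?thesis using that[of v] \<beta> by (simp add: R_def v_def)
  next
    assume "\<forall>h\<in>H. \<beta> h = - (\<Sum>\<alpha>\<in>D. of_nat (n \<alpha>) * \<alpha> h)"
    then have "ev (\<lambda>\<alpha>. - v \<alpha>) = \<beta>"
      unfolding ev_minus using ev ev_outside[of _ v] root_vanish[OF \<beta>] by (intro ext) (metis add.inverse_neutral)
    then show ?thesis using that[of "\<lambda>\<alpha>. - v \<alpha>"] \<beta> by (simp add: R_def v_def)
  qed
qed

lemma ev_coroot: "\<alpha> \<in> \<Phi> \<Longrightarrow> ev v (cr \<alpha>) = of_int (\<Sum>\<beta>\<in>D. A \<alpha> \<beta> * v \<beta>)"
  unfolding ev_def of_int_sum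
proof (intro sum.cong refl)
  fix \<beta> assume "\<alpha> \<in> \<Phi>" "\<beta> \<in> D"
  then have "of_int (A \<alpha> \<beta>) = \<beta> (cr \<alpha>)" using A_eq D_roots by blast
  then show "of_int (v \<beta>) * \<beta> (cr \<alpha>) = of_int (A \<alpha> \<beta> * v \<beta>)" by simp
qed

sublocale ir: integral_roots D A R
proof
  show "finite D" by (rule finite_D)
  have "inj_on ev R" using ev_inj by (auto simp: inj_on_def R_def)
  moreover have "finite (ev ` R)"
    using finite_roots by (rule finite_subset[rotated]) (auto simp: R_def)
  ultimately show "finite R" using finite_imageD by blast
  fix \<alpha> assume \<alpha>: "\<alpha> \<in> D"
  then have \<alpha>': "\<alpha> \<in> \<Phi>" using D_roots by blast
  show "A \<alpha> \<alpha> = 2" using root_coroot[OF \<alpha>'] by (simp add: A_def)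
  show "A \<beta> \<alpha> = 0" if "\<beta> \<in> D" "A \<alpha> \<beta> = 0" for \<beta>
  proof -
    have "\<beta> \<in> \<Phi>" using that D_roots by blast
    then have "\<beta> (cr \<alpha>) = 0" using A_eq[OF \<alpha>'] that by (metis of_int_0)
    then have "\<alpha> (cr \<beta>) = 0" using coroot_zero_sym \<alpha>' \<open>\<beta> \<in> \<Phi>\<close> by blast
    then show ?thesis by (simp add: A_def)
  qed
  show "(\<lambda>_. 0)(\<alpha> := 1) \<in> R" using \<alpha> \<alpha>' by (simp add: R_def ev_single)
  show "v(\<alpha> := v \<alpha> - (\<Sum>\<beta>\<in>D. A \<alpha> \<beta> * v \<beta>)) \<in> R" if "v \<in> R" for v
  proof -
    have "ev (v(\<alpha> := v \<alpha> - (\<Sum>\<beta>\<in>D. A \<alpha> \<beta> * v \<beta>))) = (\<lambda>h. ev v h - ev v (cr \<alpha>) * \<alpha> h)"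
      using ev_upd[OF \<alpha>] ev_coroot[OF \<alpha>'] by (simp add: fun_eq_iff del: of_int_sum)
    then show ?thesis using root_reflection[OF \<alpha>', of "ev v"] that \<alpha> by (simp add: R_def)
  qed
  show "n = 1" if "(\<lambda>_. 0)(\<alpha> := n) \<in> R" "0 < n" for n
  proof -
    have "(\<lambda>h. of_nat (nat n) * \<alpha> h) \<in> \<Phi>" using that ev_single[OF \<alpha>, of n] by (simp add: R_def of_nat_nat)
    then show ?thesis using root_multiple[OF \<alpha>', of "nat n"] by simp
  qed
next
  fix v assume v: "v \<in> R"
  show "v \<alpha> = 0" if "\<alpha> \<notin> D" for \<alpha> using v that by (simp add: R_def)
  show "(\<lambda>\<alpha>. - v \<alpha>) \<in> R" using v root_neg[of "ev v"] by (simp add: R_def ev_minus)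
  obtain v' where v': "v' \<in> R" "ev v' = ev v" "(\<forall>\<alpha>. 0 \<le> v' \<alpha>) \<or> (\<forall>\<alpha>. v' \<alpha> \<le> 0)"
    using root_coefficients[of "ev v"] v by (auto simp: R_def)
  have "v' = v" by (rule ev_inj) (use v v' in \<open>auto simp: R_def\<close>)
  then show "(\<forall>\<alpha>. 0 \<le> v \<alpha>) \<or> (\<forall>\<alpha>. v \<alpha> \<le> 0)" using v' by simp
next
  show "(\<lambda>_. 0) \<notin> R"
  proof
    assume "(\<lambda>_. 0) \<in> R"
    moreover have "ev (\<lambda>_. 0) = (\<lambda>h. 0)" by (simp add: fun_eq_iff)
    ultimately have "(\<lambda>h. 0) \<in> \<Phi>" by (simp add: R_def)
    then show False by (simp add: roots_def)
  qed
qed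

section \<open>Reflections and words acting on the Cartan subalgebra\<close>

definition refl :: "('a \<Rightarrow> complex) \<Rightarrow> 'a \<Rightarrow> 'a" where
  "refl = reflection UNIV H"

lemma refl_eq: "h \<in> H \<Longrightarrow> refl \<alpha> h = h - \<alpha> h *s cr \<alpha>"
  by (simp add: refl_def reflection_def)

lemma refl_H: "\<alpha> \<in> \<Phi> \<Longrightarrow> h \<in> H \<Longrightarrow> refl \<alpha> h \<in> H"
  using subspace_diff[OF subspace_H] subspace_scale[OF subspace_H] coroot_H by (simp add: refl_eq)

lemma refl_refl:
  assumes "\<alpha> \<in> \<Phi>" "h \<in> H"
  shows "refl \<alpha> (refl \<alpha> h) = h"
proof -
  have "\<alpha> (h - \<alpha> h *s cr \<alpha>) = - \<alpha> h"
    using root_diff[OF assms(1) assms(2)] root_scale[OF assms(1)] root_coroot[OF assms(1)]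
      coroot_H[OF assms(1)] subspace_scale[OF subspace_H] by simp
  then show ?thesis using assms refl_H[OF assms] by (simp add: refl_eq)
qed

lemma refl_Bij:
  assumes "\<alpha> \<in> \<Phi>"
  shows "refl \<alpha> \<in> Bij H"
proof -
  have "bij_betw (refl \<alpha>) H H"
    by (rule bij_betw_byWitness[of _ "refl \<alpha>"]) (use assms refl_H refl_refl in auto)
  moreover have "refl \<alpha> \<in> extensional H" by (simp add: refl_def reflection_def)
  ultimately show ?thesis by (simp add: Bij_def)
qed

lemma ev_refl: "\<alpha> \<in> D \<Longrightarrow> h \<in> H \<Longrightarrow> ev v (refl \<alpha> h) = ev (ir.s \<alpha> v) h"
proof -
  assume \<alpha>: "\<alpha> \<in> D" and h: "h \<in> H"
  then have \<alpha>': "\<alpha> \<in> \<Phi>" using D_roots by blast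
  have "ev v (refl \<alpha> h) = (\<Sum>\<beta>\<in>D. of_int (v \<beta>) * (\<beta> h - \<alpha> h * \<beta> (cr \<alpha>)))"
    unfolding ev_def refl_eq[OF h]
  proof (intro sum.cong HOL.refl)
    fix \<beta> assume "\<beta> \<in> D"
    then have \<beta>: "\<beta> \<in> \<Phi>" using D_roots by blast
    have "\<beta> (h - \<alpha> h *s cr \<alpha>) = \<beta> h - \<alpha> h * \<beta> (cr \<alpha>)"
      using root_diff[OF \<beta> h] root_scale[OF \<beta>] coroot_H[OF \<alpha>'] subspace_scale[OF subspace_H] by simp
    then show "of_int (v \<beta>) * \<beta> (h - \<alpha> h *s cr \<alpha>) = of_int (v \<beta>) * (\<beta> h - \<alpha> h * \<beta> (cr \<alpha>))" by simp
  qed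
  also have "\<dots> = ev v h - ev v (cr \<alpha>) * \<alpha> h"
    by (simp add: ev_def sum_subtractf right_diff_distrib sum_distrib_left sum_distrib_right algebra_simps)
  also have "\<dots> = ev (ir.s \<alpha> v) h"
    using ev_upd[OF \<alpha>] ev_coroot[OF \<alpha>'] by (simp add: ir.s_def ir.pr_def del: of_int_sum)
  finally show ?thesis .
qed

abbreviation W where "W \<equiv> weyl_group UNIV H D"

lemma one_W: "\<one>\<^bsub>W\<^esub> = (\<lambda>h\<in>H. h)"
  by (simp add: weyl_group_def BijGroup_def)

lemma mult_W: "x \<in> Bij H \<Longrightarrow> y \<in> Bij H \<Longrightarrow> x \<otimes>\<^bsub>W\<^esub> y = compose H x y"
  by (simp add: weyl_group_def BijGroup_def)

lemma carrier_W: "carrier W = generate (BijGroup H) (refl ` D)"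
proof -
  have "carrier (BijGroup H) \<inter> refl ` D = refl ` D"
    using refl_Bij D_roots by (auto simp: BijGroup_def)
  then show ?thesis
    by (simp add: weyl_group_def carrier_subgroup_generated simple_reflections_def refl_def)
qed



definition wp :: "('a \<Rightarrow> complex) list \<Rightarrow> 'a \<Rightarrow> 'a" where
  "wp ws = word_prod W (map refl ws)"

lemma wp_empty: "wp [] = (\<lambda>h\<in>H. h)"
  by (simp add: wp_def word_prod_def one_W)

lemma wp_Bij: "set ws \<subseteq> D \<Longrightarrow> wp ws \<in> Bij H"
proof (induction ws)
  case Nil
  show ?case unfolding wp_empty by (rule id_Bij)
next
  case (Cons \<alpha> ws)
  then have "refl \<alpha> \<in> Bij H" using refl_Bij D_roots by auto
  then show ?case using Cons by (simp add: wp_def word_prod_def mult_W compose_Bij)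
qed

lemma wp_Nil: "h \<in> H \<Longrightarrow> wp [] h = h"
  by (simp add: wp_def word_prod_def one_W)

lemma wp_Cons: "set (\<alpha> # ws) \<subseteq> D \<Longrightarrow> wp (\<alpha> # ws) = compose H (refl \<alpha>) (wp ws)"
  using refl_Bij D_roots wp_Bij[of ws] by (auto simp: wp_def word_prod_def mult_W)

lemma wp_H: "set ws \<subseteq> D \<Longrightarrow> h \<in> H \<Longrightarrow> wp ws h \<in> H"
  using wp_Bij Bij_imp_funcset by blast

text \<open>\<open>wp\<close> acts on \<open>H\<close>, \<open>ir.act\<close> on the coefficients of
  functionals; the reflections are transposes of each other, hence the reversal of the word.\<close>

lemma ev_wp: "set ws \<subseteq> D \<Longrightarrow> h \<in> H \<Longrightarrow> ev v (wp ws h) = ev (ir.act (rev ws) v) h"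
proof (induction ws arbitrary: v)
  case (Cons \<alpha> ws)
  then show ?case by (simp add: wp_Cons compose_def ev_refl wp_H)
qed (simp add: wp_Nil)

lemma wp_append: "set us \<subseteq> D \<Longrightarrow> set ws \<subseteq> D \<Longrightarrow> wp (us @ ws) = compose H (wp us) (wp ws)"
proof (induction us)
  case Nil
  then have b: "wp ws \<in> Bij H" using wp_Bij by blast
  show ?case
    unfolding append_Nil wp_empty Id_compose[OF Bij_imp_funcset[OF b] Bij_imp_extensional[OF b]] ..
next
  case (Cons \<alpha> us)
  then have "compose H (refl \<alpha>) (compose H (wp us) (wp ws)) = compose H (compose H (refl \<alpha>) (wp us)) (wp ws)"
    using wp_H by (intro compose_assoc) auto
  then show ?case using Cons wp_Cons[of \<alpha> us] wp_Cons[of \<alpha> "us @ ws"] by simp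
qed

text \<open>Roots separate the points of \<open>H\<close>, and coefficients are determined by values
  on \<open>H\<close>, so a word and its transpose determine each other; \<open>ir.eqv_rev\<close>
  undoes the reversal.\<close>

lemma wp_eq_iff:
  assumes "set us \<subseteq> D" "set ws \<subseteq> D"
  shows "wp us = wp ws \<longleftrightarrow> ir.eqv us ws"
proof -
  have "wp us = wp ws \<longleftrightarrow> ir.eqv (rev us) (rev ws)"
  proof
    assume eq: "wp us = wp ws"
    have "ir.act (rev us) v = ir.act (rev ws) v" if v: "v \<in> R" for v
    proof (rule ev_inj)
      have "ir.act (rev us) v \<in> R" "ir.act (rev ws) v \<in> R" using ir.act_R v assms by auto
      then show "ir.act (rev us) v \<alpha> = 0" "ir.act (rev ws) v \<alpha> = 0" if "\<alpha> \<notin> D" for \<alpha>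
        using that by (auto simp: R_def)
      show "ev (ir.act (rev us) v) h = ev (ir.act (rev ws) v) h" if "h \<in> H" for h
        using ev_wp[OF assms(1) that, of v] ev_wp[OF assms(2) that, of v] eq by simp
    qed
    then show "ir.eqv (rev us) (rev ws)" by (simp add: ir.eqv_def)
  next
    assume eq: "ir.eqv (rev us) (rev ws)"
    show "wp us = wp ws"
    proof (rule extensionalityI)
      show "wp us \<in> extensional H" "wp ws \<in> extensional H"
        using wp_Bij assms Bij_imp_extensional by blast+
      fix h assume h: "h \<in> H"
      have "wp us h - wp ws h = 0"
      proof (rule roots_separate_H)
        show "wp us h - wp ws h \<in> H" using subspace_diff[OF subspace_H] wp_H assms h by blast
        fix \<beta> assume \<beta>: "\<beta> \<in> \<Phi>"
        obtain v where v: "v \<in> R" "ev v = \<beta>" using root_coefficients[OF \<beta>] by blast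
        have "\<beta> (wp us h) = \<beta> (wp ws h)"
          using ev_wp[OF assms(1) h, of v] ev_wp[OF assms(2) h, of v] eq v by (simp add: ir.eqv_def)
        then show "\<beta> (wp us h - wp ws h) = 0" using root_diff[OF \<beta>] wp_H assms h by simp
      qed
      then show "wp us h = wp ws h" by simp
    qed
  qed
  also have "\<dots> \<longleftrightarrow> ir.eqv us ws"
    using ir.eqv_rev[of "rev us" "rev ws"] ir.eqv_rev[of us ws] assms by auto
  finally show ?thesis .
qed

lemma wp_single: "\<alpha> \<in> D \<Longrightarrow> wp [\<alpha>] = refl \<alpha>"
proof -
  assume "\<alpha> \<in> D"
  moreover from this have b: "refl \<alpha> \<in> Bij H" using refl_Bij D_roots by blast
  ultimately show "wp [\<alpha>] = refl \<alpha>"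
    using compose_Id[OF Bij_imp_funcset[OF b] Bij_imp_extensional[OF b]]
    by (simp add: wp_Cons wp_empty)
qed

lemma carrier_W_words:
  assumes "w \<in> carrier W"
  shows "\<exists>ws. set ws \<subseteq> D \<and> w = wp ws"
  using assms unfolding carrier_W
proof (induction rule: generate.induct)
  case one
  have "\<one>\<^bsub>BijGroup H\<^esub> = wp []" by (simp add: wp_empty BijGroup_def)
  then show ?case by (intro exI[of _ "[]"]) simp
next
  case (incl h)
  then obtain \<alpha> where \<alpha>: "\<alpha> \<in> D" "h = refl \<alpha>" by blast
  then show ?case using wp_single by (intro exI[of _ "[\<alpha>]"]) simp
next
  case (inv h)
  then obtain \<alpha> where \<alpha>: "\<alpha> \<in> D" "h = refl \<alpha>" by blast
  then have b: "refl \<alpha> \<in> Bij H" using refl_Bij D_roots by blast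
  have "refl \<alpha> \<otimes>\<^bsub>BijGroup H\<^esub> refl \<alpha> = \<one>\<^bsub>BijGroup H\<^esub>"
  proof -
    have "compose H (refl \<alpha>) (refl \<alpha>) = (\<lambda>h\<in>H. h)"
      unfolding compose_def by (rule restrict_ext) (use \<alpha> D_roots refl_refl in auto)
    then show ?thesis using b by (simp add: BijGroup_def)
  qed
  then have "inv\<^bsub>BijGroup H\<^esub> h = refl \<alpha>"
    unfolding \<alpha>(2) by (rule group.inv_equality[OF group_BijGroup]) (use b in \<open>simp_all add: BijGroup_def\<close>)
  then show ?case using \<alpha> wp_single by (intro exI[of _ "[\<alpha>]"]) simp
next
  case (eng h1 h2)
  then obtain us ws where "set us \<subseteq> D" "h1 = wp us" "set ws \<subseteq> D" "h2 = wp ws" by blast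
  then show ?case
    using wp_append[of us ws] wp_Bij by (intro exI[of _ "us @ ws"]) (simp add: BijGroup_def)
qed

sublocale ww: weyl_words D A R W refl
proof (intro weyl_words.intro weyl_words_axioms.intro)
  show "integral_roots D A R" by (rule ir.integral_roots_axioms)
  show "group W"
    unfolding weyl_group_def by (rule group.group_subgroup_generated[OF group_BijGroup])
  fix \<alpha> assume "\<alpha> \<in> D"
  then show "refl \<alpha> \<in> carrier W" unfolding carrier_W by (intro generate.incl) simp
next
  fix w assume "w \<in> carrier W"
  then show "\<exists>ws. set ws \<subseteq> D \<and> w = word_prod W (map refl ws)"
    using carrier_W_words[of w] by (simp only: wp_def)
next
  fix us ws assume "set us \<subseteq> D" "set ws \<subseteq> D"
  then show "word_prod W (map refl us) = word_prod W (map refl ws) \<longleftrightarrow> ir.eqv us ws"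
    using wp_eq_iff[of us ws] by (simp only: wp_def)
qed

end

section \<open>Simple factors from connected components\<close>

context root_basis
begin

lemma D_separates:
  assumes h: "h \<in> H" "\<And>\<alpha>. \<alpha> \<in> D \<Longrightarrow> \<alpha> h = 0"
  shows "h = 0"
proof (rule roots_separate_H[OF h(1)])
  fix \<beta> assume "\<beta> \<in> \<Phi>"
  then obtain v where "ev v = \<beta>" using root_coefficients by blast
  moreover have "ev v h = 0" unfolding ev_def using h(2) by (intro sum.neutral) simp
  ultimately show "\<beta> h = 0" by simp
qed

text \<open>By independence \<open>g\<close> is not a combination of members of \<open>T\<close>, so
  some \<open>h\<close> distinguishes it from the combination with coefficients
  \<open>g (d \<beta>)\<close>. Removing from \<open>h\<close> its part along the
  \<open>d \<beta>\<close> leaves a \<open>k\<close> on which \<open>T\<close> vanishes and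
  \<open>g\<close> does not; multiples of \<open>k\<close> then correct the old dual
  vectors.\<close>

lemma dual_basis_partial:
  assumes "finite T" "T \<subseteq> D"
  shows "\<exists>d. \<forall>\<alpha>\<in>T. d \<alpha> \<in> H \<and> (\<forall>\<beta>\<in>T. \<beta> (d \<alpha>) = (if \<alpha> = \<beta> then 1 else 0))"
  using assms
proof (induction T rule: finite_induct)
  case (insert g T)
  then obtain d where d: "\<And>\<alpha>. \<alpha> \<in> T \<Longrightarrow> d \<alpha> \<in> H"
    "\<And>\<alpha> \<beta>. \<alpha> \<in> T \<Longrightarrow> \<beta> \<in> T \<Longrightarrow> \<beta> (d \<alpha>) = (if \<alpha> = \<beta> then 1 else 0)" by auto
  have g: "g \<in> \<Phi>" and T: "\<And>\<beta>. \<beta> \<in> T \<Longrightarrow> \<beta> \<in> \<Phi>" using insert D_roots by auto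
  have "\<exists>h\<in>H. g h - (\<Sum>\<beta>\<in>T. g (d \<beta>) * \<beta> h) \<noteq> 0"
  proof (rule ccontr)
    assume asm: "\<not> ?thesis"
    define c where "c \<alpha> = (if \<alpha> = g then 1 else if \<alpha> \<in> T then - g (d \<alpha>) else 0)" for \<alpha>
    have "(\<Sum>\<alpha>\<in>D. c \<alpha> * \<alpha> h) = 0" if h: "h \<in> H" for h
    proof -
      have "(\<Sum>\<alpha>\<in>D. c \<alpha> * \<alpha> h) = (\<Sum>\<alpha>\<in>insert g T. c \<alpha> * \<alpha> h)"
        by (rule sum.mono_neutral_right) (use insert finite_D in \<open>auto simp: c_def\<close>)
      also have "\<dots> = g h + (\<Sum>\<alpha>\<in>T. c \<alpha> * \<alpha> h)"
        using insert.hyps by (simp add: c_def)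
      also have "(\<Sum>\<alpha>\<in>T. c \<alpha> * \<alpha> h) = (\<Sum>\<alpha>\<in>T. - (g (d \<alpha>) * \<alpha> h))"
        by (rule sum.cong) (use insert.hyps in \<open>auto simp: c_def\<close>)
      finally show ?thesis using asm h by (simp add: sum_negf)
    qed
    then have "c g = 0" by (rule D_independent[of c g]) (use insert in auto)
    then show False by (simp add: c_def)
  qed
  then obtain h where h: "h \<in> H" "g h - (\<Sum>\<beta>\<in>T. g (d \<beta>) * \<beta> h) \<noteq> 0" by blast
  define k where "k = h - (\<Sum>\<beta>\<in>T. \<beta> h *s d \<beta>)"
  have sH: "(\<Sum>\<beta>\<in>T. \<beta> h *s d \<beta>) \<in> H"
    using d(1) by (intro subspace_sum subspace_scale subspace_H)
  have kH: "k \<in> H" unfolding k_def by (rule subspace_diff[OF subspace_H h(1) sH])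
  have val: "\<gamma> k = \<gamma> h - (\<Sum>\<beta>\<in>T. \<beta> h * \<gamma> (d \<beta>))" if "\<gamma> \<in> \<Phi>" for \<gamma>
  proof -
    have "\<gamma> (\<Sum>\<beta>\<in>T. \<beta> h *s d \<beta>) = (\<Sum>\<beta>\<in>T. \<gamma> (\<beta> h *s d \<beta>))"
      using d(1) by (intro root_sum[OF that] subspace_scale[OF subspace_H])
    also have "\<dots> = (\<Sum>\<beta>\<in>T. \<beta> h * \<gamma> (d \<beta>))"
      by (rule sum.cong) (use root_scale[OF that d(1)] in auto)
    finally show ?thesis unfolding k_def using root_diff[OF that h(1) sH] by simp
  qed
  have Tk: "\<gamma> k = 0" if "\<gamma> \<in> T" for \<gamma>
  proof -
    have "(\<Sum>\<beta>\<in>T. \<beta> h * \<gamma> (d \<beta>)) = (\<Sum>\<beta>\<in>T. if \<beta> = \<gamma> then \<gamma> h else 0)"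
    proof (rule sum.cong[OF HOL.refl])
      fix \<beta> assume "\<beta> \<in> T"
      then show "\<beta> h * \<gamma> (d \<beta>) = (if \<beta> = \<gamma> then \<gamma> h else 0)" using d(2)[OF _ that, of \<beta>] by simp
    qed
    then show ?thesis using val[OF T[OF that]] insert.hyps that by simp
  qed
  have gk: "g k \<noteq> 0" using val[OF g] h(2) by (simp add: mult.commute)
  define k' where "k' = (1 / g k) *s k"
  have k'H: "k' \<in> H" unfolding k'_def by (rule subspace_scale[OF subspace_H kH])
  have gk': "g k' = 1" unfolding k'_def using root_scale[OF g kH] gk by simp
  have Tk': "\<gamma> k' = 0" if "\<gamma> \<in> T" for \<gamma>
    unfolding k'_def using root_scale[OF T[OF that] kH] Tk[OF that] by simp
  define d' where "d' = (\<lambda>\<alpha>. if \<alpha> = g then k' else d \<alpha> - g (d \<alpha>) *s k')"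
  have d'H: "d \<alpha> - g (d \<alpha>) *s k' \<in> H" if "\<alpha> \<in> T" for \<alpha>
    using subspace_diff[OF subspace_H d(1)[OF that]] subspace_scale[OF subspace_H k'H] .
  have vd': "\<gamma> (d \<alpha> - g (d \<alpha>) *s k') = \<gamma> (d \<alpha>) - g (d \<alpha>) * \<gamma> k'" if "\<alpha> \<in> T" "\<gamma> \<in> \<Phi>" for \<alpha> \<gamma>
    using root_diff[OF that(2) d(1)[OF that(1)]] root_scale[OF that(2) k'H]
      subspace_scale[OF subspace_H k'H] by simp
  have "d' \<alpha> \<in> H \<and> (\<forall>\<beta>\<in>insert g T. \<beta> (d' \<alpha>) = (if \<alpha> = \<beta> then 1 else 0))" if "\<alpha> \<in> insert g T" for \<alpha>
  proof (cases "\<alpha> = g")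
    case True
    then show ?thesis using k'H gk' Tk' insert.hyps by (auto simp: d'_def)
  next
    case False
    then have \<alpha>: "\<alpha> \<in> T" using that by simp
    have "\<beta> (d' \<alpha>) = (if \<alpha> = \<beta> then 1 else 0)" if "\<beta> \<in> insert g T" for \<beta>
    proof (cases "\<beta> = g")
      case True
      then show ?thesis using vd'[OF \<alpha> g] gk' False by (simp add: d'_def)
    next
      case False
      then have \<beta>: "\<beta> \<in> T" using that by simp
      then show ?thesis using vd'[OF \<alpha> T[OF \<beta>]] Tk'[OF \<beta>] d(2)[OF \<alpha> \<beta>] \<open>\<alpha> \<noteq> g\<close> by (simp add: d'_def)
    qed
    then show ?thesis using False d'H[OF \<alpha>] by (simp add: d'_def)
  qed
  then show ?case by blast
qed simp

section \<open>Coweights and the splitting of the Cartan subalgebra\<close>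

definition coweight :: "('a \<Rightarrow> complex) \<Rightarrow> 'a" where
  "coweight = (SOME d. \<forall>\<alpha>\<in>D. d \<alpha> \<in> H \<and> (\<forall>\<beta>\<in>D. \<beta> (d \<alpha>) = (if \<alpha> = \<beta> then 1 else 0)))"

lemma coweight: "\<forall>\<alpha>\<in>D. coweight \<alpha> \<in> H \<and> (\<forall>\<beta>\<in>D. \<beta> (coweight \<alpha>) = (if \<alpha> = \<beta> then 1 else 0))"
  unfolding coweight_def by (rule someI_ex[OF dual_basis_partial[OF finite_D order_refl]])

lemma coweight_H: "\<alpha> \<in> D \<Longrightarrow> coweight \<alpha> \<in> H"
  and coweight_dual: "\<alpha> \<in> D \<Longrightarrow> \<beta> \<in> D \<Longrightarrow> \<beta> (coweight \<alpha>) = (if \<alpha> = \<beta> then 1 else 0)"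
  using coweight by blast+

text \<open>As a common kernel this is complementary to \<open>HC (D - C)\<close> for every
  \<open>C \<subseteq> D\<close>. For a block orthogonal to the rest it is also the span of the
  coroots, by \<open>HC_span_coroots\<close>.\<close>

definition HC :: "('a \<Rightarrow> complex) set \<Rightarrow> 'a set" where
  "HC C = {h \<in> H. \<forall>\<gamma>\<in>D - C. \<gamma> h = 0}"

text \<open>For \<open>C \<subseteq> D\<close>, the projection of \<open>H\<close> onto
  \<open>HC C\<close> along \<open>HC (D - C)\<close>.\<close>

definition proj :: "('a \<Rightarrow> complex) set \<Rightarrow> 'a \<Rightarrow> 'a" where
  "proj C h = (\<Sum>\<alpha>\<in>C. \<alpha> h *s coweight \<alpha>)"

lemma proj_H: "C \<subseteq> D \<Longrightarrow> proj C h \<in> H"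
  unfolding proj_def using coweight_H by (intro subspace_sum subspace_scale subspace_H) auto

lemma D_proj:
  assumes "C \<subseteq> D" "\<gamma> \<in> D"
  shows "\<gamma> (proj C h) = (if \<gamma> \<in> C then \<gamma> h else 0)"
proof -
  have \<gamma>: "\<gamma> \<in> \<Phi>" using assms D_roots by blast
  have fin: "finite C" using assms finite_D finite_subset by blast
  have "\<gamma> (proj C h) = (\<Sum>\<alpha>\<in>C. \<gamma> (\<alpha> h *s coweight \<alpha>))"
    unfolding proj_def using coweight_H assms by (intro root_sum[OF \<gamma>] subspace_scale[OF subspace_H]) auto
  also have "\<dots> = (\<Sum>\<alpha>\<in>C. if \<alpha> = \<gamma> then \<gamma> h else 0)"
  proof (rule sum.cong[OF HOL.refl])
    fix \<alpha> assume "\<alpha> \<in> C"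
    then have \<alpha>: "\<alpha> \<in> D" using assms by blast
    show "\<gamma> (\<alpha> h *s coweight \<alpha>) = (if \<alpha> = \<gamma> then \<gamma> h else 0)"
      using coweight_dual[OF \<alpha> assms(2)] root_scale[OF \<gamma> coweight_H[OF \<alpha>]] by simp
  qed
  finally show ?thesis using fin by simp
qed

lemma proj_HC: "C \<subseteq> D \<Longrightarrow> proj C h \<in> HC C"
proof -
  assume C: "C \<subseteq> D"
  have "\<gamma> (proj C h) = 0" if "\<gamma> \<in> D - C" for \<gamma> using D_proj[OF C, of \<gamma> h] that by simp
  then show "proj C h \<in> HC C" using proj_H[OF C] by (simp add: HC_def)
qed

lemma proj_eq: "C \<subseteq> D \<Longrightarrow> h \<in> HC C \<Longrightarrow> proj C h = h"
proof -
  assume C: "C \<subseteq> D" and h: "h \<in> HC C"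
  then have hH: "h \<in> H" by (simp add: HC_def)
  have "proj C h - h = 0"
  proof (rule D_separates)
    show "proj C h - h \<in> H" using subspace_diff[OF subspace_H proj_H[OF C] hH] .
    fix \<alpha> assume \<alpha>: "\<alpha> \<in> D"
    then have "\<alpha> (proj C h - h) = \<alpha> (proj C h) - \<alpha> h"
      using root_diff[OF _ proj_H[OF C] hH] D_roots by blast
    then show "\<alpha> (proj C h - h) = 0" using D_proj[OF C \<alpha>, of h] h \<alpha> by (auto simp: HC_def)
  qed
  then show ?thesis by simp
qed

lemma proj_add:
  assumes C: "C \<subseteq> D" and h: "h \<in> H"
  shows "proj C h + proj (D - C) h = h"
proof -
  have C': "D - C \<subseteq> D" by blast
  have "(proj C h + proj (D - C) h) - h = 0"
  proof (rule D_separates)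
    have 1: "proj C h + proj (D - C) h \<in> H"
      using subspace_add[OF subspace_H proj_H[OF C] proj_H[OF C']] .
    show "(proj C h + proj (D - C) h) - h \<in> H" using subspace_diff[OF subspace_H 1 h] .
    fix \<alpha> assume \<alpha>: "\<alpha> \<in> D"
    then have \<alpha>': "\<alpha> \<in> \<Phi>" using D_roots by blast
    have "\<alpha> ((proj C h + proj (D - C) h) - h) = \<alpha> (proj C h) + \<alpha> (proj (D - C) h) - \<alpha> h"
      using root_diff[OF \<alpha>' 1 h] root_add[OF \<alpha>' proj_H[OF C] proj_H[OF C']] by simp
    then show "\<alpha> ((proj C h + proj (D - C) h) - h) = 0"
      using D_proj[OF C \<alpha>, of h] D_proj[OF C' \<alpha>, of h] \<alpha> by auto
  qed
  then show ?thesis by simp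
qed

lemma subspace_HC: "subspace (HC C)"
proof (rule subspaceI)
  have "\<gamma> 0 = 0" if "\<gamma> \<in> D" for \<gamma>
    using root_scale[of \<gamma> 0 0] subspace_0[OF subspace_H] that D_roots by auto
  then show "0 \<in> HC C" using subspace_0[OF subspace_H] by (simp add: HC_def)
next
  fix x y assume xy: "x \<in> HC C" "y \<in> HC C"
  have "\<gamma> (x + y) = 0" if "\<gamma> \<in> D - C" for \<gamma>
  proof -
    have "\<gamma> \<in> \<Phi>" using that D_roots by blast
    moreover have "\<gamma> x = 0" "\<gamma> y = 0" "x \<in> H" "y \<in> H" using xy that unfolding HC_def by blast+
    ultimately show ?thesis using root_add[of \<gamma> x y] by simp
  qed
  then show "x + y \<in> HC C"
    using subspace_add[OF subspace_H, of x y] xy by (simp add: HC_def)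
next
  fix c x assume x: "x \<in> HC C"
  have "\<gamma> (c *s x) = 0" if "\<gamma> \<in> D - C" for \<gamma>
  proof -
    have "\<gamma> \<in> \<Phi>" using that D_roots by blast
    moreover have "\<gamma> x = 0" "x \<in> H" using x that unfolding HC_def by blast+
    ultimately show ?thesis using root_scale[of \<gamma> x c] by simp
  qed
  then show "c *s x \<in> HC C"
    using subspace_scale[OF subspace_H, of x c] x by (simp add: HC_def)
qed

lemma HC_H: "h \<in> HC C \<Longrightarrow> h \<in> H"
  by (simp add: HC_def)

section \<open>The ideal attached to a block of simple roots\<close>

definition RC :: "('a \<Rightarrow> complex) set \<Rightarrow> ('a \<Rightarrow> complex) set" where
  "RC C = {\<beta> \<in> \<Phi>. \<forall>h\<in>HC (D - C). \<beta> h = 0}"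

text \<open>For a \<open>component\<close> this is an ideal of the whole algebra and the candidate
  for a simple factor. Vanishing on the complementary part of \<open>H\<close>, as in
  \<open>RC C\<close>, says that a root involves only the simple roots in \<open>C\<close>.\<close>

definition FC :: "('a \<Rightarrow> complex) set \<Rightarrow> 'a set" where
  "FC C = span (HC C \<union> (\<Union>\<beta>\<in>RC C. rs \<beta>))"

definition component :: "('a \<Rightarrow> complex) set \<Rightarrow> bool" where
  "component C \<longleftrightarrow> C \<subseteq> D \<and> (\<forall>\<alpha>\<in>C. \<forall>\<gamma>\<in>D - C. \<gamma> (cr \<alpha>) = 0)"

lemma componentD: "component C \<Longrightarrow> C \<subseteq> D" "component C \<Longrightarrow> \<alpha> \<in> C \<Longrightarrow> \<gamma> \<in> D - C \<Longrightarrow> \<gamma> (cr \<alpha>) = 0"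
  "component C \<Longrightarrow> \<alpha> \<in> C \<Longrightarrow> \<gamma> \<in> D - C \<Longrightarrow> \<alpha> (cr \<gamma>) = 0"
proof -
  assume C: "component C"
  show "C \<subseteq> D" using C by (simp add: component_def)
  assume "\<alpha> \<in> C" "\<gamma> \<in> D - C"
  then show "\<gamma> (cr \<alpha>) = 0" using C by (simp add: component_def)
  then show "\<alpha> (cr \<gamma>) = 0"
    using coroot_zero_sym[of \<gamma> \<alpha>] C D_roots \<open>\<alpha> \<in> C\<close> \<open>\<gamma> \<in> D - C\<close> by (auto simp: component_def)
qed

lemma double_compl: "C \<subseteq> D \<Longrightarrow> D - (D - C) = C"
  by blast

lemma RC_roots: "RC C \<subseteq> \<Phi>"
  by (auto simp: RC_def)

lemma RC_vanish: "\<beta> \<in> RC C \<Longrightarrow> h \<in> HC (D - C) \<Longrightarrow> \<beta> h = 0"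
  by (simp add: RC_def)

lemma RC_nonvanish:
  assumes C: "C \<subseteq> D" and \<beta>: "\<beta> \<in> RC C"
  obtains h where "h \<in> HC C" "\<beta> h \<noteq> 0"
proof -
  have \<beta>': "\<beta> \<in> \<Phi>" using \<beta> RC_roots by blast
  then obtain h where h: "h \<in> H" "\<beta> h \<noteq> 0" by (auto simp: roots_iff)
  have "\<beta> h = \<beta> (proj C h + proj (D - C) h)" using proj_add[OF C h(1)] by simp
  also have "\<dots> = \<beta> (proj C h) + \<beta> (proj (D - C) h)"
    by (rule root_add[OF \<beta>' proj_H[OF C] proj_H]) blast
  finally have "\<beta> h = \<beta> (proj C h) + \<beta> (proj (D - C) h)" .
  moreover have "\<beta> (proj (D - C) h) = 0" using RC_vanish[OF \<beta>] proj_HC[of "D - C"] by blast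
  ultimately show ?thesis using that[OF proj_HC[OF C]] h(2) by auto
qed

lemma RC_disjoint:
  assumes C: "C \<subseteq> D" and \<beta>: "\<beta> \<in> RC C" "\<And>h. h \<in> HC C \<Longrightarrow> \<beta> h = 0"
  shows False
proof -
  obtain h where "h \<in> HC C" "\<beta> h \<noteq> 0" using RC_nonvanish[OF C \<beta>(1)] .
  then show False using \<beta>(2) by blast
qed

lemma simple_RC: "C \<subseteq> D \<Longrightarrow> \<alpha> \<in> C \<Longrightarrow> \<alpha> \<in> RC C"
proof -
  assume "C \<subseteq> D" "\<alpha> \<in> C"
  then have "\<alpha> \<in> \<Phi>" "\<alpha> \<in> D - (D - C)" using D_roots by blast+
  then show "\<alpha> \<in> RC C" unfolding RC_def HC_def by blast
qed

lemma roots_RC: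
  assumes C: "component C"
  shows "\<Phi> \<subseteq> RC C \<union> RC (D - C)"
proof
  fix \<beta> assume \<beta>: "\<beta> \<in> \<Phi>"
  obtain v where v: "v \<in> R" "ev v = \<beta>" using root_coefficients[OF \<beta>] by blast
  have "A i k = 0" if "i \<in> C" "k \<in> D - C" for i k
    using componentD(2)[OF C that] by (simp add: A_def)
  from ir.root_support[OF this componentD(1)[OF C] v(1)]
  show "\<beta> \<in> RC C \<union> RC (D - C)"
  proof
    assume v0: "\<forall>i. i \<notin> C \<longrightarrow> v i = 0"
    have "ev v h = 0" if "h \<in> HC (D - C)" for h
      unfolding ev_def using v0 that componentD(1)[OF C] by (intro sum.neutral) (auto simp: HC_def)
    then show ?thesis using \<beta> v(2) by (auto simp: RC_def)
  next
    assume v0: "\<forall>i\<in>C. v i = 0"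
    have "ev v h = 0" if "h \<in> HC C" for h
      unfolding ev_def using v0 that by (intro sum.neutral) (auto simp: HC_def)
    then show ?thesis using \<beta> v(2) double_compl[OF componentD(1)[OF C]] by (auto simp: RC_def)
  qed
qed

text \<open>The coroot of a simple root outside \<open>C\<close> lies in \<open>HC (D - C)\<close>,
  where \<open>\<beta>\<close> vanishes; \<open>coroot_zero_sym\<close> turns this around.\<close>

lemma coroot_HC:
  assumes C: "component C" and \<beta>: "\<beta> \<in> RC C"
  shows "cr \<beta> \<in> HC C"
proof -
  have \<beta>': "\<beta> \<in> \<Phi>" using \<beta> RC_roots by blast
  have "\<gamma> (cr \<beta>) = 0" if \<gamma>: "\<gamma> \<in> D - C" for \<gamma>
  proof -
    have \<gamma>': "\<gamma> \<in> \<Phi>" using \<gamma> D_roots by blast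
    have "cr \<gamma> \<in> HC (D - C)"
      using coroot_H[OF \<gamma>'] componentD(3)[OF C _ \<gamma>] by (auto simp: HC_def)
    then show ?thesis using RC_vanish[OF \<beta>] coroot_zero_sym[OF \<beta>' \<gamma>'] by blast
  qed
  then show ?thesis using coroot_H[OF \<beta>'] by (simp add: HC_def)
qed

lemma HC_FC: "HC C \<subseteq> FC C" and rs_FC: "\<beta> \<in> RC C \<Longrightarrow> rs \<beta> \<subseteq> FC C"
  unfolding FC_def by (auto intro: span_base)

lemma subspace_FC: "subspace (FC C)"
  by (simp add: FC_def)

lemma bracket_H_rs: "h \<in> H \<Longrightarrow> x \<in> rs \<beta> \<Longrightarrow> bracket h x = \<beta> h *s x"
  "h \<in> H \<Longrightarrow> x \<in> rs \<beta> \<Longrightarrow> bracket x h = (- \<beta> h) *s x"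
  using bracket_anti[of x h] by (auto simp: rs_iff)

lemma bracket_rs_sum:
  assumes "\<beta> \<in> \<Phi>" "\<gamma> \<in> \<Phi>" "x \<in> rs \<beta>" "y \<in> rs \<gamma>" "bracket x y \<noteq> 0"
  shows "(\<forall>h\<in>H. \<gamma> h = - \<beta> h) \<or> (\<lambda>h. \<beta> h + \<gamma> h) \<in> \<Phi>"
proof (cases "\<forall>h\<in>H. \<beta> h + \<gamma> h = 0")
  case True
  then show ?thesis by (simp add: eq_neg_iff_add_eq_0 add.commute)
next
  case False
  then have "(\<lambda>h. \<beta> h + \<gamma> h) \<in> \<Phi>"
    using rs_bracket[OF assms(3,4)] assms(5) root_vanish[OF assms(1)] root_vanish[OF assms(2)]
    by (auto simp: roots_iff)
  then show ?thesis ..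
qed

text \<open>A nonzero bracket of root vectors from the two halves would have weight
  \<open>\<beta> + \<gamma>\<close>. This sum is neither zero nor a root: a root belongs to one half
  by \<open>roots_RC\<close>, and then \<open>\<gamma>\<close> or \<open>\<beta>\<close> would
  vanish on both parts of \<open>H\<close>.\<close>

lemma FC_commute:
  assumes C: "component C" and x: "x \<in> FC C" and y: "y \<in> FC (D - C)"
  shows "bracket x y = 0"
proof -
  have sub: "C \<subseteq> D" by (rule componentD(1)[OF C])
  note cc = double_compl[OF sub]
  have "bracket x y \<in> {0}"
  proof (rule bracket_span_in[OF _ subspace_single_0 x[unfolded FC_def] y[unfolded FC_def]])
    fix x y assume x: "x \<in> HC C \<union> (\<Union>\<beta>\<in>RC C. rs \<beta>)"
      and y: "y \<in> HC (D - C) \<union> (\<Union>\<beta>\<in>RC (D - C). rs \<beta>)"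
    have "bracket x y = 0" if \<beta>: "\<beta> \<in> RC C" "x \<in> rs \<beta>" and \<gamma>: "\<gamma> \<in> RC (D - C)" "y \<in> rs \<gamma>" for \<beta> \<gamma>
    proof (rule ccontr)
      assume nz: "bracket x y \<noteq> 0"
      have R: "\<beta> \<in> \<Phi>" "\<gamma> \<in> \<Phi>" using \<beta> \<gamma> RC_roots by blast+
      have \<gamma>0: "\<gamma> h = 0" if "h \<in> HC C" for h using RC_vanish[OF \<gamma>(1)] that cc by simp
      have \<beta>0: "\<beta> h = 0" if "h \<in> HC (D - C)" for h using RC_vanish[OF \<beta>(1)] that by simp
      from bracket_rs_sum[OF R \<beta>(2) \<gamma>(2) nz] show False
      proof
        assume "\<forall>h\<in>H. \<gamma> h = - \<beta> h"
        then have "\<beta> h = 0" if "h \<in> HC C" for h using \<gamma>0[OF that] HC_H[OF that] by force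
        then show False using RC_disjoint[OF sub \<beta>(1)] by blast
      next
        assume "(\<lambda>h. \<beta> h + \<gamma> h) \<in> \<Phi>"
        then consider "(\<lambda>h. \<beta> h + \<gamma> h) \<in> RC C" | "(\<lambda>h. \<beta> h + \<gamma> h) \<in> RC (D - C)"
          using roots_RC[OF C] by blast
        then show False
        proof cases
          case 1
          then have "\<gamma> h = 0" if "h \<in> HC (D - C)" for h using RC_vanish[OF 1 that] \<beta>0[OF that] by simp
          then show False using RC_disjoint[of "D - C" \<gamma>] \<gamma>(1) by blast
        next
          case 2
          then have "\<beta> h = 0" if "h \<in> HC C" for h
            using RC_vanish[OF 2, of h] that cc \<gamma>0[OF that] by simp
          then show False using RC_disjoint[OF sub \<beta>(1)] by blast
        qed
      qed
    qed
    moreover have "bracket x y = 0" if "x \<in> HC C" "y \<in> HC (D - C)"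
      using that HC_H H_commute by blast
    moreover have "bracket x y = 0" if "x \<in> HC C" "\<gamma> \<in> RC (D - C)" "y \<in> rs \<gamma>" for \<gamma>
      using RC_vanish[OF that(2), of x] that cc bracket_H_rs(1)[OF HC_H[OF that(1)] that(3)] by simp
    moreover have "bracket x y = 0" if "\<beta> \<in> RC C" "x \<in> rs \<beta>" "y \<in> HC (D - C)" for \<beta>
      using RC_vanish[OF that(1,3)] bracket_H_rs(2)[OF HC_H[OF that(3)] that(2)] by simp
    ultimately show "bracket x y \<in> {0}" using x y by blast
  qed
  then show ?thesis by simp
qed

lemma FC_bracket:
  assumes C: "component C" and x: "x \<in> FC C" and y: "y \<in> FC C"
  shows "bracket x y \<in> FC C"
proof (rule bracket_span_in[OF _ subspace_FC x[unfolded FC_def] y[unfolded FC_def]])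
  fix x y assume x: "x \<in> HC C \<union> (\<Union>\<beta>\<in>RC C. rs \<beta>)" and y: "y \<in> HC C \<union> (\<Union>\<beta>\<in>RC C. rs \<beta>)"
  have "bracket x y \<in> FC C" if \<beta>: "\<beta> \<in> RC C" "x \<in> rs \<beta>" and \<gamma>: "\<gamma> \<in> RC C" "y \<in> rs \<gamma>" for \<beta> \<gamma>
  proof (cases "bracket x y = 0")
    case True
    then show ?thesis using subspace_0[OF subspace_FC] by simp
  next
    case False
    have R: "\<beta> \<in> \<Phi>" "\<gamma> \<in> \<Phi>" using \<beta> \<gamma> RC_roots by blast+
    from bracket_rs_sum[OF R \<beta>(2) \<gamma>(2) False] show ?thesis
    proof
      assume "\<forall>h\<in>H. \<gamma> h = - \<beta> h"
      then have "y \<in> rs (\<lambda>h. - \<beta> h)" using \<gamma>(2) rs_cong[of \<gamma> "\<lambda>h. - \<beta> h"] by simp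
      then obtain c where "bracket x y = c *s cr \<beta>" using bracket_opposite[OF R(1) \<beta>(2)] by blast
      then show ?thesis
        using subspace_scale[OF subspace_FC subsetD[OF HC_FC coroot_HC[OF C \<beta>(1)]]] by simp
    next
      assume "(\<lambda>h. \<beta> h + \<gamma> h) \<in> \<Phi>"
      then have "(\<lambda>h. \<beta> h + \<gamma> h) \<in> RC C" using \<beta>(1) \<gamma>(1) by (simp add: RC_def)
      then show ?thesis using rs_FC rs_bracket[OF \<beta>(2) \<gamma>(2)] by blast
    qed
  qed
  moreover have "bracket x y \<in> FC C" if "x \<in> HC C" "y \<in> HC C"
    using H_commute[OF HC_H[OF that(1)] HC_H[OF that(2)]] subspace_0[OF subspace_FC] by simp
  moreover have "bracket x y \<in> FC C" if "x \<in> HC C" "\<gamma> \<in> RC C" "y \<in> rs \<gamma>" for \<gamma>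
    unfolding bracket_H_rs(1)[OF HC_H[OF that(1)] that(3)]
    using rs_FC[OF that(2)] that(3) by (intro subspace_scale[OF subspace_FC]) auto
  moreover have "bracket x y \<in> FC C" if "\<gamma> \<in> RC C" "x \<in> rs \<gamma>" "y \<in> HC C" for \<gamma>
    unfolding bracket_H_rs(2)[OF HC_H[OF that(3)] that(2)]
    using rs_FC[OF that(1)] that(2) by (intro subspace_scale[OF subspace_FC]) auto
  ultimately show "bracket x y \<in> FC C" using x y by blast
qed

lemma FC_span:
  assumes C: "component C"
  shows "span (FC C \<union> FC (D - C)) = UNIV"
proof -
  have sub: "C \<subseteq> D" by (rule componentD(1)[OF C])
  have "b \<in> span (FC C \<union> FC (D - C))" if b: "b \<in> B" for b
  proof -
    note rb = basis_rs[OF b]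
    show ?thesis
    proof (cases "\<exists>h\<in>H. wt b h \<noteq> 0")
      case True
      then have "wt b \<in> \<Phi>" using rb wt_outside by (auto simp: roots_iff)
      then have "b \<in> FC C \<union> FC (D - C)" using roots_RC[OF C] rb(1) rs_FC by blast
      then show ?thesis by (rule span_base)
    next
      case False
      then have bH: "b \<in> H" using rb(1) rs_zero[of "wt b"] by auto
      have "proj C b \<in> FC C" "proj (D - C) b \<in> FC (D - C)"
        using proj_HC HC_FC sub by blast+
      then have "proj C b + proj (D - C) b \<in> span (FC C \<union> FC (D - C))"
        by (intro span_add span_base) auto
      then show ?thesis using proj_add[OF sub bH] by simp
    qed
  qed
  then have "span B \<subseteq> span (FC C \<union> FC (D - C))" by (intro span_minimal subspace_span) auto
  then show ?thesis using span_B by auto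
qed

text \<open>The complementary \<open>FC (D - C)\<close> commutes with \<open>FC C\<close>, and
  together they span the algebra. This makes \<open>ideal_meets_H\<close> available for ideals of
  \<open>FC C\<close>.\<close>

lemma ideal_of_FC:
  assumes C: "component C" and J: "lie_ideal (FC C) J"
  shows "lie_ideal UNIV J"
proof -
  have "bracket x y \<in> J" if "y \<in> J" for x y
  proof (rule bracket_span_in[where X = "FC C \<union> FC (D - C)" and Y = J])
    fix x y assume x: "x \<in> FC C \<union> FC (D - C)" and y: "y \<in> J"
    have "bracket x y = 0" if "x \<in> FC (D - C)"
      using FC_commute[OF C _ that, of y] bracket_anti[of x y] y J by (auto simp: lie_ideal_def)
    then show "bracket x y \<in> J"
      using x y J subspace_0[of J] by (auto simp: lie_ideal_def)
  qed (use that J FC_span[OF C] in \<open>auto simp: lie_ideal_def intro: span_base\<close>)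
  then show ?thesis using J by (simp add: lie_ideal_def)
qed

lemma FC_ideal: "component C \<Longrightarrow> lie_ideal UNIV (FC C)"
  by (rule ideal_of_FC) (auto simp: lie_ideal_def subspace_FC FC_bracket)

section \<open>Cartan subalgebra, roots and coroots of the ideal\<close>

lemma FC_H:
  assumes C: "component C" and x: "x \<in> FC C" "x \<in> H"
  shows "x \<in> HC C"
proof -
  have "\<gamma> x = 0" if \<gamma>: "\<gamma> \<in> D - C" for \<gamma>
  proof -
    have \<gamma>R: "\<gamma> \<in> RC (D - C)" using simple_RC[of "D - C"] \<gamma> by blast
    then obtain v where v: "v \<in> rs \<gamma>" "v \<noteq> 0" using RC_roots by (fastforce simp: roots_iff)
    have "bracket x v = 0" using FC_commute[OF C x(1)] rs_FC[OF \<gamma>R] v(1) by blast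
    then show ?thesis using bracket_H_rs(1)[OF x(2) v(1)] v(2) by simp
  qed
  then show ?thesis using x(2) by (simp add: HC_def)
qed

text \<open>The complementary part of \<open>H\<close> commutes with \<open>FC C\<close>, so a
  weight vector for \<open>HC C\<close> is one for all of \<open>H\<close>, with its weight extended
  through \<open>proj C\<close>.\<close>

lemma FC_weight_vector:
  assumes C: "component C" and x: "x \<in> FC C" "\<And>h. h \<in> HC C \<Longrightarrow> bracket h x = \<alpha> h *s x"
  shows "x \<in> rs (\<lambda>h. \<alpha> (proj C h))"
  unfolding rs_iff
proof
  fix h assume h: "h \<in> H"
  have sub: "C \<subseteq> D" by (rule componentD(1)[OF C])
  have "proj (D - C) h \<in> FC (D - C)" using proj_HC[of "D - C"] HC_FC by blast
  then have "bracket (proj (D - C) h) x = 0"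
    using FC_commute[OF C x(1)] bracket_anti[of "proj (D - C) h" x] by simp
  moreover have "bracket h x = bracket (proj C h) x + bracket (proj (D - C) h) x"
    using proj_add[OF sub h] by (metis bracket_add_left)
  ultimately show "bracket h x = \<alpha> (proj C h) *s x" using x(2)[OF proj_HC[OF sub]] by simp
qed

lemma FC_cartan:
  assumes C: "component C"
  shows "cartan_subalgebra (FC C) (HC C)"
  unfolding cartan_subalgebra_def lie_subalgebra_def
proof (intro conjI ballI impI)
  show "subspace (HC C)" by (rule subspace_HC)
  show "HC C \<subseteq> FC C" by (rule HC_FC)
  show "bracket h k = 0" if "h \<in> HC C" "k \<in> HC C" for h k using that HC_H H_commute by blast
  then show "bracket h k \<in> HC C" if "h \<in> HC C" "k \<in> HC C" for h k
    using that subspace_0[OF subspace_HC] by simp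
  show "x \<in> HC C" if "x \<in> FC C" "\<forall>h\<in>HC C. bracket h x = 0" for x
  proof -
    have "x \<in> rs (\<lambda>h. (\<lambda>_. 0) (proj C h))" using that by (intro FC_weight_vector[OF C]) auto
    then have "x \<in> H" using rs_zero[of "\<lambda>_. 0"] by simp
    then show ?thesis using FC_H[OF C that(1)] by blast
  qed
  fix h assume h: "h \<in> HC C"
  show "FC C \<subseteq> span {x \<in> FC C. \<exists>c. bracket h x = c *s x}"
    unfolding FC_def
  proof (rule span_mono, rule subsetI)
    fix x assume x: "x \<in> HC C \<union> (\<Union>\<beta>\<in>RC C. rs \<beta>)"
    then have "x \<in> FC C" using HC_FC rs_FC by blast
    moreover have "\<exists>c. bracket h x = c *s x"
      using x
    proof
      assume "x \<in> HC C"
      then have "bracket h x = 0 *s x" using h HC_H H_commute by simp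
      then show ?thesis ..
    qed (use bracket_H_rs(1)[OF HC_H[OF h]] in blast)
    ultimately show "x \<in> {x \<in> span (HC C \<union> (\<Union>\<beta>\<in>RC C. rs \<beta>)). \<exists>c. bracket h x = c *s x}"
      by (simp add: FC_def)
  qed
qed


text \<open>Relative to \<open>HC C\<close>, \<open>dual_space\<close> wants functionals that vanish
  off \<open>HC C\<close>; \<open>restr\<close> renormalises the roots accordingly.\<close>

definition restr :: "('a \<Rightarrow> complex) set \<Rightarrow> ('a \<Rightarrow> complex) \<Rightarrow> 'a \<Rightarrow> complex" where
  "restr C \<alpha> = (\<lambda>h. if h \<in> HC C then \<alpha> h else 0)"

lemma RC_proj:
  assumes C: "C \<subseteq> D" and \<beta>: "\<beta> \<in> RC C" and h: "h \<in> H"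
  shows "\<beta> (proj C h) = \<beta> h"
proof -
  have \<beta>': "\<beta> \<in> \<Phi>" using \<beta> RC_roots by blast
  have "\<beta> (proj C h + proj (D - C) h) = \<beta> (proj C h) + \<beta> (proj (D - C) h)"
    by (rule root_add[OF \<beta>' proj_H[OF C] proj_H]) blast
  moreover have "\<beta> (proj (D - C) h) = 0" using RC_vanish[OF \<beta>] proj_HC[of "D - C"] by blast
  ultimately show ?thesis using proj_add[OF C h] by simp
qed

lemma RC_neg:
  assumes "\<beta> \<in> RC C" shows "(\<lambda>h. - \<beta> h) \<in> RC C"
  using assms root_neg by (simp add: RC_def)

lemma root_space_FC:
  assumes C: "component C" and \<beta>: "\<beta> \<in> RC C"
  shows "root_space (FC C) (HC C) (restr C \<beta>) = rs \<beta>"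
proof
  have sub: "C \<subseteq> D" by (rule componentD(1)[OF C])
  show "root_space (FC C) (HC C) (restr C \<beta>) \<subseteq> rs \<beta>"
  proof
    fix x assume "x \<in> root_space (FC C) (HC C) (restr C \<beta>)"
    then have x: "x \<in> FC C" "\<And>h. h \<in> HC C \<Longrightarrow> bracket h x = \<beta> h *s x"
      by (auto simp: root_space_def restr_def)
    have "x \<in> rs (\<lambda>h. \<beta> (proj C h))" using x by (rule FC_weight_vector[OF C])
    then show "x \<in> rs \<beta>" using rs_cong[of "\<lambda>h. \<beta> (proj C h)" \<beta>] RC_proj[OF sub \<beta>] by blast
  qed
  show "rs \<beta> \<subseteq> root_space (FC C) (HC C) (restr C \<beta>)"
    using rs_FC[OF \<beta>] HC_H by (auto simp: root_space_def restr_def)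
qed

text \<open>A bracket of opposite root vectors is a multiple of \<open>cr \<beta>\<close>, so it
  lies in \<open>HC C\<close>, where \<open>restr C \<beta>\<close> and \<open>\<beta>\<close>
  agree. Hence both coroots are picked out by the same condition.\<close>

lemma coroot_FC:
  assumes C: "component C" and \<beta>: "\<beta> \<in> RC C"
  shows "coroot (FC C) (HC C) (restr C \<beta>) = cr \<beta>"
proof -
  have \<beta>': "\<beta> \<in> \<Phi>" using \<beta> RC_roots by blast
  have "(\<lambda>h. - restr C \<beta> h) = restr C (\<lambda>h. - \<beta> h)" by (auto simp: restr_def fun_eq_iff)
  then have neg: "root_space (FC C) (HC C) (\<lambda>h. - restr C \<beta> h) = rs (\<lambda>h. - \<beta> h)"
    using root_space_FC[OF C RC_neg[OF \<beta>]] by simp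
  have "((\<exists>x\<in>rs \<beta>. \<exists>y\<in>rs (\<lambda>h. - \<beta> h). t = bracket x y) \<and> restr C \<beta> t = 2) =
      ((\<exists>x\<in>rs \<beta>. \<exists>y\<in>rs (\<lambda>h. - \<beta> h). t = bracket x y) \<and> \<beta> t = 2)" for t
  proof -
    have "restr C \<beta> t = \<beta> t" if xy: "x \<in> rs \<beta>" "y \<in> rs (\<lambda>h. - \<beta> h)" "t = bracket x y" for x y
    proof -
      obtain c where "bracket x y = c *s cr \<beta>" using bracket_opposite[OF \<beta>' xy(1,2)] .
      then have "t \<in> HC C" using subspace_scale[OF subspace_HC coroot_HC[OF C \<beta>]] xy(3) by simp
      then show ?thesis by (simp add: restr_def)
    qed
    then show ?thesis by metis
  qed
  then show ?thesis unfolding coroot_def root_space_FC[OF C \<beta>] neg by simp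
qed

lemma restr_root:
  assumes C: "component C" and \<beta>: "\<beta> \<in> RC C"
  shows "restr C \<beta> \<in> roots (FC C) (HC C)"
proof -
  have \<beta>': "\<beta> \<in> \<Phi>" using \<beta> RC_roots by blast
  have "restr C \<beta> \<in> dual_space (HC C)"
    unfolding dual_space_def mem_Collect_eq
  proof (intro conjI ballI allI impI)
    fix h k assume hk: "h \<in> HC C" "k \<in> HC C"
    then show "restr C \<beta> (h + k) = restr C \<beta> h + restr C \<beta> k"
      using subspace_add[OF subspace_HC hk] root_add[OF \<beta>' HC_H[OF hk(1)] HC_H[OF hk(2)]]
      by (simp add: restr_def)
  next
    fix c h assume h: "h \<in> HC C"
    then show "restr C \<beta> (c *s h) = c * restr C \<beta> h"
      using subspace_scale[OF subspace_HC h] root_scale[OF \<beta>' HC_H[OF h]] by (simp add: restr_def)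
  qed (simp add: restr_def)
  moreover have "restr C \<beta> \<noteq> (\<lambda>h. 0)"
  proof -
    obtain h where "h \<in> HC C" "\<beta> h \<noteq> 0" using RC_nonvanish[OF componentD(1)[OF C] \<beta>] .
    then have "restr C \<beta> h \<noteq> 0" by (simp add: restr_def)
    then show ?thesis by auto
  qed
  moreover have "rs \<beta> \<noteq> {0}" using \<beta>' by (auto simp: roots_iff)
  ultimately show ?thesis using root_space_FC[OF C \<beta>] by (simp add: roots_def)
qed

lemma roots_FC:
  assumes C: "component C" and \<gamma>: "\<gamma> \<in> roots (FC C) (HC C)"
  obtains \<beta> where "\<beta> \<in> RC C" "\<gamma> = restr C \<beta>"
proof -
  have sub: "C \<subseteq> D" by (rule componentD(1)[OF C])
  have \<gamma>d: "\<gamma> \<in> dual_space (HC C)" "\<gamma> \<noteq> (\<lambda>h. 0)" "root_space (FC C) (HC C) \<gamma> \<noteq> {0}"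
    using \<gamma> by (auto simp: roots_def)
  have out: "\<gamma> h = 0" if "h \<notin> HC C" for h using \<gamma>d(1) that by (simp add: dual_space_def)
  have zero: "\<gamma> 0 = 0"
  proof -
    have "\<gamma> (0 *s 0) = 0 * \<gamma> 0"
      using \<gamma>d(1) subspace_0[OF subspace_HC, of C] unfolding dual_space_def by blast
    then show ?thesis by simp
  qed
  have "0 \<in> root_space (FC C) (HC C) \<gamma>"
    using subspace_0[OF subspace_FC] by (simp add: root_space_def)
  then obtain x where x: "x \<in> root_space (FC C) (HC C) \<gamma>" "x \<noteq> 0" using \<gamma>d(3) by blast
  then have xw: "x \<in> rs (\<lambda>h. \<gamma> (proj C h))"
    by (intro FC_weight_vector[OF C]) (auto simp: root_space_def)
  obtain h where h: "h \<in> HC C" "\<gamma> h \<noteq> 0" using \<gamma>d(2) out by fastforce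
  \<comment> \<open>Composing with the projection extends \<open>\<gamma>\<close> from
    \<open>HC C\<close> to \<open>H\<close>, and \<open>weight_root\<close> recognises the result as
    a root.\<close>
  define \<beta> where "\<beta> h = (if h \<in> H then \<gamma> (proj C h) else 0)" for h
  have "\<gamma> (proj C h) \<noteq> 0" using proj_eq[OF sub h(1)] h(2) by simp
  then have \<beta>': "\<beta> \<in> \<Phi>" unfolding \<beta>_def by (rule weight_root[OF xw x(2) HC_H[OF h(1)]])
  have "\<beta> h = 0" if "h \<in> HC (D - C)" for h
  proof -
    have "\<alpha> h = 0" if "\<alpha> \<in> C" for \<alpha> using \<open>h \<in> HC (D - C)\<close> that sub by (auto simp: HC_def)
    then have "proj C h = 0" unfolding proj_def by (intro sum.neutral) simp
    then show ?thesis using zero by (simp add: \<beta>_def)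
  qed
  then have "\<beta> \<in> RC C" using \<beta>' by (simp add: RC_def)
  moreover have "\<gamma> = restr C \<beta>"
    using proj_eq[OF sub] out HC_H by (auto simp: restr_def \<beta>_def fun_eq_iff)
  ultimately show ?thesis using that by blast
qed

lemma coweight_HC: "C \<subseteq> D \<Longrightarrow> \<alpha> \<in> C \<Longrightarrow> coweight \<alpha> \<in> HC C"
proof -
  assume "C \<subseteq> D" "\<alpha> \<in> C"
  then have \<alpha>: "\<alpha> \<in> D" by blast
  have "\<gamma> (coweight \<alpha>) = 0" if "\<gamma> \<in> D - C" for \<gamma> using coweight_dual[OF \<alpha>, of \<gamma>] that \<open>\<alpha> \<in> C\<close> by auto
  then show "coweight \<alpha> \<in> HC C" using coweight_H[OF \<alpha>] by (simp add: HC_def)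
qed

lemma restr_coweight:
  assumes "C \<subseteq> D" "\<alpha> \<in> C" "\<beta> \<in> C"
  shows "restr C \<beta> (coweight \<alpha>) = (if \<alpha> = \<beta> then 1 else 0)"
proof -
  have "\<alpha> \<in> D" "\<beta> \<in> D" using assms by blast+
  then show ?thesis using coweight_HC[OF assms(1,2)] coweight_dual[of \<alpha> \<beta>] by (simp add: restr_def)
qed

lemma inj_on_restr:
  assumes C: "C \<subseteq> D"
  shows "inj_on (restr C) C"
proof (rule inj_onI, rule ccontr)
  fix \<alpha> \<beta> assume ab: "\<alpha> \<in> C" "\<beta> \<in> C" "restr C \<alpha> = restr C \<beta>" "\<alpha> \<noteq> \<beta>"
  then show False using restr_coweight[OF C ab(1,1)] restr_coweight[OF C ab(1,2)] by simp
qed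

lemma simple_roots_FC:
  assumes C: "component C"
  shows "simple_roots (FC C) (HC C) (restr C ` C)"
proof -
  have sub: "C \<subseteq> D" by (rule componentD(1)[OF C])
  have fin: "finite C" using sub finite_D finite_subset by blast
  note inj = inj_on_restr[OF sub]
  have "restr C ` C \<subseteq> roots (FC C) (HC C)"
    using restr_root[OF C] simple_RC[OF sub] by blast
  moreover have "c \<gamma> = 0" if c: "\<forall>h\<in>HC C. (\<Sum>\<alpha>\<in>restr C ` C. c \<alpha> * \<alpha> h) = 0" and \<gamma>: "\<gamma> \<in> restr C ` C"
    for c :: "('a \<Rightarrow> complex) \<Rightarrow> complex" and \<gamma>
  proof -
    obtain \<alpha> where \<alpha>: "\<alpha> \<in> C" "\<gamma> = restr C \<alpha>" using \<gamma> by blast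
    have "(\<Sum>\<delta>\<in>restr C ` C. c \<delta> * \<delta> (coweight \<alpha>)) = (\<Sum>\<beta>\<in>C. c (restr C \<beta>) * restr C \<beta> (coweight \<alpha>))"
      using sum.reindex[OF inj] by simp
    also have "\<dots> = (\<Sum>\<beta>\<in>C. if \<beta> = \<alpha> then c \<gamma> else 0)"
    proof (rule sum.cong[OF HOL.refl])
      fix \<beta> assume "\<beta> \<in> C"
      then show "c (restr C \<beta>) * restr C \<beta> (coweight \<alpha>) = (if \<beta> = \<alpha> then c \<gamma> else 0)"
        using restr_coweight[OF sub \<alpha>(1), of \<beta>] \<alpha>(2) by auto
    qed
    also have "\<dots> = c \<gamma>" using fin \<alpha> by simp
    finally show ?thesis using c coweight_HC[OF sub \<alpha>(1)] by simp
  qed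
  moreover have "\<exists>n :: ('a \<Rightarrow> complex) \<Rightarrow> nat.
      (\<forall>h\<in>HC C. \<gamma> h = (\<Sum>\<alpha>\<in>restr C ` C. of_nat (n \<alpha>) * \<alpha> h)) \<or>
      (\<forall>h\<in>HC C. \<gamma> h = - (\<Sum>\<alpha>\<in>restr C ` C. of_nat (n \<alpha>) * \<alpha> h))"
    if \<gamma>: "\<gamma> \<in> roots (FC C) (HC C)" for \<gamma>
  proof -
    obtain \<beta> where \<beta>: "\<beta> \<in> RC C" "\<gamma> = restr C \<beta>" using roots_FC[OF C \<gamma>] .
    have \<beta>': "\<beta> \<in> \<Phi>" using \<beta> RC_roots by blast
    obtain n :: "('a \<Rightarrow> complex) \<Rightarrow> nat" where n:
      "(\<forall>h\<in>H. \<beta> h = (\<Sum>\<alpha>\<in>D. of_nat (n \<alpha>) * \<alpha> h)) \<or> (\<forall>h\<in>H. \<beta> h = - (\<Sum>\<alpha>\<in>D. of_nat (n \<alpha>) * \<alpha> h))"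
      using simple \<beta>' unfolding simple_roots_def by meson
    \<comment> \<open>Coefficients inside the ideal are indexed by restricted functionals, so those
      of \<open>\<beta>\<close> are carried over along the injection \<open>restr C\<close>.\<close>
    define m where "m \<delta> = n (the_inv_into C (restr C) \<delta>)" for \<delta>
    have eq: "(\<Sum>\<alpha>\<in>D. of_nat (n \<alpha>) * \<alpha> h) = (\<Sum>\<alpha>\<in>restr C ` C. of_nat (m \<alpha>) * \<alpha> h)"
      if h: "h \<in> HC C" for h
    proof -
      have "(\<Sum>\<alpha>\<in>D. of_nat (n \<alpha>) * \<alpha> h) = (\<Sum>\<alpha>\<in>C. of_nat (n \<alpha>) * \<alpha> h)"
      proof (rule sum.mono_neutral_right[OF finite_D sub], rule ballI)
        fix \<alpha> assume "\<alpha> \<in> D - C"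
        then have "\<alpha> h = 0" using h unfolding HC_def by blast
        then show "of_nat (n \<alpha>) * \<alpha> h = 0" by simp
      qed
      also have "\<dots> = (\<Sum>\<alpha>\<in>C. of_nat (m (restr C \<alpha>)) * restr C \<alpha> h)"
      proof (rule sum.cong[OF HOL.refl])
        fix \<alpha> assume "\<alpha> \<in> C"
        then have "m (restr C \<alpha>) = n \<alpha>" by (simp add: m_def the_inv_into_f_f[OF inj])
        then show "of_nat (n \<alpha>) * \<alpha> h = of_nat (m (restr C \<alpha>)) * restr C \<alpha> h"
          using h by (simp add: restr_def)
      qed
      also have "\<dots> = (\<Sum>\<alpha>\<in>restr C ` C. of_nat (m \<alpha>) * \<alpha> h)"
        using sum.reindex[OF inj, of "\<lambda>\<alpha>. of_nat (m \<alpha>) * \<alpha> h"] by (simp add: o_def)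
      finally show ?thesis .
    qed
    have \<gamma>h: "\<gamma> h = \<beta> h" if "h \<in> HC C" for h using that \<beta>(2) by (simp add: restr_def)
    from n show ?thesis
    proof
      assume "\<forall>h\<in>H. \<beta> h = (\<Sum>\<alpha>\<in>D. of_nat (n \<alpha>) * \<alpha> h)"
      then have "\<forall>h\<in>HC C. \<gamma> h = (\<Sum>\<alpha>\<in>restr C ` C. of_nat (m \<alpha>) * \<alpha> h)"
        using eq \<gamma>h HC_H by simp
      then show ?thesis by blast
    next
      assume "\<forall>h\<in>H. \<beta> h = - (\<Sum>\<alpha>\<in>D. of_nat (n \<alpha>) * \<alpha> h)"
      then have "\<forall>h\<in>HC C. \<gamma> h = - (\<Sum>\<alpha>\<in>restr C ` C. of_nat (m \<alpha>) * \<alpha> h)"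
        using eq \<gamma>h HC_H by simp
      then show ?thesis by blast
    qed
  qed
  ultimately show ?thesis unfolding simple_roots_def using fin by blast
qed

section \<open>Simplicity of the ideal of a connected block\<close>

lemma HC_span_coroots:
  assumes C: "component C"
  shows "HC C \<subseteq> span (cr ` C)"
proof (rule card_ge_dim_independent)
  have sub: "C \<subseteq> D" by (rule componentD(1)[OF C])
  have fin: "finite C" using sub finite_D finite_subset by blast
  \<comment> \<open>The Killing form pairs coweights and coroots of \<open>C\<close> diagonally with
    nonzero diagonal entries, so the coroots are independent. There are \<open>card C\<close> of
    them, and the coweights spanning \<open>HC C\<close> bound its dimension by the same
    number.\<close>
  have kill: "killing (coweight \<alpha>) (cr \<beta>) = (if \<alpha> = \<beta> then killing (cr \<beta>) (cr \<beta>) / 2 else 0)"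
    if "\<alpha> \<in> C" "\<beta> \<in> C" for \<alpha> \<beta>
  proof -
    have "\<alpha> \<in> D" "\<beta> \<in> D" "\<beta> \<in> \<Phi>" using that sub D_roots by blast+
    then show ?thesis
      using killing_coroot[of \<beta> "coweight \<alpha>"] coweight_H[of \<alpha>] coweight_dual[of \<alpha> \<beta>] by (cases "\<alpha> = \<beta>") simp_all
  qed
  have knz: "killing (cr \<beta>) (cr \<beta>) \<noteq> 0" if "\<beta> \<in> C" for \<beta>
    using killing_coroot_nonzero that sub D_roots by blast
  have inj: "inj_on cr C"
  proof (rule inj_onI, rule ccontr)
    fix \<alpha> \<beta> assume ab: "\<alpha> \<in> C" "\<beta> \<in> C" "cr \<alpha> = cr \<beta>" "\<alpha> \<noteq> \<beta>"
    then show False using kill[of \<alpha> \<alpha>] kill[of \<alpha> \<beta>] knz[of \<alpha>] by simp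
  qed
  show "cr ` C \<subseteq> HC C" using coroot_HC[OF C] simple_RC[OF sub] by blast
  show "independent (cr ` C)"
  proof (rule independent_if_scalars_zero)
    show "finite (cr ` C)" using fin by simp
    fix f x assume f: "(\<Sum>y\<in>cr ` C. f y *s y) = 0" and "x \<in> cr ` C"
    then obtain \<alpha> where \<alpha>: "\<alpha> \<in> C" "x = cr \<alpha>" by blast
    have "0 = killing (coweight \<alpha>) (\<Sum>\<beta>\<in>C. f (cr \<beta>) *s cr \<beta>)"
      using f sum.reindex[OF inj, of "\<lambda>y. f y *s y"] by simp
    also have "\<dots> = (\<Sum>\<beta>\<in>C. if \<beta> = \<alpha> then f x * (killing x x / 2) else 0)"
      unfolding killing_sum_right
    proof (rule sum.cong[OF HOL.refl])
      fix \<beta> assume "\<beta> \<in> C"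
      then show "killing (coweight \<alpha>) (f (cr \<beta>) *s cr \<beta>) = (if \<beta> = \<alpha> then f x * (killing x x / 2) else 0)"
        using kill[OF \<alpha>(1)] \<alpha>(2) by (auto simp: killing_scale_right)
    qed
    also have "\<dots> = f x * (killing x x / 2)" using fin \<alpha> by simp
    finally show "f x = 0" using knz[OF \<alpha>(1)] \<alpha>(2) by simp
  qed
  have "HC C \<subseteq> span (coweight ` C)"
  proof
    fix h assume "h \<in> HC C"
    then have "h = (\<Sum>\<alpha>\<in>C. \<alpha> h *s coweight \<alpha>)" using proj_eq[OF sub] by (simp add: proj_def)
    moreover have "(\<Sum>\<alpha>\<in>C. \<alpha> h *s coweight \<alpha>) \<in> span (coweight ` C)"
      by (intro span_sum span_scale span_base) auto
    ultimately show "h \<in> span (coweight ` C)" by simp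
  qed
  then have "dim (HC C) \<le> card (coweight ` C)" using fin by (intro dim_le_card) auto
  also have "\<dots> \<le> card C" using fin by (rule card_image_le)
  also have "\<dots> = card (cr ` C)" using card_image[OF inj] by simp
  finally show "dim (HC C) \<le> card (cr ` C)" .
qed

lemma ideal_absorbs_root:
  assumes J: "lie_ideal UNIV J" and h: "h \<in> J" "h \<in> H" and \<beta>: "\<beta> \<in> \<Phi>" "\<beta> h \<noteq> 0"
  shows "rs \<beta> \<subseteq> J" and "cr \<beta> \<in> J"
proof -
  have sJ: "subspace J" and lJ: "\<And>x y. y \<in> J \<Longrightarrow> bracket x y \<in> J"
    using J by (simp_all add: lie_ideal_def)
  have iJ: "bracket y x \<in> J" if "y \<in> J" for x y
    using subspace_neg[OF sJ lJ[OF that, of x]] bracket_anti[of y x] by simp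
  show rsJ: "rs \<beta> \<subseteq> J"
  proof
    fix x assume "x \<in> rs \<beta>"
    then have "bracket h x = \<beta> h *s x" using h(2) by (simp add: rs_iff)
    then have "\<beta> h *s x \<in> J" using iJ[OF h(1), of x] by simp
    from subspace_scale[OF sJ this, of "1 / \<beta> h"] show "x \<in> J" using \<beta>(2) by simp
  qed
  obtain e f where "e \<in> rs \<beta>" "cr \<beta> = bracket e f" using coroot_triple[OF \<beta>(1)] by metis
  then show "cr \<beta> \<in> J" using rsJ iJ by auto
qed

text \<open>Connectedness without paths, in terms of subsets closed under passing to neighbours.
  \<open>FC_simple\<close> uses it for the set of nodes whose coroot lies in a given ideal.\<close>

definition dynkin_connected :: "('a \<Rightarrow> complex) set \<Rightarrow> bool" where
  "dynkin_connected C \<longleftrightarrow> C \<noteq> {} \<and>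
     (\<forall>T. T \<subseteq> C \<longrightarrow> T \<noteq> {} \<longrightarrow> (\<forall>\<alpha>\<in>T. \<forall>\<beta>\<in>C. \<beta> (cr \<alpha>) \<noteq> 0 \<longrightarrow> \<beta> \<in> T) \<longrightarrow> T = C)"

text \<open>A nonzero ideal contains a nonzero \<open>h\<close> in \<open>H\<close>, on which some
  simple root of \<open>C\<close> does not vanish. That root brings its coroot into the ideal, and
  the coroots spread along the edges of the diagram. With all of \<open>HC C\<close> inside, every
  root space of the block follows.\<close>

lemma FC_simple:
  assumes C: "component C" and conn: "dynkin_connected C"
  shows "simple_factor UNIV (FC C)"
proof -
  have sub: "C \<subseteq> D" by (rule componentD(1)[OF C])
  have "J = {0} \<or> J = FC C" if J: "lie_ideal (FC C) J" for J
  proof (cases "J \<inter> H \<subseteq> {0}")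
    case True
    then show ?thesis using ideal_meets_H ideal_of_FC[OF C J] by blast
  next
    case False
    have J': "lie_ideal UNIV J" by (rule ideal_of_FC[OF C J])
    have JF: "J \<subseteq> FC C" and sJ: "subspace J" using J by (auto simp: lie_ideal_def)
    obtain h where h: "h \<in> J" "h \<in> H" "h \<noteq> 0" using False by blast
    have hC: "h \<in> HC C" using FC_H[OF C _ h(2)] JF h(1) by blast
    obtain \<alpha> where \<alpha>: "\<alpha> \<in> D" "\<alpha> h \<noteq> 0" using D_separates[OF h(2)] h(3) by blast
    then have \<alpha>C: "\<alpha> \<in> C" using hC unfolding HC_def by blast
    define T where "T = {\<alpha> \<in> C. cr \<alpha> \<in> J}"
    have \<alpha>': "\<alpha> \<in> \<Phi>" using \<alpha>(1) D_roots by blast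
    have "cr \<alpha> \<in> J" by (rule ideal_absorbs_root(2)[OF J' h(1,2) \<alpha>' \<alpha>(2)])
    then have "\<alpha> \<in> T" using \<alpha>C by (simp add: T_def)
    moreover have "\<beta> \<in> T" if "\<alpha> \<in> T" "\<beta> \<in> C" "\<beta> (cr \<alpha>) \<noteq> 0" for \<alpha> \<beta>
    proof -
      have \<alpha>\<beta>: "\<alpha> \<in> \<Phi>" "\<beta> \<in> \<Phi>" "cr \<alpha> \<in> J" using that sub D_roots by (auto simp: T_def)
      have "cr \<beta> \<in> J" by (rule ideal_absorbs_root(2)[OF J' \<alpha>\<beta>(3) coroot_H[OF \<alpha>\<beta>(1)] \<alpha>\<beta>(2) that(3)])
      then show ?thesis using that by (simp add: T_def)
    qed
    moreover have "T \<subseteq> C" by (auto simp: T_def)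
    ultimately have "T = C" using conn unfolding dynkin_connected_def by blast
    then have "cr ` C \<subseteq> J" by (auto simp: T_def)
    then have HJ: "HC C \<subseteq> J" using HC_span_coroots[OF C] span_minimal[OF _ sJ] by blast
    have "rs \<beta> \<subseteq> J" if \<beta>: "\<beta> \<in> RC C" for \<beta>
    proof -
      obtain h where h: "h \<in> HC C" "\<beta> h \<noteq> 0" using RC_nonvanish[OF sub \<beta>] .
      have \<beta>': "\<beta> \<in> \<Phi>" using \<beta> RC_roots by blast
      show ?thesis by (rule ideal_absorbs_root(1)[OF J' subsetD[OF HJ h(1)] HC_H[OF h(1)] \<beta>' h(2)])
    qed
    then have "FC C \<subseteq> J" unfolding FC_def using HJ sJ by (intro span_minimal) auto
    then show ?thesis using JF by blast
  qed
  moreover have "lie_subalgebra (FC C)"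
    using FC_bracket[OF C] subspace_FC by (simp add: lie_subalgebra_def)
  moreover have "\<exists>x\<in>FC C. \<exists>y\<in>FC C. bracket x y \<noteq> 0"
  proof -
    obtain \<alpha> where \<alpha>: "\<alpha> \<in> C" using conn by (auto simp: dynkin_connected_def)
    then have \<alpha>R: "\<alpha> \<in> RC C" "\<alpha> \<in> \<Phi>" using simple_RC[OF sub] RC_roots by blast+
    obtain e f where e: "e \<in> rs \<alpha>" "f \<in> rs (\<lambda>h. - \<alpha> h)" "cr \<alpha> = bracket e f"
      using coroot_triple[OF \<alpha>R(2)] by metis
    have "cr \<alpha> \<noteq> 0"
      using root_coroot[OF \<alpha>R(2)] root_scale[OF \<alpha>R(2) subspace_0[OF subspace_H], of 0] by auto
    then show ?thesis using e rs_FC[OF \<alpha>R(1)] rs_FC[OF RC_neg[OF \<alpha>R(1)]] by auto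
  qed
  ultimately show ?thesis
    using FC_ideal[OF C] unfolding simple_factor_def simple_lie_def by blast
qed

text \<open>A block given by \<open>ir.cartan_component\<close> is separated from the other nodes.
  The condition on \<open>M\<close> joins consecutive nodes in both directions and so makes the
  block connected; the types in question satisfy it, their diagrams being paths in the given
  numbering.\<close>

lemma simple_factor_of_component:
  assumes comp: "ir.cartan_component n M" and n: "0 < n"
    and M: "\<And>i. Suc i < n \<Longrightarrow> M i (Suc i) \<noteq> 0 \<and> M (Suc i) i \<noteq> 0"
  shows "\<exists>F. simple_factor UNIV F \<and> has_cartan_matrix F n M"
proof -
  obtain a where *: "inj_on a {..<n} \<and> a ` {..<n} \<subseteq> D \<and>
     (\<forall>i<n. \<forall>j<n. A (a i) (a j) = M i j) \<and> (\<forall>i<n. \<forall>k\<in>D - a ` {..<n}. A (a i) k = 0)"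
    using comp unfolding ir.cartan_component_def by (elim exE)
  then have a: "inj_on a {..<n}" "a ` {..<n} \<subseteq> D"
    "\<And>i j. i < n \<Longrightarrow> j < n \<Longrightarrow> A (a i) (a j) = M i j"
    "\<And>i k. i < n \<Longrightarrow> k \<in> D - a ` {..<n} \<Longrightarrow> A (a i) k = 0" by simp_all
  let ?C = "a ` {..<n}"
  have aR: "a i \<in> \<Phi>" if "i < n" for i using a(2) that D_roots by auto
  have C: "component ?C"
    unfolding component_def
  proof (intro conjI ballI)
    fix \<alpha> \<gamma> assume "\<alpha> \<in> ?C" and \<gamma>: "\<gamma> \<in> D - ?C"
    then obtain i where i: "i < n" "\<alpha> = a i" by blast
    have "of_int (A (a i) \<gamma>) = \<gamma> (cr (a i))" using A_eq[OF aR[OF i(1)]] \<gamma> D_roots by blast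
    then show "\<gamma> (cr \<alpha>) = 0" using a(4)[OF i(1) \<gamma>] i(2) by simp
  qed (rule a(2))
  have val: "a j (cr (a i)) = of_int (M i j)" if "i < n" "j < n" for i j
    using A_eq[OF aR[OF that(1)] aR[OF that(2)]] a(3)[OF that] by simp
  have "dynkin_connected ?C"
    unfolding dynkin_connected_def
  proof (intro conjI allI impI)
    show "?C \<noteq> {}" using n by auto
    fix T assume T: "T \<subseteq> ?C" "T \<noteq> {}" "\<forall>\<alpha>\<in>T. \<forall>\<beta>\<in>?C. \<beta> (cr \<alpha>) \<noteq> 0 \<longrightarrow> \<beta> \<in> T"
    have step: "a j \<in> T" if "a i \<in> T" "i < n" "j < n" "M i j \<noteq> 0" for i j
      using T(3) that val[OF that(2,3)] by simp
    obtain k where k: "k < n" "a k \<in> T" using T(1,2) by blast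
    \<comment> \<open>Walk from the node \<open>k\<close> down to \<open>0\<close>, where truncated
      subtraction stops; the next induction walks up through all nodes.\<close>
    have "a (k - i) \<in> T" for i
    proof (induction i)
      case (Suc i)
      show ?case
      proof (cases "k - i")
        case (Suc m)
        then have "k - Suc i = m" by simp
        then show ?thesis using step[of "Suc m" m] Suc.IH Suc M[of m] k(1) by simp
      qed (use Suc.IH in simp)
    qed (use k in simp)
    from this[of k] have 0: "a 0 \<in> T" by simp
    have "i < n \<Longrightarrow> a i \<in> T" for i
    proof (induction i)
      case (Suc i)
      then show ?case using step[of i "Suc i"] M[of i] by simp
    qed (use 0 in simp)
    then show "T = ?C" using T(1) by blast
  qed
  then have "simple_factor UNIV (FC ?C)" by (rule FC_simple[OF C])
  moreover have "has_cartan_matrix (FC ?C) n M"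
    unfolding has_cartan_matrix_def
  proof (intro exI[of _ "HC ?C"] exI[of _ "\<lambda>i. restr ?C (a i)"] conjI allI impI)
    show "cartan_subalgebra (FC ?C) (HC ?C)" by (rule FC_cartan[OF C])
    show "inj_on (\<lambda>i. restr ?C (a i)) {..<n}"
      using comp_inj_on[OF a(1) inj_on_restr[OF a(2)]] by (simp add: o_def)
    show "simple_roots (FC ?C) (HC ?C) ((\<lambda>i. restr ?C (a i)) ` {..<n})"
      using simple_roots_FC[OF C] by (simp add: image_image)
    fix i j assume ij: "i < n" "j < n"
    then have R: "a i \<in> RC ?C" using simple_RC[OF a(2)] by blast
    show "restr ?C (a j) (coroot (FC ?C) (HC ?C) (restr ?C (a i))) = of_int (M i j)"
      unfolding coroot_FC[OF C R] using coroot_HC[OF C R] val[OF ij] by (simp add: restr_def)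
  qed
  ultimately show ?thesis by blast
qed

lemma weyl_group_fat_ideal:
  assumes fat: "fat_ideal W (simple_reflections UNIV H D) I"
  shows "((\<nexists>F. simple_factor UNIV F \<and> type_A 1 F) \<longrightarrow>
            (\<forall>w\<in>carrier W. word_length W (simple_reflections UNIV H D) w \<le> 1 \<longrightarrow> w \<in> I)) \<and>
         ((\<nexists>F. simple_factor UNIV F \<and> (type_A 1 F \<or> type_A 2 F \<or> type_A 3 F \<or> type_B 2 F)) \<longrightarrow>
            (\<forall>w\<in>carrier W. word_length W (simple_reflections UNIV H D) w \<le> 2 \<longrightarrow> w \<in> I))"
proof -
  have S: "simple_reflections UNIV H D = refl ` D"
    by (simp add: simple_reflections_def refl_def)
  have comp_A: "\<exists>F. simple_factor UNIV F \<and> type_A n F"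
    if "ir.cartan_component n cartan_matrix_A" "0 < n" for n
    unfolding type_A_def
    by (rule simple_factor_of_component[OF that]) (simp add: cartan_matrix_A_def)
  have comp_B: "\<exists>F. simple_factor UNIV F \<and> type_B 2 F"
    if "ir.cartan_component 2 (cartan_matrix_B 2)"
    unfolding type_B_def
    by (rule simple_factor_of_component[OF that]) (auto simp: cartan_matrix_A_def cartan_matrix_B_def)
  show ?thesis
    unfolding S
  proof (intro conjI impI ballI)
    fix w assume "\<nexists>F. simple_factor UNIV F \<and> type_A 1 F" "w \<in> carrier W" "word_length W (refl ` D) w \<le> 1"
    then show "w \<in> I"
      using ww.fat_ideal_length_le_1[OF fat[unfolded S]] comp_A[of 1] by auto
  next
    fix w assume no: "\<nexists>F. simple_factor UNIV F \<and> (type_A 1 F \<or> type_A 2 F \<or> type_A 3 F \<or> type_B 2 F)"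
      and w: "w \<in> carrier W" "word_length W (refl ` D) w \<le> 2"
    have "\<not> ir.cartan_component 1 cartan_matrix_A" "\<not> ir.cartan_component 2 cartan_matrix_A"
      "\<not> ir.cartan_component 3 cartan_matrix_A" "\<not> ir.cartan_component 2 (cartan_matrix_B 2)"
      using no comp_A[of 1] comp_A[of 2] comp_A[of 3] comp_B by auto
    then show "w \<in> I" using ww.fat_ideal_length_le_2[OF fat[unfolded S]] w by blast
  qed
qed

end

theorem theorem4p1:
  fixes scale :: "complex \<Rightarrow> 'g::ab_group_add \<Rightarrow> 'g"
    and bracket :: "'g \<Rightarrow> 'g \<Rightarrow> 'g"
    and H :: "'g set"
    and \<Delta> :: "('g \<Rightarrow> complex) set"
    and W :: "('g \<Rightarrow> 'g) monoid"
    and S :: "('g \<Rightarrow> 'g) set"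
    and I :: "('g \<Rightarrow> 'g) set"
  assumes "complex_lie_algebra scale bracket"
    and "complex_lie_algebra.semisimple_lie scale bracket UNIV"
    and "complex_lie_algebra.cartan_subalgebra scale bracket UNIV H"
    and "complex_lie_algebra.simple_roots scale bracket UNIV H \<Delta>"
    and "W = complex_lie_algebra.weyl_group scale bracket UNIV H \<Delta>"
    and "S = complex_lie_algebra.simple_reflections scale bracket UNIV H \<Delta>"
    and "fat_ideal W S I"
  shows "((\<nexists>F. complex_lie_algebra.simple_factor scale bracket UNIV F \<and>
                complex_lie_algebra.type_A scale bracket 1 F)
            \<longrightarrow> (\<forall>w\<in>carrier W. word_length W S w \<le> 1 \<longrightarrow> w \<in> I))
       \<and> ((\<nexists>F. complex_lie_algebra.simple_factor scale bracket UNIV F \<and>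
                (complex_lie_algebra.type_A scale bracket 1 F \<or>
                 complex_lie_algebra.type_A scale bracket 2 F \<or>
                 complex_lie_algebra.type_A scale bracket 3 F \<or>
                 complex_lie_algebra.type_B scale bracket 2 F))
            \<longrightarrow> (\<forall>w\<in>carrier W. word_length W S w \<le> 2 \<longrightarrow> w \<in> I))"
proof -
  interpret complex_lie_algebra scale bracket by (rule assms(1))
  obtain B wt where *: "finite B \<and> independent B \<and> span B = UNIV \<and>
     (\<forall>b\<in>B. \<forall>h\<in>H. bracket h b = scale (wt b h) b) \<and> (\<forall>b. \<forall>h. h \<notin> H \<longrightarrow> wt b h = 0)"
    using weight_basis_exists[OF assms(3)] by (elim exE)
  then have B: "finite B" "independent B" "span B = UNIV"
    "\<And>b h. b \<in> B \<Longrightarrow> h \<in> H \<Longrightarrow> bracket h b = scale (wt b h) b" "\<And>b h. h \<notin> H \<Longrightarrow> wt b h = 0"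
    by simp_all
  interpret root_basis scale bracket H B wt \<Delta>
    by unfold_locales (fact assms B)+
  show ?thesis
    unfolding assms(5,6) by (rule weyl_group_fat_ideal[OF assms(7)[unfolded assms(5,6)]])
qed

end
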